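(* Let $q,a,b,x,y,z,h$ be non-zero complex numbers with $|q|<1$ and $|q^3a^6|<|bxyz|^2$, and assume there are no vanishing denominator factors. Then $${}_{10}W_9\!\left(a^2;b^2,x,qx,y,qy,z,qz;q^2,\frac{q^3a^6}{(bxyz)^2}\right)=\frac{(\pm qa,x,y,z,\frac{qa^2}{xy},\frac{qa^2}{xz},\frac{qa^2}{yz};q)_\infty}{\vartheta(h,h\frac{xyz}{qa^2};q)\,(\pm\frac{qa}b,\frac{qa^2}x,\frac{qa^2}y,\frac{qa^2}z;q)_\infty}$$ $$\times\Bigg(F(x;y,z)+F(y;x,z)+F(z;y,x)+\frac{(\pm b;q)_\infty}{2(-q;q)_\infty}\big(E_1+E_{-1}\big)\Bigg),$$ where $$F(x;y,z)=\frac{\vartheta(hx,h\frac{yz}{qa^2};q)\,(\pm\frac{\sqrt q\,a}x,\frac{qa^2}{b^2x};q)_\infty}{(x,\frac yx,\frac zx,\frac{qa^2}{yz},\pm\frac{\sqrt q\,a}{bx};q)_\infty}\,{}_5\phi_4\!\left(x,\tfrac{qa^2}{yz},\pm\tfrac{\sqrt q\,x}a,\tfrac{b^2x}{a^2};\tfrac{qx}y,\tfrac{qx}z,\pm\tfrac{\sqrt q\,bx}a;q,q\right)$$ and, for $\epsilon\in\{1,-1\}$, $$E_\epsilon=\frac{\vartheta(\epsilon h\frac{\sqrt q\,a}b,\epsilon h\frac{bxyz}{q^{3/2}a^3};q)}{(\frac{\epsilon q^{3/2}a^3}{bxyz},\frac{\epsilon bx}{\sqrt q\,a},\frac{\epsilon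 by}{\sqrt q\,a},\frac{\epsilon bz}{\sqrt q\,a};q)_\infty}\,{}_5\phi_4\!\left(\pm\tfrac qb,\tfrac{\epsilon\sqrt q\,a}b,\tfrac{\epsilon\sqrt q\,b}a,\tfrac{\epsilon q^{3/2}a^3}{bxyz};-q,\tfrac{\epsilon q^{3/2}a}{bx},\tfrac{\epsilon q^{3/2}a}{by},\tfrac{\epsilon q^{3/2}a}{bz};q,q\right).$$
   Context: Notation. $(a;q)_k=\prod_{j=0}^{k-1}(1-aq^j)$, $(a;q)_\infty=\prod_{j\ge0}(1-aq^j)$, $(a_1,\dots,a_r;q)_k=\prod_j(a_j;q)_k$ for $k\in\mathbb N_0\cup\{\infty\}$. In a list, $\pm t$ stands for the two entries $t,-t$. $\vartheta(t;q)=(t,q/t;q)_\infty$ for $t\ne0$, $\vartheta(t_1,\dots,t_k;q)=\prod_j\vartheta(t_j;q)$. ${}_{r+1}\phi_r(a_1,\dots,a_{r+1};b_1,\dots,b_r;p,t)=\sum_{k\ge0}\frac{(a_1,\dots,a_{r+1};p)_k}{(p,b_1,\dots,b_r;p)_k}t^k$ for $|t|<1$. The very-well-poised series in base $p$ is $${}_{10}W_9(\alpha;a_4,\dots,a_{10};p,t)={}_{10}\phi_9\!\left(\alpha,\pm p\sqrt\alpha,a_4,\dots,a_{10};\pm\sqrt\alpha,\tfrac{p\alpha}{a_4},\dots,\tfrac{p\alpha}{a_{10}};p,t\right),$$ used here with $p=q^2$, $\alpha=a^2$. A square root $\sqrt q$ is fixed and $q^{3/2}=(\sqrt q)^3$.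 $F(y;x,z)$ and $F(z;y,x)$ are obtained from $F(x;y,z)$ by interchanging $x$ with $y$, respectively $x$ with $z$. Convention "no vanishing denominator factors": every infinite $q$-shifted factorial and every theta function appearing in a denominator is non-zero, and no denominator parameter of any series makes a denominator factor vanish. *)

theory Defs
  imports "HOL-Analysis.Analysis"
begin

definition qpoch :: "complex \<Rightarrow> complex \<Rightarrow> nat \<Rightarrow> complex" where
  "qpoch a q k = (\<Prod>j<k. 1 - a * q ^ j)"

definition qpoch_inf :: "complex \<Rightarrow> complex \<Rightarrow> complex" where
  "qpoch_inf a q = (\<Prod>j. 1 - a * q ^ j)"

definition qpochs :: "complex list \<Rightarrow> complex \<Rightarrow> nat \<Rightarrow> complex" where
  "qpochs as q k = (\<Prod>a\<leftarrow>as. qpoch a q k)"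

definition qpochs_inf :: "complex list \<Rightarrow> complex \<Rightarrow> complex" where
  "qpochs_inf as q = (\<Prod>a\<leftarrow>as. qpoch_inf a q)"

definition pm :: "complex \<Rightarrow> complex list" where
  "pm t = [t, - t]"

definition theta :: "complex \<Rightarrow> complex \<Rightarrow> complex" where
  "theta t q = qpochs_inf [t, q / t] q"

definition thetas :: "complex list \<Rightarrow> complex \<Rightarrow> complex" where
  "thetas ts q = (\<Prod>t\<leftarrow>ts. theta t q)"

(* The basic hypergeometric series with r+1 upper parameters as and r lower parameters bs;
   the base p itself is the implicit extra lower parameter. Meant for
   length as = length bs + 1 only: for other lengths the usual definition has a further factor. *)
definition phi :: "complex list \<Rightarrow> complex list \<Rightarrow> complex \<Rightarrow> complex \<Rightarrow> complex" where
  "phi as bs p t = (\<Sum>k. qpochs as p k / qpochs (p # bs) p k * t ^ k)"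

definition phi_denom_ok :: "complex list \<Rightarrow> complex \<Rightarrow> bool" where
  "phi_denom_ok bs p \<longleftrightarrow> (\<forall>k. qpochs (p # bs) p k \<noteq> 0)"

(* Very-well-poised series; cs = [a4, ..., a10] gives 10W9. The choice of the square root
   of al does not matter, since both roots enter through pm. *)
definition W_upper :: "complex \<Rightarrow> complex list \<Rightarrow> complex \<Rightarrow> complex list" where
  "W_upper al cs p = [al] @ pm (p * csqrt al) @ cs"

definition W_lower :: "complex \<Rightarrow> complex list \<Rightarrow> complex \<Rightarrow> complex list" where
  "W_lower al cs p = pm (csqrt al) @ map (\<lambda>c. p * al / c) cs"

definition W_series :: "complex \<Rightarrow> complex list \<Rightarrow> complex \<Rightarrow> complex \<Rightarrow> complex" where
  "W_series al cs p t = phi (W_upper al cs p) (W_lower al cs p) p t"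

(* In all that follows, s stands for the fixed square root of q, so q powr (3/2) is s ^ 3. *)

definition F_denom ::
  "complex \<Rightarrow> complex \<Rightarrow> complex \<Rightarrow> complex \<Rightarrow> complex \<Rightarrow> complex \<Rightarrow> complex \<Rightarrow> complex list" where
  "F_denom q s a b x y z = [x, y / x, z / x, q * a^2 / (y * z)] @ pm (s * a / (b * x))"

definition F_lower ::
  "complex \<Rightarrow> complex \<Rightarrow> complex \<Rightarrow> complex \<Rightarrow> complex \<Rightarrow> complex \<Rightarrow> complex \<Rightarrow> complex list" where
  "F_lower q s a b x y z = [q * x / y, q * x / z] @ pm (s * b * x / a)"

definition F_term ::
  "complex \<Rightarrow> complex \<Rightarrow> complex \<Rightarrow> complex \<Rightarrow> complex \<Rightarrow> complex \<Rightarrow> complex \<Rightarrow> complex \<Rightarrow> complex" where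
  "F_term q s a b h x y z =
     thetas [h * x, h * (y * z / (q * a^2))] q *
     qpochs_inf (pm (s * a / x) @ [q * a^2 / (b^2 * x)]) q /
     qpochs_inf (F_denom q s a b x y z) q *
     phi ([x, q * a^2 / (y * z)] @ pm (s * x / a) @ [b^2 * x / a^2])
         (F_lower q s a b x y z) q q"

definition F_denom_ok ::
  "complex \<Rightarrow> complex \<Rightarrow> complex \<Rightarrow> complex \<Rightarrow> complex \<Rightarrow> complex \<Rightarrow> complex \<Rightarrow> bool" where
  "F_denom_ok q s a b x y z \<longleftrightarrow>
     qpochs_inf (F_denom q s a b x y z) q \<noteq> 0 \<and> phi_denom_ok (F_lower q s a b x y z) q"

definition E_denom ::
  "complex \<Rightarrow> complex \<Rightarrow> complex \<Rightarrow> complex \<Rightarrow> complex \<Rightarrow> complex \<Rightarrow> complex \<Rightarrow> complex list" where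
  "E_denom s a b x y z e =
     [e * s^3 * a^3 / (b * x * y * z), e * b * x / (s * a), e * b * y / (s * a), e * b * z / (s * a)]"

definition E_lower ::
  "complex \<Rightarrow> complex \<Rightarrow> complex \<Rightarrow> complex \<Rightarrow> complex \<Rightarrow> complex \<Rightarrow> complex \<Rightarrow> complex \<Rightarrow> complex list" where
  "E_lower q s a b x y z e =
     [- q, e * s^3 * a / (b * x), e * s^3 * a / (b * y), e * s^3 * a / (b * z)]"

definition E_term ::
  "complex \<Rightarrow> complex \<Rightarrow> complex \<Rightarrow> complex \<Rightarrow> complex \<Rightarrow> complex \<Rightarrow> complex \<Rightarrow> complex \<Rightarrow> complex \<Rightarrow> complex" where
  "E_term q s a b h x y z e =
     thetas [e * h * (s * a / b), e * h * (b * x * y * z / (s^3 * a^3))] q /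
     qpochs_inf (E_denom s a b x y z e) q *
     phi (pm (q / b) @ [e * s * a / b, e * s * b / a, e * s^3 * a^3 / (b * x * y * z)])
         (E_lower q s a b x y z e) q q"

definition E_denom_ok ::
  "complex \<Rightarrow> complex \<Rightarrow> complex \<Rightarrow> complex \<Rightarrow> complex \<Rightarrow> complex \<Rightarrow> complex \<Rightarrow> complex \<Rightarrow> bool" where
  "E_denom_ok q s a b x y z e \<longleftrightarrow>
     qpochs_inf (E_denom s a b x y z e) q \<noteq> 0 \<and> phi_denom_ok (E_lower q s a b x y z e) q"

end

theory Submission
  imports Defs
begin

text \<open>Write \<open>X = x y z / (q a^2)\<close>, \<open>\<tau> = s a / b\<close> with \<open>s^2 = q\<close>, and, all products being to the base \<open>q\<close>,

  \<open>G(t) = \<vartheta>(h t, h X / t) (s a / t, - s a / t, q a^2 / (b^2 t)) /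
     (x / t, y / t, z / t, \<tau> / t, - \<tau> / t, t, t / X)\<close>.

The differential \<open>G(t) dt / t\<close> has two kinds of poles: the inner ones \<open>x q^k\<close>, \<open>y q^k\<close>, \<open>z q^k\<close>,
\<open>\<tau> q^k\<close>, \<open>- \<tau> q^k\<close>, which accumulate at zero, and the outer ones \<open>q^(-k)\<close> and \<open>X q^(-k)\<close>, which
accumulate at infinity.  Up to the factor \<open>(q; q)\<close> the residues at the five inner families sum up to
the five series on the right-hand side of the theorem, including their prefactors.

The sum of all residues vanishes.  Rather than integrating over large and small circles, one truncates
every infinite product to \<open>N\<close> factors; \<open>G\<close> becomes a rational function, whose residues sum up to the
difference of its values at infinity and at zero, and these values are \<open>N\<close>-th powers of numbers
in the unit disc.  Letting \<open>N\<close> tend to infinity termwise gives \<open>sum_inner_eq_sum_outer\<close>.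

At an outer pole \<open>t = 1 / w\<close> the theta functions and the factors \<open>(t, t / X)\<close> contribute the constant
\<open>\<vartheta>(h, h X)\<close> and an elementary weight, so that the outer residues form the functional \<open>Lam\<close>, which
does not involve \<open>h\<close>, applied to the remaining factors of \<open>G\<close>.  Rogers' sum of a very-well-poised
6-phi-5 series (\<open>sum_6phi5\<close>, base \<open>q^2\<close>, parameters \<open>b^2\<close>, \<open>t\<close>, \<open>q t\<close>) expands these factors into a
series over \<open>n\<close>.  At the poles \<open>X q^(-k)\<close> that series converges because the convergence condition of
the theorem says \<open>|\<tau>| < |X|\<close>; at the poles \<open>q^(-k)\<close> it terminates.  After interchanging the sums
(\<open>vwp_sum_eq_Lam\<close>) the functional acts on the functions \<open>pn (2 n)\<close>, and there it has a closed form
(\<open>Lam_pn\<close>, a nonterminating q-Saalschuetz sum): a \<open>q\<close>-difference argument yields a first-order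
recurrence in \<open>n\<close>, and in the limit \<open>n \<rightarrow> \<infinity>\<close> only the pole \<open>t = X\<close> survives.  The result is the
very-well-poised series on the left-hand side.

All this requires simple poles, in particular that \<open>X\<close> is not a power of \<open>q\<close> and that neither \<open>\<tau>\<close>
nor \<open>- \<tau>\<close> is one of the numbers \<open>q^(-k)\<close>, as well as a few further denominators that do not vanish.  The
values of \<open>a\<close> that violate these conditions form a countable set, and both sides are continuous in \<open>a\<close>;
hence the exceptional values are covered too.\<close>

section \<open>Elementary properties of shifted factorials\<close>

lemma qpoch_0 [simp]: "qpoch a q 0 = 1"
  and qpoch_Suc: "qpoch a q (Suc k) = qpoch a q k * (1 - a * q ^ k)"
  by (simp_all add: qpoch_def)

lemma qpoch_add: "qpoch a q (m + n) = qpoch a q m * qpoch (a * q ^ m) q n"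
  by (induction n) (simp_all add: qpoch_Suc power_add algebra_simps)

lemma qpoch_Suc_left: "qpoch a q (Suc k) = (1 - a) * qpoch (a * q) q k"
  using qpoch_add[of a q 1 k] by (simp add: qpoch_Suc)

lemma qpoch_eq_0_iff: "qpoch a q k = 0 \<longleftrightarrow> (\<exists>j<k. a * q ^ j = 1)"
  by (auto simp: qpoch_def)

lemma qpoch_square_base:
  "qpoch a (q^2) k * qpoch (a * q) (q^2) k = qpoch a q (2 * k)"
  by (induction k) (simp_all add: qpoch_Suc power_mult[symmetric] algebra_simps)

lemma qpoch_pm: "qpoch u q k * qpoch (- u) q k = qpoch (u^2) (q^2) k"
  by (induction k) (simp_all add: qpoch_Suc power2_eq_square power_mult_distrib algebra_simps)

text \<open>The product read backwards.  The product of the \<open>- 1 / q^(j + 1)\<close> grows superexponentially with \<open>k\<close>;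
  it will cancel between numerators and denominators.\<close>

lemma qpoch_reflect:
  assumes "q \<noteq> 0" "u \<noteq> 0"
  shows "qpoch (u / q ^ k) q k = u ^ k * (\<Prod>j<k. - 1 / q ^ Suc j) * qpoch (q / u) q k"
proof -
  have "qpoch (u / q ^ k) q k = (\<Prod>j<k. 1 - u / q ^ k * q ^ (k - Suc j))"
    unfolding qpoch_def by (rule prod.nat_diff_reindex[symmetric])
  also have "\<dots> = (\<Prod>j<k. u * (- 1 / q ^ Suc j) * (1 - q / u * q ^ j))"
  proof (rule prod.cong[OF refl])
    fix j assume "j \<in> {..<k}"
    hence "q ^ k = q ^ (k - Suc j) * q ^ Suc j"
      by (subst power_add[symmetric]) auto
    thus "1 - u / q ^ k * q ^ (k - Suc j) = u * (- 1 / q ^ Suc j) * (1 - q / u * q ^ j)"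
      using assms by (simp add: field_simps)
  qed
  also have "\<dots> = u ^ k * (\<Prod>j<k. - 1 / q ^ Suc j) * qpoch (q / u) q k"
    by (simp only: prod.distrib qpoch_def prod_constant card_lessThan)
  finally show ?thesis .
qed

subsection \<open>Estimates that are uniform in the length of the product\<close>

text \<open>A bound for \<open>(a; q)_k\<close> with \<open>|a| \<le> A\<close> that does not depend on \<open>k\<close>.\<close>

definition qbound :: "real \<Rightarrow> complex \<Rightarrow> real" where
  "qbound A q = exp (A / (1 - norm q))"

lemma qbound_pos [simp]: "qbound A q > 0"
  by (simp add: qbound_def)

lemma sum_geometric_le:
  assumes "norm (q :: complex) < 1"
  shows "(\<Sum>j<k. norm q ^ j) \<le> 1 / (1 - norm q)"
  using sum_le_suminf[of "\<lambda>j. norm q ^ j" "{..<k}"] assms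
  by (auto simp: suminf_geometric summable_geometric)

lemma prod_one_plus_le_qbound:
  assumes "norm q < 1" "A \<ge> 0"
  shows "(\<Prod>j<k. 1 + A * norm q ^ j) \<le> qbound A q"
proof -
  have "(\<Prod>j<k. 1 + A * norm q ^ j) \<le> (\<Prod>j<k. exp (A * norm q ^ j))"
    using assms by (intro prod_mono) auto
  also have "\<dots> = exp (A * (\<Sum>j<k. norm q ^ j))"
    by (simp add: exp_sum sum_distrib_left)
  also have "\<dots> \<le> exp (A * (1 / (1 - norm q)))"
    using mult_left_mono[OF sum_geometric_le[OF assms(1)] assms(2)] by (subst exp_le_cancel_iff)
  finally show ?thesis by (simp add: qbound_def)
qed

lemma norm_factor_le:
  assumes "norm (a :: complex) \<le> A"
  shows "norm (1 - a * q ^ j) \<le> 1 + A * norm q ^ j"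
proof -
  have "norm (1 - a * q ^ j) \<le> 1 + norm (a * q ^ j)"
    using norm_triangle_ineq4[of 1 "a * q ^ j"] by simp
  also have "norm (a * q ^ j) \<le> A * norm q ^ j"
    using assms by (simp add: norm_mult norm_power mult_right_mono)
  finally show ?thesis by simp
qed

lemma norm_qpoch_le_prod:
  assumes "norm a \<le> A"
  shows "norm (qpoch a q k) \<le> (\<Prod>j<k. 1 + A * norm q ^ j)"
  unfolding qpoch_def prod_norm[symmetric] using norm_factor_le[OF assms] by (intro prod_mono) auto

lemma norm_qpoch_le:
  assumes "norm q < 1" "norm a \<le> A"
  shows "norm (qpoch a q k) \<le> qbound A q"
proof -
  have "A \<ge> 0" using assms norm_ge_zero order_trans by blast
  thus ?thesis
    using norm_qpoch_le_prod[OF assms(2), of q k] prod_one_plus_le_qbound[OF assms(1), of A k] by linarith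
qed

text \<open>Lipschitz continuity in the parameter with a constant independent of \<open>k\<close>: this passes to the infinite
  product and is the source of all continuity statements below.\<close>

lemma norm_qpoch_diff_le:
  assumes "norm q < 1" "norm a \<le> A" "norm b \<le> A"
  shows "norm (qpoch a q k - qpoch b q k) \<le> norm (a - b) * (qbound A q / (1 - norm q))"
proof -
  have A: "A \<ge> 0" using assms norm_ge_zero order_trans by blast
  define P where "P k = (\<Prod>j<k. 1 + A * norm q ^ j)" for k
  have P0: "P k \<ge> 0" for k unfolding P_def using A by (intro prod_nonneg) auto
  have Pb: "norm (qpoch b q k) \<le> P k" for k
    unfolding P_def by (rule norm_qpoch_le_prod[OF assms(3)])
  have main: "norm (qpoch a q k - qpoch b q k) \<le> norm (a - b) * (\<Sum>j<k. norm q ^ j) * P k" for k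
  proof (induction k)
    case (Suc k)
    have eq: "qpoch a q (Suc k) - qpoch b q (Suc k) =
        (qpoch a q k - qpoch b q k) * (1 - a * q ^ k) + (b - a) * q ^ k * qpoch b q k"
      by (simp add: qpoch_Suc algebra_simps)
    have PS: "P (Suc k) = P k * (1 + A * norm q ^ k)" by (simp add: P_def)
    have "norm (qpoch a q (Suc k) - qpoch b q (Suc k)) \<le>
        norm (a - b) * (\<Sum>j<k. norm q ^ j) * P k * (1 + A * norm q ^ k)
        + norm (a - b) * norm q ^ k * P k"
      unfolding eq
      by (intro norm_triangle_mono, unfold norm_mult norm_power, intro mult_mono)
         (use Suc norm_factor_le[OF assms(2), of q k] Pb P0 A in
           \<open>auto simp: norm_minus_commute intro!: mult_nonneg_nonneg sum_nonneg mult_left_mono\<close>)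
    also have "norm (a - b) * norm q ^ k * P k \<le> norm (a - b) * norm q ^ k * P (Suc k)"
      unfolding PS using P0[of k] A by (intro mult_left_mono) (auto simp: algebra_simps)
    finally show ?case by (simp add: PS algebra_simps)
  qed simp
  have "norm (a - b) * (\<Sum>j<k. norm q ^ j) * P k \<le> norm (a - b) * (1 / (1 - norm q)) * qbound A q"
    using prod_one_plus_le_qbound[OF assms(1) A, of k] sum_geometric_le[OF assms(1), of k] P0[of k] assms(1)
    by (intro mult_mono mult_left_mono) (auto simp: P_def sum_nonneg)
  thus ?thesis using main[of k] by simp
qed

subsection \<open>Infinite products\<close>

lemma convergent_prod_qpoch:
  fixes a q :: complex
  assumes "norm q < 1"
  shows "convergent_prod (\<lambda>j. 1 - a * q ^ j)"
proof -
  have "summable (\<lambda>j. norm ((1 - a * q ^ j) - 1))"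
    using summable_mult[OF summable_geometric[of "norm q"], of "norm a"] assms
    by (simp add: norm_mult norm_power)
  thus ?thesis
    using abs_convergent_prod_conv_summable abs_convergent_prod_imp_convergent_prod by blast
qed

lemma qpoch_LIMSEQ:
  assumes "norm q < 1"
  shows "(\<lambda>k. qpoch a q k) \<longlonglongrightarrow> qpoch_inf a q"
  using convergent_prod_LIMSEQ[OF convergent_prod_qpoch[OF assms, of a]]
  unfolding qpoch_def qpoch_inf_def by (simp add: LIMSEQ_lessThan_iff_atMost)

lemma qpoch_inf_eq_0_iff:
  assumes "norm q < 1"
  shows "qpoch_inf a q = 0 \<longleftrightarrow> (\<exists>k. a * q ^ k = 1)"
proof
  assume "qpoch_inf a q = 0"
  thus "\<exists>k. a * q ^ k = 1"
    using prodinf_nonzero[OF convergent_prod_qpoch[OF assms, of a]]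
    by (auto simp: qpoch_inf_def)
next
  assume "\<exists>k. a * q ^ k = 1"
  then obtain k where k: "a * q ^ k = 1" by blast
  have "eventually (\<lambda>n. qpoch a q n = 0) sequentially"
    using eventually_gt_at_top[of k] by eventually_elim (use k in \<open>auto simp: qpoch_eq_0_iff\<close>)
  hence "(\<lambda>n. qpoch a q n) \<longlonglongrightarrow> 0"
    by (rule tendsto_eventually)
  thus "qpoch_inf a q = 0" using qpoch_LIMSEQ[OF assms, of a] LIMSEQ_unique by blast
qed

lemma qpoch_nonzero:
  assumes "norm q < 1" "qpoch_inf a q \<noteq> 0"
  shows "qpoch a q k \<noteq> 0"
  using assms by (auto simp: qpoch_inf_eq_0_iff qpoch_eq_0_iff)

lemma qpoch_inf_split:
  assumes "norm q < 1"
  shows "qpoch_inf a q = qpoch a q k * qpoch_inf (a * q ^ k) q"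
proof (rule LIMSEQ_unique)
  show "(\<lambda>n. qpoch a q (k + n)) \<longlonglongrightarrow> qpoch_inf a q"
    using LIMSEQ_ignore_initial_segment[OF qpoch_LIMSEQ[OF assms, of a], of k]
    by (simp add: add.commute)
  show "(\<lambda>n. qpoch a q (k + n)) \<longlonglongrightarrow> qpoch a q k * qpoch_inf (a * q ^ k) q"
    unfolding qpoch_add by (intro tendsto_intros qpoch_LIMSEQ assms)
qed

lemma norm_sq_less_1:
  fixes q :: complex
  assumes "norm q < 1"
  shows "norm (q^2) < 1"
  using assms by (simp add: norm_power power_less_one_iff)

lemma qpoch_inf_square_base:
  assumes "norm q < 1"
  shows "qpoch_inf a (q^2) * qpoch_inf (a * q) (q^2) = qpoch_inf a q"
proof (rule LIMSEQ_unique)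
  show "(\<lambda>k. qpoch a (q^2) k * qpoch (a * q) (q^2) k) \<longlonglongrightarrow> qpoch_inf a (q^2) * qpoch_inf (a * q) (q^2)"
    by (intro tendsto_intros qpoch_LIMSEQ norm_sq_less_1 assms)
  show "(\<lambda>k. qpoch a (q^2) k * qpoch (a * q) (q^2) k) \<longlonglongrightarrow> qpoch_inf a q"
    unfolding qpoch_square_base using LIMSEQ_subseq_LIMSEQ[OF qpoch_LIMSEQ[OF assms, of a], of "\<lambda>k. 2 * k"]
    by (auto simp: strict_mono_def o_def)
qed

lemma qpoch_inf_pm:
  assumes "norm q < 1"
  shows "qpoch_inf u q * qpoch_inf (- u) q = qpoch_inf (u^2) (q^2)"
proof (rule LIMSEQ_unique)
  show "(\<lambda>k. qpoch u q k * qpoch (- u) q k) \<longlonglongrightarrow> qpoch_inf u q * qpoch_inf (- u) q"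
    by (intro tendsto_intros qpoch_LIMSEQ assms)
  show "(\<lambda>k. qpoch u q k * qpoch (- u) q k) \<longlonglongrightarrow> qpoch_inf (u^2) (q^2)"
    unfolding qpoch_pm by (intro qpoch_LIMSEQ norm_sq_less_1 assms)
qed

lemma norm_qpoch_inf_le:
  assumes "norm q < 1" "norm a \<le> A"
  shows "norm (qpoch_inf a q) \<le> qbound A q"
  by (rule tendsto_upperbound[OF tendsto_norm[OF qpoch_LIMSEQ[OF assms(1)]]])
     (use norm_qpoch_le[OF assms] in auto)

lemma isCont_qpoch_inf:
  assumes q: "norm q < 1" and f: "isCont f u"
  shows "isCont (\<lambda>v. qpoch_inf (f v) q) u"
proof -
  define A where "A = norm (f u) + 1"
  have lip: "norm (qpoch_inf a q - qpoch_inf b q) \<le> norm (a - b) * (qbound A q / (1 - norm q))"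
    if "norm a \<le> A" "norm b \<le> A" for a b
    by (rule tendsto_upperbound[OF tendsto_norm[OF tendsto_diff[OF qpoch_LIMSEQ[OF q] qpoch_LIMSEQ[OF q]]]])
       (use norm_qpoch_diff_le[OF q that] in auto)
  have "((\<lambda>a. qpoch_inf a q) \<longlongrightarrow> qpoch_inf (f u) q) (nhds (f u))"
  proof (rule Lim_transform_bound[where g = "\<lambda>a. norm (a - f u) * (qbound A q / (1 - norm q))", THEN Lim_null[THEN iffD2]])
    have "eventually (\<lambda>a. a \<in> ball (f u) 1) (nhds (f u))"
      by (intro eventually_nhds_in_open) auto
    thus "\<forall>\<^sub>F a in nhds (f u). norm (qpoch_inf a q - qpoch_inf (f u) q)
        \<le> norm (norm (a - f u) * (qbound A q / (1 - norm q)))"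
    proof eventually_elim
      case (elim a)
      have "norm a \<le> A"
        using elim norm_triangle_ineq2[of a "f u"] by (auto simp: A_def dist_norm norm_minus_commute)
      from lip[OF this, of "f u"] show ?case
        by (intro order_trans[OF _ abs_ge_self[THEN order_trans[OF _ eq_refl[OF real_norm_def[symmetric]]]]])
           (auto simp: A_def)
    qed
    have "((\<lambda>a. norm (a - f u) * (qbound A q / (1 - norm q))) \<longlongrightarrow>
        norm (f u - f u) * (qbound A q / (1 - norm q))) (nhds (f u))"
      by (intro tendsto_intros filterlim_ident)
    thus "((\<lambda>a. norm (a - f u) * (qbound A q / (1 - norm q))) \<longlongrightarrow> 0) (nhds (f u))" by simp
  qed
  hence "isCont (\<lambda>a. qpoch_inf a q) (f u)"
    unfolding isCont_def by (rule tendsto_mono[rotated]) (simp add: at_within_def)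
  from isCont_o2[OF f this] show ?thesis .
qed

text \<open>Products that do not vanish in the limit stay away from zero, for all lengths and all
  nearby parameters at once.  This is what allows limits to be taken termwise below.\<close>

lemma qpoch_lower_bound:
  assumes q: "norm q < 1" and nz: "qpoch_inf b q \<noteq> 0"
  obtains c \<delta> where "c > 0" "\<delta> > 0" "\<And>b' k. norm (b' - b) < \<delta> \<Longrightarrow> c \<le> norm (qpoch b' q k)"
proof -
  have "Bseq (\<lambda>k. inverse (qpoch b q k))"
    by (rule convergent_imp_Bseq, rule convergentI, rule tendsto_inverse[OF qpoch_LIMSEQ[OF q] nz])
  then obtain K where K: "K > 0" "\<And>k. norm (inverse (qpoch b q k)) \<le> K"
    using BseqE by blast
  have lb: "1 / K \<le> norm (qpoch b q k)" for k
    using K(2)[of k] K(1) qpoch_nonzero[OF q nz, of k] by (simp add: norm_inverse norm_divide field_simps)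
  define C where "C = qbound (norm b + 1) q / (1 - norm q)"
  have C: "C > 0" using q by (simp add: C_def)
  show ?thesis
  proof (rule that[of "1 / (2 * K)" "min 1 (1 / (2 * K * C))"])
    fix b' k assume b': "norm (b' - b) < min 1 (1 / (2 * K * C))"
    have "norm b' \<le> norm b + 1" using b' norm_triangle_ineq2[of b' b] by auto
    hence "norm (qpoch b' q k - qpoch b q k) \<le> norm (b' - b) * C"
      unfolding C_def by (intro norm_qpoch_diff_le q) auto
    also have "\<dots> \<le> 1 / (2 * K * C) * C" using b' C by (intro mult_right_mono) auto
    also have "\<dots> = 1 / (2 * K)" using C by simp
    finally have "norm (qpoch b' q k - qpoch b q k) \<le> 1 / (2 * K)" .
    moreover have "norm (qpoch b q k) - norm (qpoch b' q k) \<le> norm (qpoch b' q k - qpoch b q k)"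
      by (metis norm_minus_commute norm_triangle_ineq2)
    moreover have "1 / K = 1 / (2 * K) + 1 / (2 * K)" using K by (simp add: field_simps)
    ultimately show "1 / (2 * K) \<le> norm (qpoch b' q k)" using lb[of k] by linarith
  qed (use K C in auto)
qed

section \<open>Partial fractions\<close>

lemma degree_prod_linear_le:
  fixes a :: "'i \<Rightarrow> 'a :: idom"
  shows "degree (\<Prod>i\<in>A. [:1, - a i:]) \<le> card A"
proof -
  have "degree (\<Prod>i\<in>A. [:1, - a i:]) \<le> (\<Sum>i\<in>A. degree [:1, - a i:])"
    by (cases "finite A") (auto simp: o_def intro!: order_trans[OF degree_prod_sum_le])
  also have "\<dots> \<le> (\<Sum>i\<in>A. 1)"
    by (intro sum_mono) auto
  finally show ?thesis by simp
qed

lemma coeff_card_prod_linear: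
  fixes a :: "'i \<Rightarrow> 'a :: idom"
  assumes "finite A"
  shows "coeff (\<Prod>i\<in>A. [:1, - a i:]) (card A) = (\<Prod>i\<in>A. - a i)"
  using assms
proof (induction A rule: finite_induct)
  case (insert x A)
  have "coeff (\<Prod>i\<in>A. [:1, - a i:]) (Suc (card A)) = 0"
    by (intro coeff_eq_0) (use degree_prod_linear_le[of a A] in auto)
  thus ?case using insert by (simp add: algebra_simps)
qed simp

text \<open>The residue theorem for the rational function
  \<open>(\<Prod>v. 1 - b v / t) / (\<Prod>u. 1 - a u / t)\<close> against \<open>dt / t\<close>: the right-hand side is the
  value at infinity minus the value at zero.\<close>

lemma sum_residues_rational:
  fixes a :: "'i \<Rightarrow> complex" and b :: "'j \<Rightarrow> complex"
  assumes fin: "finite U" "finite V" and card: "card V = card U"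
    and inj: "inj_on a U" and nz: "\<And>u. u \<in> U \<Longrightarrow> a u \<noteq> 0"
  shows "(\<Sum>u\<in>U. (\<Prod>v\<in>V. 1 - b v / a u) / (\<Prod>u'\<in>U - {u}. 1 - a u' / a u))
    = 1 - (\<Prod>v\<in>V. b v) / (\<Prod>u\<in>U. a u)"
proof -
  define \<kappa> where "\<kappa> = (\<Prod>v\<in>V. b v) / (\<Prod>u\<in>U. a u)"
  define w where "w u = (\<Prod>v\<in>V. 1 - b v / a u) / (\<Prod>u'\<in>U - {u}. 1 - a u' / a u)" for u
  define p where "p = (\<Prod>v\<in>V. [:1, - b v:])"
  define r where "r = smult \<kappa> (\<Prod>u\<in>U. [:1, - a u:])
      + (\<Sum>u\<in>U. smult (w u) (\<Prod>u'\<in>U - {u}. [:1, - a u':]))"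
  have nz': "(\<Prod>u\<in>U. a u) \<noteq> 0" using nz fin by simp
  have low: "degree (\<Prod>u'\<in>U - {u}. [:1, - a u':]) \<le> card U - 1" if "u \<in> U" for u
    using degree_prod_linear_le[of a "U - {u}"] that fin by simp
  have "p = r"
  proof (rule poly_eqI_degree_lead_coeff[where n = "card U" and A = "(\<lambda>u. 1 / a u) ` U"])
    have "inj_on (\<lambda>u. 1 / a u) U"
      using inj nz by (auto simp: inj_on_def divide_simps)
    thus "card U \<le> card ((\<lambda>u. 1 / a u) ` U)" by (simp add: card_image)
    show "degree p \<le> card U"
      using degree_prod_linear_le[of b V] card by (simp add: p_def)
    show "degree r \<le> card U"
      unfolding r_def using low degree_prod_linear_le[of a U]
      by (intro degree_add_le degree_sum_le fin order_trans[OF degree_smult_le])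
         (auto intro: order_trans[OF low])
    have "coeff r (card U) = \<kappa> * (\<Prod>u\<in>U. - a u)
        + (\<Sum>u\<in>U. w u * coeff (\<Prod>u'\<in>U - {u}. [:1, - a u':]) (card U))"
      by (simp add: r_def coeff_sum coeff_card_prod_linear fin)
    also have "(\<Sum>u\<in>U. w u * coeff (\<Prod>u'\<in>U - {u}. [:1, - a u':]) (card U)) = 0"
    proof (intro sum.neutral ballI)
      fix u assume u: "u \<in> U"
      hence "card U > 0" using fin by (auto simp: card_gt_0_iff)
      with low[OF u] have "degree (\<Prod>u'\<in>U - {u}. [:1, - a u':]) < card U" by linarith
      thus "w u * coeff (\<Prod>u'\<in>U - {u}. [:1, - a u':]) (card U) = 0"
        by (simp add: coeff_eq_0)
    qed
    also have "\<kappa> * (\<Prod>u\<in>U. - a u) + 0 = (\<Prod>v\<in>V. - b v)"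
      using card nz' prod_uminus[of b V] prod_uminus[of a U] by (simp add: \<kappa>_def)
    also have "\<dots> = coeff p (card U)"
      using coeff_card_prod_linear[OF fin(2), of b] card by (simp add: p_def)
    finally show "coeff p (card U) = coeff r (card U)" ..
    fix z assume "z \<in> (\<lambda>u. 1 / a u) ` U"
    then obtain u where u: "u \<in> U" "z = 1 / a u" by auto
    have D: "(\<Prod>u'\<in>U - {u}. 1 - a u' / a u) \<noteq> 0"
      using fin nz[OF u(1)] inj u(1) by (auto simp: inj_on_def)
    have "poly r z = \<kappa> * (\<Prod>u'\<in>U. 1 - a u' / a u)
        + (\<Sum>u1\<in>U. w u1 * (\<Prod>u'\<in>U - {u1}. 1 - a u' / a u))"
      by (simp add: r_def poly_sum poly_prod u divide_simps)
    also have "(\<Prod>u'\<in>U. 1 - a u' / a u) = 0"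
      using fin u(1) nz[OF u(1)] by (intro prod_zero) (auto intro!: bexI[of _ u])
    also have "(\<Sum>u1\<in>U. w u1 * (\<Prod>u'\<in>U - {u1}. 1 - a u' / a u)) =
        (\<Sum>u1\<in>{u}. w u1 * (\<Prod>u'\<in>U - {u1}. 1 - a u' / a u))"
    proof (intro sum.mono_neutral_right ballI fin)
      fix u1 assume "u1 \<in> U - {u}"
      hence "(\<Prod>u'\<in>U - {u1}. 1 - a u' / a u) = 0"
        using fin u(1) nz[OF u(1)] by (intro prod_zero) (auto intro!: bexI[of _ u])
      thus "w u1 * (\<Prod>u'\<in>U - {u1}. 1 - a u' / a u) = 0" by simp
    qed (use u in auto)
    also have "\<kappa> * 0 + \<dots> = (\<Prod>v\<in>V. 1 - b v / a u)"
      using D by (simp add: w_def)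
    also have "\<dots> = poly p z"
      by (simp add: p_def poly_prod u divide_simps)
    finally show "poly p z = poly r z" ..
  qed
  hence "poly p 0 = poly r 0" by simp
  hence "1 = \<kappa> + (\<Sum>u\<in>U. w u)"
    by (simp add: p_def r_def poly_sum poly_prod)
  thus ?thesis by (simp add: \<kappa>_def w_def algebra_simps)
qed

lemma prod_one_minus_ratio_inversion:
  fixes f :: "'i \<Rightarrow> complex"
  assumes "t \<noteq> 0" "\<And>v. v \<in> S \<Longrightarrow> f v \<noteq> 0"
  shows "(\<Prod>v\<in>S. 1 - f v / t) = (\<Prod>v\<in>S. f v) * (- 1 / t) ^ card S * (\<Prod>v\<in>S. 1 - (1 / f v) / (1 / t))"
proof -
  have "(\<Prod>v\<in>S. 1 - f v / t) = (\<Prod>v\<in>S. f v * (- 1 / t) * (1 - (1 / f v) / (1 / t)))"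
    using assms by (intro prod.cong refl) (auto simp: field_simps)
  thus ?thesis by (simp only: prod.distrib prod_constant)
qed

text \<open>The substitution \<open>t \<mapsto> 1/t\<close> turns a rational function of this kind into another one, up to the constant
  factor \<open>(\<Prod>v. b v) / (\<Prod>u. a u)\<close>, and reverses the sign of \<open>dt / t\<close>.\<close>

lemma residue_rational_inversion:
  fixes a :: "'i \<Rightarrow> complex" and b :: "'j \<Rightarrow> complex"
  assumes fin: "finite U" "finite V" and card: "card V = card U" and u: "u \<in> U"
    and nz: "\<And>u. u \<in> U \<Longrightarrow> a u \<noteq> 0" "\<And>v. v \<in> V \<Longrightarrow> b v \<noteq> 0"
  shows "(\<Prod>v\<in>V. 1 - b v / a u) / (\<Prod>u'\<in>U - {u}. 1 - a u' / a u)
    = - ((\<Prod>v\<in>V. b v) / (\<Prod>u\<in>U. a u)) *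
      ((\<Prod>v\<in>V. 1 - (1 / b v) / (1 / a u)) / (\<Prod>u'\<in>U - {u}. 1 - (1 / a u') / (1 / a u)))"
proof -
  have cU: "card U = Suc (card (U - {u}))" by (rule card.remove[OF fin(1) u])
  have pU: "(\<Prod>u\<in>U. a u) = a u * (\<Prod>u'\<in>U - {u}. a u')" by (rule prod.remove[OF fin(1) u])
  have n: "a u \<noteq> 0" "(\<Prod>u'\<in>U - {u}. a u') \<noteq> 0" using nz u fin by auto
  have num: "(\<Prod>v\<in>V. 1 - b v / a u)
      = (\<Prod>v\<in>V. b v) * (- 1 / a u) ^ card V * (\<Prod>v\<in>V. 1 - (1 / b v) / (1 / a u))"
    by (rule prod_one_minus_ratio_inversion) (use n nz in auto)
  have den: "(\<Prod>u'\<in>U - {u}. 1 - a u' / a u)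
      = (\<Prod>u'\<in>U - {u}. a u') * (- 1 / a u) ^ card (U - {u}) * (\<Prod>u'\<in>U - {u}. 1 - (1 / a u') / (1 / a u))"
    by (rule prod_one_minus_ratio_inversion) (use n nz in auto)
  have alg: "bb * ((- 1 / au) ^ Suc n) * X / (aa * (- 1 / au) ^ n * Y) = - (bb / (au * aa)) * (X / Y)"
    if "au \<noteq> 0" for bb aa au X Y :: complex and n
    using that by (simp add: field_simps)
  show ?thesis
    unfolding num den pU card cU by (rule alg[OF n(1)])
qed

section \<open>Residues of quotients of infinite products\<close>

text \<open>Boundedness in both indices, the number \<open>k\<close> of the pole and the length \<open>N\<close> of the products.  Since it is
  preserved by finite products, it reduces a dominating bound for a residue to its single factors.\<close>

definition bdd2 :: "(nat \<Rightarrow> nat \<Rightarrow> complex) \<Rightarrow> bool" where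
  "bdd2 f \<longleftrightarrow> (\<exists>M. \<forall>k N. norm (f k N) \<le> M)"

lemma bdd2_const: "bdd2 (\<lambda>k N. c)"
  by (auto simp: bdd2_def)

lemma bdd2_mult:
  assumes "bdd2 f" "bdd2 g"
  shows "bdd2 (\<lambda>k N. f k N * g k N)"
proof -
  obtain M1 M2 where M: "\<And>k N. norm (f k N) \<le> M1" "\<And>k N. norm (g k N) \<le> M2"
    using assms unfolding bdd2_def by blast
  have "norm (f k N * g k N) \<le> M1 * M2" for k N
    unfolding norm_mult using M norm_ge_zero order_trans by (intro mult_mono) blast+
  thus ?thesis by (auto simp: bdd2_def)
qed

lemma bdd2_prod:
  assumes "\<And>i. i \<in> S \<Longrightarrow> bdd2 (f i)"
  shows "bdd2 (\<lambda>k N. \<Prod>i\<in>S. f i k N)"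
  using assms
proof (induction S rule: infinite_finite_induct)
  case (insert x S)
  thus ?case by (simp add: bdd2_mult)
qed (auto simp: bdd2_const)

lemma bdd2_qpoch:
  assumes "norm q < 1"
  shows "bdd2 (\<lambda>k N. qpoch (a * q ^ e k N) q (l k N))"
proof -
  have "norm (a * q ^ m) \<le> norm a" for m
    using assms by (simp add: norm_mult norm_power mult_left_le power_le_one)
  thus ?thesis
    unfolding bdd2_def using norm_qpoch_le[OF assms] by blast
qed

lemma bdd2_inverse_qpoch_base:
  assumes "norm q < 1" "qpoch_inf a q \<noteq> 0"
  shows "bdd2 (\<lambda>k N. inverse (qpoch a q (l k N)))"
proof -
  obtain c \<delta> where c: "c > 0" "\<delta> > 0" "\<And>b' k. norm (b' - a) < \<delta> \<Longrightarrow> c \<le> norm (qpoch b' q k)"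
    using qpoch_lower_bound[OF assms] by blast
  have "norm (inverse (qpoch a q m)) \<le> 1 / c" for m
    using c(1) c(3)[of a m] c(2) le_imp_inverse_le[of c "norm (qpoch a q m)"]
    by (simp add: norm_divide inverse_eq_divide)
  thus ?thesis unfolding bdd2_def by blast
qed

text \<open>A shifted start \<open>a q^e\<close> needs no new lower bound: \<open>(a q^e; q)_l = (a; q)_(e + l) / (a; q)_e\<close>.\<close>

lemma bdd2_inverse_qpoch:
  assumes "norm q < 1" "qpoch_inf a q \<noteq> 0"
  shows "bdd2 (\<lambda>k N. inverse (qpoch (a * q ^ e k N) q (l k N)))"
proof -
  have "inverse (qpoch (a * q ^ e k N) q (l k N))
      = qpoch (a * q ^ 0) q (e k N) * inverse (qpoch a q (e k N + l k N))" for k N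
    using qpoch_nonzero[OF assms, of "e k N"] by (simp add: qpoch_add)
  thus ?thesis
    using bdd2_mult[OF bdd2_qpoch[OF assms(1), of a "\<lambda>_ _. 0" e]
        bdd2_inverse_qpoch_base[OF assms, of "\<lambda>k N. e k N + l k N"]] by simp
qed

lemma qpoch_inf_base_nonzero:
  assumes "norm q < 1"
  shows "qpoch_inf q q \<noteq> 0"
proof
  assume "qpoch_inf q q = 0"
  then obtain k where "q * q ^ k = 1" using qpoch_inf_eq_0_iff[OF assms] by blast
  hence "norm q ^ Suc k = 1" by (metis norm_one norm_power power_Suc)
  moreover have "norm q ^ Suc k < 1" using assms by (simp add: power_less_one_iff del: power_Suc)
  ultimately show False by simp
qed

text \<open>The setting: \<open>G(t) = (\<Prod>B. (b/t)) (\<Prod>E. (e t)) / ((\<Prod>I. (c/t)) (\<Prod>J. (d t)))\<close>, every factor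
  an infinite product to the base \<open>q\<close>.  Its poles \<open>c q^k\<close> accumulate at \<open>0\<close>, its poles
  \<open>1 / (d q^k)\<close> at infinity; the genericity assumptions make all of them simple.  The substitution
  \<open>t \<mapsto> 1/t\<close> exchanges the two kinds of poles.\<close>

locale two_sided_poles =
  fixes q :: complex and I J B E :: "nat set" and c d b e :: "nat \<Rightarrow> complex"
  assumes q0: "q \<noteq> 0" and q1: "norm q < 1"
    and fin: "finite I" "finite J" "finite B" "finite E"
    and card_in: "card B = card I" and card_out: "card E = card J"
    and c0: "\<And>i. i \<in> I \<Longrightarrow> c i \<noteq> 0" and d0: "\<And>i. i \<in> J \<Longrightarrow> d i \<noteq> 0"
    and b0: "\<And>i. i \<in> B \<Longrightarrow> b i \<noteq> 0" and e0: "\<And>i. i \<in> E \<Longrightarrow> e i \<noteq> 0"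
    and gen_in: "\<And>i i'. i \<in> I \<Longrightarrow> i' \<in> I \<Longrightarrow> i \<noteq> i' \<Longrightarrow> qpoch_inf (c i' / c i) q \<noteq> 0"
    and gen_out: "\<And>i i'. i \<in> J \<Longrightarrow> i' \<in> J \<Longrightarrow> i \<noteq> i' \<Longrightarrow> qpoch_inf (d i' / d i) q \<noteq> 0"
    and gen_cross: "\<And>i j. i \<in> I \<Longrightarrow> j \<in> J \<Longrightarrow> qpoch_inf (d j * c i) q \<noteq> 0"
    and small_in: "norm (\<Prod>i\<in>B. b i) < norm (\<Prod>i\<in>I. c i)"
    and small_out: "norm (\<Prod>i\<in>E. e i) < norm (\<Prod>i\<in>J. d i)"
begin

definition rho :: complex where
  "rho = (\<Prod>i\<in>B. b i) / (\<Prod>i\<in>I. c i)"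

text \<open>The residue at \<open>c i * q^k\<close> after truncating every product to \<open>N\<close> factors, and its limit.  In the
  limit the factors \<open>(b/t)\<close> and \<open>(c/t)\<close> are reflected by \<open>qpoch_reflect\<close>; because there are as many
  of one kind as of the other, only the geometric factor \<open>rho^k\<close> remains of the powers that appear.\<close>

definition res_trunc :: "nat \<Rightarrow> nat \<Rightarrow> nat \<Rightarrow> complex" where
  "res_trunc N i k =
     (\<Prod>m\<in>B. qpoch (b m / c i / q ^ k) q N) * (\<Prod>m\<in>E. qpoch (e m * c i * q ^ k) q N) /
     ((\<Prod>j\<in>{..<N} - {k}. 1 - q ^ j / q ^ k) * (\<Prod>i'\<in>I - {i}. qpoch (c i' / c i / q ^ k) q N) *
      (\<Prod>j\<in>J. qpoch (d j * c i * q ^ k) q N))"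

definition res :: "nat \<Rightarrow> nat \<Rightarrow> complex" where
  "res i k = rho ^ k *
     (\<Prod>m\<in>B. qpoch (q * c i / b m) q k * qpoch_inf (b m / c i) q) *
     (\<Prod>m\<in>E. qpoch_inf (e m * c i * q ^ k) q) /
     (qpoch q q k * qpoch_inf q q *
      (\<Prod>i'\<in>I - {i}. qpoch (q * c i / c i') q k * qpoch_inf (c i' / c i) q) *
      (\<Prod>j\<in>J. qpoch_inf (d j * c i * q ^ k) q))"

lemma norm_rho: "norm rho < 1"
proof -
  have "norm (\<Prod>i\<in>I. c i) > 0" using small_in norm_ge_zero le_less_trans by blast
  thus ?thesis using small_in by (simp add: rho_def norm_divide)
qed

lemma swapped: "two_sided_poles q J I E B d c e b"
proof
  show "qpoch_inf (c j * d i) q \<noteq> 0" if "i \<in> J" "j \<in> I" for i j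
    using gen_cross[OF that(2,1)] by (simp add: mult.commute)
qed (use q0 q1 fin card_in card_out c0 d0 b0 e0 gen_in gen_out small_in small_out in auto)

lemma q_power_eq_1_iff: "q ^ k = 1 \<longleftrightarrow> k = 0"
proof
  assume *: "q ^ k = 1"
  show "k = 0"
  proof (rule ccontr)
    assume "k \<noteq> 0"
    hence "norm q ^ k < 1" using q1 by (simp add: power_less_one_iff)
    thus False using * by (metis less_irrefl norm_one norm_power)
  qed
qed simp

lemma q_power_inject: "q ^ k = q ^ l \<longleftrightarrow> k = l"
proof (induction k l rule: linorder_wlog)
  case (le k l)
  then obtain m where "l = k + m" using le_Suc_ex by blast
  thus ?case using q_power_eq_1_iff[of m] q0 by (auto simp: power_add)
qed auto

text \<open>The left summand labels the poles (zeros) that accumulate at \<open>0\<close>, the right one those that accumulate at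
  infinity.\<close>

definition pole :: "nat \<times> nat + nat \<times> nat \<Rightarrow> complex" where
  "pole = case_sum (\<lambda>(i, k). c i * q ^ k) (\<lambda>(j, k). 1 / (d j * q ^ k))"

definition zero :: "nat \<times> nat + nat \<times> nat \<Rightarrow> complex" where
  "zero = case_sum (\<lambda>(i, k). b i * q ^ k) (\<lambda>(j, k). 1 / (e j * q ^ k))"

abbreviation "poles (N :: nat) \<equiv> (I \<times> {..<N}) <+> (J \<times> {..<N})"
abbreviation "zeros (N :: nat) \<equiv> (B \<times> {..<N}) <+> (E \<times> {..<N})"

lemma ratio_gen:
  assumes "qpoch_inf (u / v) q \<noteq> 0" "qpoch_inf (v / u) q \<noteq> 0" "u \<noteq> 0" "v \<noteq> 0"
  shows "u * q ^ k \<noteq> v * q ^ l"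
proof
  assume *: "u * q ^ k = v * q ^ l"
  show False
  proof (cases "k \<le> l")
    case True
    then obtain m where "l = k + m" using le_Suc_ex by blast
    with * have "v / u * q ^ m = 1" using q0 assms by (simp add: power_add field_simps)
    thus False using assms qpoch_inf_eq_0_iff[OF q1] by blast
  next
    case False
    then obtain m where "k = l + m" using le_Suc_ex[of l k] by auto
    with * have "u / v * q ^ m = 1" using q0 assms by (simp add: power_add field_simps)
    thus False using assms qpoch_inf_eq_0_iff[OF q1] by blast
  qed
qed

lemma inj_pole: "inj_on pole (poles N)"
proof -
  have cc: "i = i' \<and> k = k'" if "i \<in> I" "i' \<in> I" "c i * q ^ k = c i' * q ^ k'" for i i' k k'
    using ratio_gen[OF gen_in[of i' i] gen_in[of i i'], of k k'] that c0 q_power_inject[of k k']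
    by (cases "i = i'") auto
  have dd: "i = i' \<and> k = k'" if "i \<in> J" "i' \<in> J" "d i * q ^ k = d i' * q ^ k'" for i i' k k'
    using ratio_gen[OF gen_out[of i' i] gen_out[of i i'], of k k'] that d0 q_power_inject[of k k']
    by (cases "i = i'") auto
  have cd: "c i * q ^ k \<noteq> 1 / (d j * q ^ l)" if "i \<in> I" "j \<in> J" for i j k l
  proof
    assume "c i * q ^ k = 1 / (d j * q ^ l)"
    hence "d j * c i * q ^ (k + l) = 1" using that d0 q0 by (simp add: power_add field_simps)
    thus False using gen_cross[OF that] qpoch_inf_eq_0_iff[OF q1] by blast
  qed
  show ?thesis
    using cc dd cd cd[symmetric] q0 by (auto simp: inj_on_def pole_def)
qed

lemma pole_nonzero: "u \<in> poles N \<Longrightarrow> pole u \<noteq> 0"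
  using c0 d0 q0 by (auto simp: pole_def)

lemma zero_nonzero: "u \<in> zeros N \<Longrightarrow> zero u \<noteq> 0"
  using b0 e0 q0 by (auto simp: zero_def)

lemma prod_side: "(\<Prod>(m, l)\<in>S \<times> {..<N}. f m * q ^ l) = (\<Prod>m\<in>S. f m) ^ N * (\<Prod>l<N. q ^ l) ^ card S"
  by (simp add: prod.cartesian_product[symmetric] prod.distrib prod_power_distrib)

lemma prod_zero_over_pole:
  "(\<Prod>v\<in>zeros N. zero v) / (\<Prod>u\<in>poles N. pole u)
   = rho ^ N * ((\<Prod>j\<in>J. d j) / (\<Prod>j\<in>E. e j)) ^ N"
proof -
  have out: "(\<Prod>(m, l)\<in>S \<times> {..<N}. 1 / (f m * q ^ l)) = inverse ((\<Prod>m\<in>S. f m) ^ N * (\<Prod>l<N. q ^ l) ^ card S)"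
    for S and f :: "nat \<Rightarrow> complex"
    unfolding prod_side[symmetric] by (simp add: case_prod_beta inverse_eq_divide prod_dividef)
  have Q: "(\<Prod>l<N. q ^ l) \<noteq> 0" using q0 by simp
  have nz: "prod c I \<noteq> 0" "prod d J \<noteq> 0" "prod b B \<noteq> 0" "prod e E \<noteq> 0"
    using c0 d0 b0 e0 fin by auto
  show ?thesis
    using fin Q nz q0 unfolding zero_def pole_def
    by (simp add: prod.Plus prod_side out card_in card_out rho_def field_simps del: prod_power_distrib)
qed

text \<open>Extracting \<open>-1 / (w q^j)\<close> from each factor turns the outer products into shifted factorials;
  the extracted constants are the same for all inner poles.\<close>

lemma residue_at_inner_pole:
  assumes i: "i \<in> I" and k: "k < N"
  shows "(\<Prod>v\<in>zeros N. 1 - zero v / (c i * q ^ k)) /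
    (\<Prod>u\<in>poles N - {Inl (i, k)}. 1 - pole u / (c i * q ^ k))
    = ((\<Prod>j\<in>J. d j) / (\<Prod>j\<in>E. e j)) ^ N * res_trunc N i k"
proof -
  have t0: "c i * q ^ k \<noteq> 0" using c0[OF i] q0 by simp
  have inner: "(\<Prod>(m, l)\<in>S \<times> {..<N}. 1 - f m * q ^ l / (c i * q ^ k)) = (\<Prod>m\<in>S. qpoch (f m / c i / q ^ k) q N)"
    for S f by (simp add: prod.cartesian_product[symmetric] qpoch_def field_simps)
  define K where "K = (c i * q ^ k) ^ N * (\<Prod>l<N. - (q ^ l))"
  have K0: "K \<noteq> 0" using t0 q0 by (auto simp: K_def)
  have outer: "(\<Prod>(m, l)\<in>S \<times> {..<N}. 1 - 1 / (f m * q ^ l) / (c i * q ^ k))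
      = (\<Prod>m\<in>S. qpoch (f m * c i * q ^ k) q N) / ((\<Prod>m\<in>S. f m) ^ N * K ^ card S)"
    if f0: "\<And>m. m \<in> S \<Longrightarrow> f m \<noteq> 0" for S f
  proof -
    have "(\<Prod>l<N. 1 - 1 / (f m * q ^ l) / (c i * q ^ k)) = qpoch (f m * c i * q ^ k) q N / (f m ^ N * K)"
      if m: "m \<in> S" for m
    proof -
      have "(\<Prod>l<N. 1 - 1 / (f m * q ^ l) / (c i * q ^ k))
          = (\<Prod>l<N. (1 - f m * c i * q ^ k * q ^ l) / (f m * (c i * q ^ k) * - (q ^ l)))"
        using f0[OF m] t0 q0 by (intro prod.cong refl) (simp add: field_simps)
      also have "\<dots> = (\<Prod>l<N. 1 - f m * c i * q ^ k * q ^ l) / (f m ^ N * (c i * q ^ k) ^ N * (\<Prod>l<N. - (q ^ l)))"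
        by (simp only: prod_dividef prod.distrib prod_constant card_lessThan power_mult_distrib)
      finally show ?thesis
        by (simp only: qpoch_def K_def mult.assoc power_mult_distrib)
    qed
    hence "(\<Prod>(m, l)\<in>S \<times> {..<N}. 1 - 1 / (f m * q ^ l) / (c i * q ^ k))
        = (\<Prod>m\<in>S. qpoch (f m * c i * q ^ k) q N / (f m ^ N * K))"
      by (simp add: prod.cartesian_product[symmetric])
    thus ?thesis by (simp add: prod_dividef prod.distrib prod_power_distrib)
  qed
  have own: "(\<Prod>(m, l)\<in>I \<times> {..<N} - {(i, k)}. 1 - c m * q ^ l / (c i * q ^ k))
      = (\<Prod>j\<in>{..<N} - {k}. 1 - q ^ j / q ^ k) * (\<Prod>i'\<in>I - {i}. qpoch (c i' / c i / q ^ k) q N)"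
  proof -
    have "I \<times> {..<N} - {(i, k)} = {i} \<times> ({..<N} - {k}) \<union> (I - {i}) \<times> {..<N}"
      using i by auto
    hence "(\<Prod>(m, l)\<in>I \<times> {..<N} - {(i, k)}. 1 - c m * q ^ l / (c i * q ^ k))
        = (\<Prod>(m, l)\<in>{i} \<times> ({..<N} - {k}). 1 - c m * q ^ l / (c i * q ^ k))
          * (\<Prod>(m, l)\<in>(I - {i}) \<times> {..<N}. 1 - c m * q ^ l / (c i * q ^ k))"
      using fin by (simp only:) (rule prod.union_disjoint, auto)
    also have "(\<Prod>(m, l)\<in>{i} \<times> ({..<N} - {k}). 1 - c m * q ^ l / (c i * q ^ k))
        = (\<Prod>j\<in>{..<N} - {k}. 1 - q ^ j / q ^ k)"
      using c0[OF i] by (simp add: prod.cartesian_product[symmetric])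
    finally show ?thesis by (simp only: inner)
  qed
  have split: "poles N - {Inl (i, k)} = (I \<times> {..<N} - {(i, k)}) <+> (J \<times> {..<N})"
    by auto
  have nz: "prod d J \<noteq> 0" "prod e E \<noteq> 0" using d0 e0 fin by auto
  have "(\<Prod>v\<in>zeros N. 1 - zero v / (c i * q ^ k))
      = (\<Prod>(m, l)\<in>B \<times> {..<N}. 1 - b m * q ^ l / (c i * q ^ k)) *
        (\<Prod>(m, l)\<in>E \<times> {..<N}. 1 - 1 / (e m * q ^ l) / (c i * q ^ k))"
    using fin by (simp add: prod.Plus zero_def case_prod_beta)
  also have "\<dots> = (\<Prod>m\<in>B. qpoch (b m / c i / q ^ k) q N) *
      ((\<Prod>m\<in>E. qpoch (e m * c i * q ^ k) q N) / ((\<Prod>m\<in>E. e m) ^ N * K ^ card E))"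
    by (simp only: inner outer[of E e, OF e0])
  finally have num: "(\<Prod>v\<in>zeros N. 1 - zero v / (c i * q ^ k)) = \<dots>" .
  have "(\<Prod>u\<in>poles N - {Inl (i, k)}. 1 - pole u / (c i * q ^ k))
      = (\<Prod>(m, l)\<in>I \<times> {..<N} - {(i, k)}. 1 - c m * q ^ l / (c i * q ^ k)) *
        (\<Prod>(m, l)\<in>J \<times> {..<N}. 1 - 1 / (d m * q ^ l) / (c i * q ^ k))"
    unfolding split using fin by (simp add: prod.Plus pole_def case_prod_beta)
  also have "\<dots> = (\<Prod>j\<in>{..<N} - {k}. 1 - q ^ j / q ^ k) * (\<Prod>i'\<in>I - {i}. qpoch (c i' / c i / q ^ k) q N) *
      ((\<Prod>m\<in>J. qpoch (d m * c i * q ^ k) q N) / ((\<Prod>m\<in>J. d m) ^ N * K ^ card J))"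
    by (simp only: own outer[of J d, OF d0])
  finally have den: "(\<Prod>u\<in>poles N - {Inl (i, k)}. 1 - pole u / (c i * q ^ k)) = \<dots>" .
  have alg: "x * (y / (ee * kk)) / (u * (w / (dd * kk))) = dd / ee * (x * y / (u * w))"
    if "kk \<noteq> 0" "dd \<noteq> 0" "ee \<noteq> 0" for x y u w ee dd kk :: complex
    using that by (simp add: field_simps)
  show ?thesis
    unfolding num den card_out
    by (subst alg) (use K0 nz in \<open>auto simp: res_trunc_def power_divide mult.assoc\<close>)
qed

text \<open>\<open>sum_residues_rational\<close> for all poles at once.  The outer residues are the inner residues of the
  swapped data up to sign, by \<open>residue_rational_inversion\<close>.\<close>

lemma res_trunc_sum:
  "(\<Sum>i\<in>I. \<Sum>k<N. res_trunc N i k)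
     - (\<Sum>j\<in>J. \<Sum>k<N. two_sided_poles.res_trunc q J I E B d c e b N j k)
   = ((\<Prod>j\<in>E. e j) / (\<Prod>j\<in>J. d j)) ^ N - rho ^ N"
proof -
  interpret sw: two_sided_poles q J I E B d c e b by (rule swapped)
  define U where "U = poles N"
  define V where "V = zeros N"
  define U' where "U' = (J \<times> {..<N}) <+> (I \<times> {..<N})"
  define V' where "V' = (E \<times> {..<N}) <+> (B \<times> {..<N})"
  define s where "s = (\<Prod>j\<in>E. e j) / (\<Prod>j\<in>J. d j)"
  define flip :: "nat \<times> nat + nat \<times> nat \<Rightarrow> nat \<times> nat + nat \<times> nat" where "flip = case_sum Inr Inl"
  have finU: "finite U" "finite V" using fin by (auto simp: U_def V_def)
  have cardUV: "card V = card U"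
    using fin by (simp add: U_def V_def card_Plus card_cartesian_product card_in card_out)
  have nz: "prod c I \<noteq> 0" "prod d J \<noteq> 0" "prod b B \<noteq> 0" "prod e E \<noteq> 0"
    using c0 d0 b0 e0 fin by auto
  have s0: "s \<noteq> 0" "rho \<noteq> 0" using nz by (auto simp: s_def rho_def)
  have inv_s: "prod d J / prod e E = 1 / s" by (simp add: s_def)
  have ratio: "(\<Prod>v\<in>V. zero v) / (\<Prod>u\<in>U. pole u) = (rho / s) ^ N"
    unfolding U_def V_def prod_zero_over_pole inv_s by (simp add: power_divide)
  define w where "w u = (\<Prod>v\<in>V. 1 - zero v / pole u) / (\<Prod>u'\<in>U - {u}. 1 - pole u' / pole u)" for u
  have w_in: "w (Inl (i, k)) = res_trunc N i k / s ^ N" if "i \<in> I" "k < N" for i k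
    using residue_at_inner_pole[OF that] unfolding inv_s
    by (simp add: w_def U_def V_def pole_def power_divide)
  have w_out: "w (Inr (j, k)) = - (sw.res_trunc N j k / s ^ N)" if jk: "j \<in> J" "k < N" for j k
  proof -
    have flip_prod: "(\<Prod>u\<in>S. 1 - (1 / f u) / (1 / pole (Inr (j, k)))) = (\<Prod>u\<in>flip ` S. 1 - g u / (d j * q ^ k))"
      if "\<And>u. g (flip u) = 1 / f u" for S and f g :: "nat \<times> nat + nat \<times> nat \<Rightarrow> complex"
    proof -
      have "inj_on flip S" by (auto simp: inj_on_def flip_def split: sum.splits)
      thus ?thesis using that by (simp add: prod.reindex pole_def)
    qed
    have fz: "sw.zero (flip u) = 1 / zero u" for u
      by (cases u) (auto simp: flip_def zero_def sw.zero_def)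
    have fp: "sw.pole (flip u) = 1 / pole u" for u
      by (cases u) (auto simp: flip_def pole_def sw.pole_def)
    have flip_Plus: "flip ` (X <+> Y) = Y <+> X" for X Y
      by (auto simp: flip_def Plus_def image_Un image_image)
    have fV: "flip ` V = V'" by (simp add: V_def V'_def flip_Plus)
    have fU: "flip ` (U - {Inr (j, k)}) = U' - {Inl (j, k)}"
    proof -
      have "U - {Inr (j, k)} = (I \<times> {..<N}) <+> (J \<times> {..<N} - {(j, k)})"
        by (auto simp: U_def)
      thus ?thesis by (auto simp: flip_Plus U'_def)
    qed
    have uU: "Inr (j, k) \<in> U" using jk by (auto simp: U_def)
    have "w (Inr (j, k)) = - ((rho / s) ^ N) *
        ((\<Prod>v\<in>V'. 1 - sw.zero v / (d j * q ^ k)) / (\<Prod>u\<in>U' - {Inl (j, k)}. 1 - sw.pole u / (d j * q ^ k)))"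
    proof -
      have pz: "\<And>u. u \<in> U \<Longrightarrow> pole u \<noteq> 0" "\<And>v. v \<in> V \<Longrightarrow> zero v \<noteq> 0"
        using pole_nonzero zero_nonzero unfolding U_def V_def by blast+
      show ?thesis
        using residue_rational_inversion[OF finU cardUV uU, of pole zero, OF pz]
        unfolding w_def ratio flip_prod[where f = zero and g = sw.zero, OF fz]
          flip_prod[where f = pole and g = sw.pole, OF fp] fV fU .
    qed
    also have "(\<Prod>v\<in>V'. 1 - sw.zero v / (d j * q ^ k)) / (\<Prod>u\<in>U' - {Inl (j, k)}. 1 - sw.pole u / (d j * q ^ k))
        = (1 / rho) ^ N * sw.res_trunc N j k"
      using sw.residue_at_inner_pole[OF jk] by (simp add: U'_def V'_def rho_def)
    finally show ?thesis using s0 by (simp add: power_divide)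
  qed
  have "(\<Sum>u\<in>U. w u) = 1 - (rho / s) ^ N"
    unfolding w_def ratio[symmetric]
    by (rule sum_residues_rational[OF finU cardUV])
       (use inj_pole pole_nonzero in \<open>auto simp: U_def\<close>)
  also have "(\<Sum>u\<in>U. w u) = (\<Sum>(i, k)\<in>I \<times> {..<N}. w (Inl (i, k))) + (\<Sum>(j, k)\<in>J \<times> {..<N}. w (Inr (j, k)))"
    unfolding U_def using fin by (simp add: sum.Plus case_prod_beta)
  also have "(\<Sum>(i, k)\<in>I \<times> {..<N}. w (Inl (i, k))) = (\<Sum>i\<in>I. \<Sum>k<N. res_trunc N i k) / s ^ N"
    by (subst sum.cartesian_product[symmetric]) (simp add: w_in sum_divide_distrib)
  also have "(\<Sum>(j, k)\<in>J \<times> {..<N}. w (Inr (j, k))) = - (\<Sum>j\<in>J. \<Sum>k<N. sw.res_trunc N j k) / s ^ N"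
    by (subst sum.cartesian_product[symmetric]) (simp add: w_out sum_divide_distrib sum_negf)
  finally show ?thesis
    using s0 unfolding s_def[symmetric] by (simp add: field_simps power_divide)
qed

definition res_factor :: "nat \<Rightarrow> nat \<Rightarrow> nat \<Rightarrow> complex" where
  "res_factor i k N = (\<Prod>m\<in>B. qpoch (q * c i / b m) q k * qpoch (b m / c i) q (N - k)) *
    (\<Prod>m\<in>E. qpoch (e m * c i * q ^ k) q N) *
    (inverse (qpoch q q k) * inverse (qpoch q q (N - Suc k))) *
    (\<Prod>i'\<in>I - {i}. inverse (qpoch (q * c i / c i') q k) * inverse (qpoch (c i' / c i) q (N - k))) *
    (\<Prod>j\<in>J. inverse (qpoch (d j * c i * q ^ k) q N))"

text \<open>Dominated form of a truncated residue: a geometric factor times a quantity that is bounded in \<open>k\<close> and \<open>N\<close>.\<close>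

lemma res_trunc_eq:
  assumes i: "i \<in> I" and k: "k < N"
  shows "res_trunc N i k = rho ^ k * res_factor i k N"
proof -
  define \<tau> where "\<tau> = (\<Prod>j<k. - 1 / q ^ Suc j)"
  have \<tau>0: "\<tau> \<noteq> 0" using q0 by (auto simp: \<tau>_def)
  have reflect: "qpoch (u / q ^ k) q N = u ^ k * \<tau> * (qpoch (q / u) q k * qpoch u q (N - k))"
    if "u \<noteq> 0" for u
    using qpoch_add[of "u / q ^ k" q k "N - k"] k qpoch_reflect[OF q0 that, of k] q0
    by (simp add: \<tau>_def)
  have prefl: "(\<Prod>m\<in>S. qpoch (f m / c i / q ^ k) q N)
      = ((\<Prod>m\<in>S. f m) ^ k / c i ^ (k * card S)) * \<tau> ^ card S
        * (\<Prod>m\<in>S. qpoch (q * c i / f m) q k * qpoch (f m / c i) q (N - k))"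
    if "\<And>m. m \<in> S \<Longrightarrow> f m \<noteq> 0" for S f
  proof -
    have "(\<Prod>m\<in>S. qpoch (f m / c i / q ^ k) q N)
        = (\<Prod>m\<in>S. f m ^ k / c i ^ k * \<tau> * (qpoch (q * c i / f m) q k * qpoch (f m / c i) q (N - k)))"
    proof (rule prod.cong[OF refl])
      fix m assume "m \<in> S"
      thus "qpoch (f m / c i / q ^ k) q N
          = f m ^ k / c i ^ k * \<tau> * (qpoch (q * c i / f m) q k * qpoch (f m / c i) q (N - k))"
        using reflect[of "f m / c i"] that c0[OF i] by (simp add: power_divide)
    qed
    thus ?thesis
      by (simp only: prod.distrib prod_dividef prod_constant prod_power_distrib power_mult)
  qed
  have own: "(\<Prod>j\<in>{..<N} - {k}. 1 - q ^ j / q ^ k) = \<tau> * (qpoch q q k * qpoch q q (N - Suc k))"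
  proof -
    have S: "{..<N} - {k} = {..<k} \<union> (\<lambda>j. Suc k + j) ` {..<N - Suc k}"
    proof (intro equalityI subsetI)
      fix j assume j: "j \<in> {..<N} - {k}"
      show "j \<in> {..<k} \<union> (\<lambda>j. Suc k + j) ` {..<N - Suc k}"
      proof (cases "j < k")
        case False
        hence "j = Suc k + (j - Suc k)" "j - Suc k \<in> {..<N - Suc k}" using j by auto
        thus ?thesis by blast
      qed auto
    qed (use k in auto)
    have "(\<Prod>j\<in>{..<N} - {k}. 1 - q ^ j / q ^ k)
        = (\<Prod>j<k. 1 - q ^ j / q ^ k) * (\<Prod>j\<in>(\<lambda>j. Suc k + j) ` {..<N - Suc k}. 1 - q ^ j / q ^ k)"
      unfolding S by (rule prod.union_disjoint) auto
    also have "(\<Prod>j\<in>(\<lambda>j. Suc k + j) ` {..<N - Suc k}. 1 - q ^ j / q ^ k)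
        = (\<Prod>j<N - Suc k. 1 - q ^ (Suc k + j) / q ^ k)"
      by (subst prod.reindex) (auto simp: inj_on_def o_def)
    also have "(\<Prod>j<k. 1 - q ^ j / q ^ k) = qpoch (1 / q ^ k) q k"
      by (simp add: qpoch_def)
    also have "\<dots> = \<tau> * qpoch q q k"
      using qpoch_reflect[OF q0, of 1 k] by (simp add: \<tau>_def)
    also have "(\<Prod>j<N - Suc k. 1 - q ^ (Suc k + j) / q ^ k) = qpoch q q (N - Suc k)"
      using q0 by (simp add: qpoch_def power_add)
    finally show ?thesis by simp
  qed
  have cI: "card I = Suc (card (I - {i}))" by (rule card.remove[OF fin(1) i])
  have pI: "prod c I = c i * prod c (I - {i})" by (rule prod.remove[OF fin(1) i])
  have nz: "c i \<noteq> 0" "prod c (I - {i}) \<noteq> 0" using c0 i fin by auto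
  have alg: "(bb ^ k / ci ^ (k * Suc n) * \<tau> ^ Suc n * X) * Y / ((\<tau> * Q) * (cc ^ k / ci ^ (k * n) * \<tau> ^ n * Z) * W)
     = (bb / (ci * cc)) ^ k * (X * Y * inverse Q * inverse Z * inverse W)"
    if "ci \<noteq> 0" "cc \<noteq> 0" for bb ci cc X Y Z W Q n
  proof -
    have gen: "(b' / (C1 * C) * (\<tau> * T) * X) * Y / ((\<tau> * Q) * (D / C * T * Z) * W)
        = b' / (C1 * D) * (X * Y * inverse Q * inverse Z * inverse W)"
      if "C1 \<noteq> 0" "C \<noteq> 0" "T \<noteq> 0" "D \<noteq> 0" for b' C1 C T D
    proof -
      have "(b' / (C1 * C) * (\<tau> * T) * X) * Y / ((\<tau> * Q) * (D / C * T * Z) * W)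
          = (\<tau> * T / C) * (b' / C1 * X * Y) / ((\<tau> * T / C) * (D * Q * Z * W))"
        by (simp add: mult_ac)
      also have "\<dots> = (b' / C1 * X * Y) / (D * Q * Z * W)"
        using that \<tau>0 by (intro mult_divide_mult_cancel_left) auto
      finally show ?thesis by (simp add: divide_inverse mult_ac)
    qed
    have "bb ^ k / ci ^ (k * Suc n) * \<tau> ^ Suc n * X * Y / ((\<tau> * Q) * (cc ^ k / ci ^ (k * n) * \<tau> ^ n * Z) * W)
        = bb ^ k / (ci ^ k * ci ^ (k * n)) * (\<tau> * \<tau> ^ n) * X * Y / ((\<tau> * Q) * (cc ^ k / ci ^ (k * n) * \<tau> ^ n * Z) * W)"
      by (simp only: power_add mult_Suc_right power_Suc)
    also have "\<dots> = bb ^ k / (ci ^ k * cc ^ k) * (X * Y * inverse Q * inverse Z * inverse W)"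
      by (rule gen) (use that \<tau>0 in auto)
    finally show ?thesis by (simp only: power_mult_distrib power_divide)
  qed
  have pB: "(\<Prod>m\<in>B. qpoch (b m / c i / q ^ k) q N)
      = (prod b B ^ k / c i ^ (k * card B)) * \<tau> ^ card B
        * (\<Prod>m\<in>B. qpoch (q * c i / b m) q k * qpoch (b m / c i) q (N - k))"
    by (rule prefl) (use b0 in auto)
  have pI': "(\<Prod>m\<in>I - {i}. qpoch (c m / c i / q ^ k) q N)
      = (prod c (I - {i}) ^ k / c i ^ (k * card (I - {i}))) * \<tau> ^ card (I - {i})
        * (\<Prod>m\<in>I - {i}. qpoch (q * c i / c m) q k * qpoch (c m / c i) q (N - k))"
    by (rule prefl) (use c0 in auto)
  show ?thesis
    unfolding res_trunc_def res_factor_def pB pI' own card_in cI rho_def pI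
    by (subst alg[OF nz]) (simp only: prod_inversef[unfolded o_def] prod.distrib inverse_mult_distrib mult.assoc)
qed

lemma reflected_nonzero:
  assumes "i \<in> I" "i' \<in> I - {i}"
  shows "qpoch_inf (q * c i / c i') q \<noteq> 0"
proof
  assume "qpoch_inf (q * c i / c i') q = 0"
  then obtain k where "q * c i / c i' * q ^ k = 1" using qpoch_inf_eq_0_iff[OF q1] by blast
  hence "c i / c i' * q ^ Suc k = 1" by (simp add: mult.commute mult.left_commute)
  thus False using gen_in[of i' i] assms qpoch_inf_eq_0_iff[OF q1] by blast
qed

lemma res_trunc_LIMSEQ:
  assumes i: "i \<in> I"
  shows "(\<lambda>N. \<Sum>k<N. res_trunc N i k) \<longlonglongrightarrow> (\<Sum>k. res i k)"
    and "summable (\<lambda>k. norm (res i k))"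
proof -
  define f where "f = res_factor i"
  have bq: "bdd2 (\<lambda>k N. qpoch a q (l k N))" for a l
    using bdd2_qpoch[OF q1, of a "\<lambda>_ _. 0" l] by simp
  have "bdd2 f"
    unfolding f_def res_factor_def
    by (intro bdd2_mult bdd2_prod bq bdd2_qpoch bdd2_inverse_qpoch_base bdd2_inverse_qpoch q1
        qpoch_inf_base_nonzero reflected_nonzero i gen_in gen_cross) auto
  then obtain M where M: "\<And>k N. norm (f k N) \<le> M" unfolding bdd2_def by blast
  define a where "a k N = (if k < N then rho ^ k * f k N else 0)" for k N
  have "M \<ge> 0" using M norm_ge_zero order_trans by blast
  hence bound: "norm (a k N) \<le> M * norm rho ^ k" for k N
    using M[of k N] by (auto simp: a_def norm_mult norm_power mult_left_mono mult.commute[of M])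
  have lim: "(\<lambda>N. a k N) \<longlonglongrightarrow> res i k" for k
  proof -
    have sh: "filterlim (\<lambda>N. N - l) at_top sequentially" for l :: nat
      by (rule filterlim_minus_const_nat_at_top)
    have L: "(\<lambda>N. qpoch u q (N - l)) \<longlonglongrightarrow> qpoch_inf u q" for u l
      by (rule filterlim_compose[OF qpoch_LIMSEQ[OF q1] sh])
    have "(\<lambda>N. rho ^ k * f k N) \<longlonglongrightarrow> rho ^ k *
      ((\<Prod>m\<in>B. qpoch (q * c i / b m) q k * qpoch_inf (b m / c i) q) *
       (\<Prod>m\<in>E. qpoch_inf (e m * c i * q ^ k) q) *
       (inverse (qpoch q q k) * inverse (qpoch_inf q q)) *
       (\<Prod>i'\<in>I - {i}. inverse (qpoch (q * c i / c i') q k) * inverse (qpoch_inf (c i' / c i) q)) *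
       (\<Prod>j\<in>J. inverse (qpoch_inf (d j * c i * q ^ k) q)))"
      unfolding f_def res_factor_def
    proof (intro tendsto_intros tendsto_inverse L qpoch_LIMSEQ q1)
      show "qpoch_inf (d j * c i * q ^ k) q \<noteq> 0" if "j \<in> J" for j
        using gen_cross[OF i that] qpoch_inf_split[OF q1, of "d j * c i" k] by auto
    qed (use qpoch_inf_base_nonzero[OF q1] gen_in i in auto)
    also have "rho ^ k *
      ((\<Prod>m\<in>B. qpoch (q * c i / b m) q k * qpoch_inf (b m / c i) q) *
       (\<Prod>m\<in>E. qpoch_inf (e m * c i * q ^ k) q) *
       (inverse (qpoch q q k) * inverse (qpoch_inf q q)) *
       (\<Prod>i'\<in>I - {i}. inverse (qpoch (q * c i / c i') q k) * inverse (qpoch_inf (c i' / c i) q)) *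
       (\<Prod>j\<in>J. inverse (qpoch_inf (d j * c i * q ^ k) q))) = res i k"
      by (simp only: res_def divide_inverse prod_inversef[unfolded o_def] prod.distrib inverse_mult_distrib mult.assoc)
    finally have "(\<lambda>N. rho ^ k * f k N) \<longlonglongrightarrow> res i k" .
    moreover have "eventually (\<lambda>N. rho ^ k * f k N = a k N) sequentially"
      using eventually_gt_at_top[of k] by eventually_elim (simp add: a_def)
    ultimately show ?thesis by (rule Lim_transform_eventually)
  qed
  have sM: "summable (\<lambda>k. M * norm rho ^ k)"
    using norm_rho by (intro summable_mult summable_geometric) simp
  have T: "summable (\<lambda>k. norm (res i k)) \<and> (\<lambda>N. \<Sum>k. a k N) \<longlonglongrightarrow> (\<Sum>k. res i k)"
    using tannerys_theorem[of a "res i" sequentially, OF lim always_eventually sM] bound by auto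
  have "(\<Sum>k. a k N) = (\<Sum>k<N. res_trunc N i k)" for N
    by (subst suminf_finite[of "{..<N}"]) (auto simp: a_def f_def res_trunc_eq[OF i])
  with T show "(\<lambda>N. \<Sum>k<N. res_trunc N i k) \<longlonglongrightarrow> (\<Sum>k. res i k)" by simp
  from T show "summable (\<lambda>k. norm (res i k))" by blast
qed

text \<open>The sum of all residues of \<open>G(t) dt / t\<close> vanishes.  The outer residues enter with the opposite sign, since
  \<open>t \<mapsto> 1/t\<close> maps \<open>dt / t\<close> to its negative.\<close>

theorem sum_inner_eq_sum_outer:
  "(\<Sum>i\<in>I. \<Sum>k. res i k) = (\<Sum>j\<in>J. \<Sum>k. two_sided_poles.res q J I E B d c e b j k)"
proof -
  interpret sw: two_sided_poles q J I E B d c e b by (rule swapped)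
  have "(\<lambda>N. (\<Sum>i\<in>I. \<Sum>k<N. res_trunc N i k) - (\<Sum>j\<in>J. \<Sum>k<N. sw.res_trunc N j k))
      \<longlonglongrightarrow> (\<Sum>i\<in>I. \<Sum>k. res i k) - (\<Sum>j\<in>J. \<Sum>k. sw.res j k)"
    by (intro tendsto_diff tendsto_sum res_trunc_LIMSEQ sw.res_trunc_LIMSEQ)
  moreover have "(\<lambda>N. sw.rho ^ N - rho ^ N) \<longlonglongrightarrow> 0 - 0"
    by (intro tendsto_diff LIMSEQ_power_zero norm_rho sw.norm_rho)
  ultimately show ?thesis
    unfolding res_trunc_sum sw.rho_def[symmetric] using LIMSEQ_unique by fastforce
qed

end

section \<open>Series that depend continuously on their parameters\<close>

lemma qpochs_Nil [simp]: "qpochs [] p k = 1"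
  and qpochs_Cons [simp]: "qpochs (a # as) p k = qpoch a p k * qpochs as p k"
  by (simp_all add: qpochs_def)

text \<open>A bound that holds for all indices \<open>k\<close> and for all parameters near \<open>u\<close>, as needed for Tannery's theorem.\<close>

definition locally_bounded :: "(nat \<Rightarrow> complex \<Rightarrow> complex) \<Rightarrow> complex \<Rightarrow> bool" where
  "locally_bounded f u \<longleftrightarrow> (\<exists>M. \<forall>\<^sub>F v in nhds u. \<forall>k. norm (f k v) \<le> M)"

lemma locally_bounded_mult:
  assumes "locally_bounded f u" "locally_bounded g u"
  shows "locally_bounded (\<lambda>k v. f k v * g k v) u"
proof -
  obtain M1 M2 where M: "\<forall>\<^sub>F v in nhds u. \<forall>k. norm (f k v) \<le> M1" "\<forall>\<^sub>F v in nhds u. \<forall>k. norm (g k v) \<le> M2"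
    using assms unfolding locally_bounded_def by blast
  have "\<forall>\<^sub>F v in nhds u. \<forall>k. norm (f k v * g k v) \<le> M1 * M2"
    using M by eventually_elim (auto simp: norm_mult intro!: mult_mono intro: order_trans[OF norm_ge_zero])
  thus ?thesis unfolding locally_bounded_def by blast
qed

lemma eventually_norm_diff_less:
  assumes "isCont f u" "\<delta> > (0 :: real)"
  shows "\<forall>\<^sub>F v in nhds u. norm (f v - f u) < \<delta>"
proof -
  have "(f \<longlongrightarrow> f u) (nhds u)"
    using assms(1) by (simp add: isCont_def tendsto_nhds_iff)
  thus ?thesis using assms(2) by (simp add: tendsto_iff dist_norm)
qed

lemma locally_bounded_qpoch:
  assumes "norm p < 1" "isCont f u"
  shows "locally_bounded (\<lambda>k v. qpoch (f v) p k) u"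
proof -
  have "\<forall>\<^sub>F v in nhds u. \<forall>k. norm (qpoch (f v) p k) \<le> qbound (norm (f u) + 1) p"
    using eventually_norm_diff_less[OF assms(2) zero_less_one]
  proof eventually_elim
    case (elim v)
    have "norm (f v) \<le> norm (f u) + 1" using elim norm_triangle_ineq2[of "f v" "f u"] by linarith
    thus ?case using norm_qpoch_le[OF assms(1)] by blast
  qed
  thus ?thesis unfolding locally_bounded_def by blast
qed

lemma locally_bounded_inverse_qpoch:
  assumes "norm p < 1" "isCont f u" "qpoch_inf (f u) p \<noteq> 0"
  shows "locally_bounded (\<lambda>k v. inverse (qpoch (f v) p k)) u"
proof -
  obtain c \<delta> where c: "c > 0" "\<delta> > 0" "\<And>b' k. norm (b' - f u) < \<delta> \<Longrightarrow> c \<le> norm (qpoch b' p k)"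
    using qpoch_lower_bound[OF assms(1,3)] by blast
  have "\<forall>\<^sub>F v in nhds u. \<forall>k. norm (inverse (qpoch (f v) p k)) \<le> inverse c"
    using eventually_norm_diff_less[OF assms(2) c(2)]
  proof eventually_elim
    case (elim v)
    thus ?case using c(1) c(3)[of "f v"] by (auto simp: norm_inverse intro!: le_imp_inverse_le)
  qed
  thus ?thesis unfolding locally_bounded_def by blast
qed

lemma locally_bounded_qpochs:
  assumes "norm p < 1" "\<forall>f\<in>set As. isCont f u"
  shows "locally_bounded (\<lambda>k v. qpochs (map (\<lambda>f. f v) As) p k) u"
  using assms
proof (induction As)
  case Nil
  show ?case by (auto simp: locally_bounded_def)
next
  case (Cons f As)
  thus ?case by (simp add: locally_bounded_mult locally_bounded_qpoch)
qed

lemma locally_bounded_inverse_qpochs: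
  assumes "norm p < 1" "\<forall>f\<in>set As. isCont f u \<and> qpoch_inf (f u) p \<noteq> 0"
  shows "locally_bounded (\<lambda>k v. inverse (qpochs (map (\<lambda>f. f v) As) p k)) u"
  using assms
proof (induction As)
  case Nil
  show ?case by (auto simp: locally_bounded_def)
next
  case (Cons f As)
  thus ?case by (simp add: locally_bounded_mult locally_bounded_inverse_qpoch)
qed

lemma isCont_qpochs:
  assumes "\<forall>f\<in>set As. isCont f u"
  shows "isCont (\<lambda>v. qpochs (map (\<lambda>f. f v) As) p k) u"
  using assms by (induction As) (auto simp: qpoch_def intro!: continuous_intros)

lemma qpochs_nonzero:
  assumes "norm p < 1" "\<forall>a\<in>set As. qpoch_inf a p \<noteq> 0"
  shows "qpochs As p k \<noteq> 0"
  using assms by (induction As) (auto simp: qpoch_nonzero)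

lemma isCont_phi_aux:
  fixes u :: complex
  assumes p: "norm p < 1" and A: "\<forall>f\<in>set As. isCont f u"
    and B: "\<forall>f\<in>set Bs. isCont f u \<and> qpoch_inf (f u) p \<noteq> 0"
    and t: "isCont t u" "norm (t u) < 1"
  defines "a \<equiv> (\<lambda>k v. qpochs (map (\<lambda>f. f v) As) p k / qpochs (p # map (\<lambda>f. f v) Bs) p k * t v ^ k)"
  shows "summable (\<lambda>k. norm (a k u))" "isCont (\<lambda>v. \<Sum>k. a k v) u"
proof -
  let ?C = "\<lambda>k (v :: complex). qpochs (map (\<lambda>f. f v) As) p k * inverse (qpochs (map (\<lambda>f. f v) ((\<lambda>_. p) # Bs)) p k)"
  have Bp: "\<forall>f\<in>set ((\<lambda>_. p) # Bs). isCont f u \<and> qpoch_inf (f u) p \<noteq> 0"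
    using B qpoch_inf_base_nonzero[OF p] by auto
  have a_eq: "a k v = ?C k v * t v ^ k" for k v
    by (simp add: a_def divide_inverse)
  have "locally_bounded ?C u"
    by (intro locally_bounded_mult locally_bounded_qpochs locally_bounded_inverse_qpochs p A Bp)
  then obtain M where M: "\<forall>\<^sub>F v in nhds u. \<forall>k. norm (?C k v) \<le> M"
    unfolding locally_bounded_def by blast
  define r where "r = (norm (t u) + 1) / 2"
  have r: "norm (t u) < r" "r < 1" using t(2) unfolding r_def by (simp_all add: field_simps)
  have r0: "r > 0" using r(1) norm_ge_zero[of "t u"] by linarith
  have tb: "\<forall>\<^sub>F v in nhds u. norm (t v - t u) < r - norm (t u)"
    by (rule eventually_norm_diff_less[OF t(1)]) (use r in simp)
  have "\<forall>\<^sub>F v in nhds u. \<forall>k. norm (a k v) \<le> M * r ^ k"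
    using M tb
  proof eventually_elim
    case (elim v)
    have "norm (t v) \<le> r" using elim(2) norm_triangle_ineq2[of "t v" "t u"] by linarith
    moreover have "M \<ge> 0" using elim(1) norm_ge_zero order_trans by blast
    ultimately show ?case
      using elim(1) unfolding a_eq norm_mult norm_power
      by (intro allI mult_mono power_mono) auto
  qed
  hence ev: "\<forall>\<^sub>F v in at u. \<forall>k. norm (a k v) \<le> M * r ^ k"
    using filter_leD[OF at_le[of UNIV UNIV]] eventually_at_filter[of _ u UNIV]
    by (metis (mono_tags, lifting) eventually_mono)
  hence ev': "\<forall>\<^sub>F (k, v) in at_top \<times>\<^sub>F at u. norm (a k v) \<le> M * r ^ k"
    unfolding eventually_prod_filter by (intro exI[of _ "\<lambda>_. True"] exI[of _ "\<lambda>v. \<forall>k. norm (a k v) \<le> M * r ^ k"]) auto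
  have c: "((\<lambda>v. a k v) \<longlongrightarrow> a k u) (at u)" for k
  proof -
    have "qpochs (map (\<lambda>f. f u) ((\<lambda>_. p) # Bs)) p k \<noteq> 0"
      by (rule qpochs_nonzero[OF p]) (use Bp in auto)
    hence "isCont (\<lambda>v. ?C k v * t v ^ k) u"
      using A Bp t by (intro continuous_intros isCont_qpochs) auto
    thus ?thesis unfolding a_eq isCont_def .
  qed
  have sM: "summable (\<lambda>k. M * r ^ k)" using r r0 by (intro summable_mult summable_geometric) simp
  have "summable (\<lambda>k. norm (a k u)) \<and> ((\<lambda>v. \<Sum>k. a k v) \<longlongrightarrow> (\<Sum>k. a k u)) (at u)"
    using tannerys_theorem[of a "\<lambda>k. a k u" "at u", OF c ev' sM] by auto
  thus "summable (\<lambda>k. norm (a k u))" "isCont (\<lambda>v. \<Sum>k. a k v) u"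
    by (auto simp: isCont_def)
qed

lemma isCont_phi:
  fixes u :: complex
  assumes "norm p < 1" "\<forall>f\<in>set As. isCont f u"
    "\<forall>f\<in>set Bs. isCont f u \<and> qpoch_inf (f u) p \<noteq> 0" "isCont t u" "norm (t u) < 1"
  shows "isCont (\<lambda>v. phi (map (\<lambda>f. f v) As) (map (\<lambda>f. f v) Bs) p (t v)) u"
  unfolding phi_def by (rule isCont_phi_aux(2)[OF assms])

lemma phi_summable:
  assumes "norm p < 1" "\<forall>b\<in>set bs. qpoch_inf b p \<noteq> 0" "norm t < 1"
  shows "summable (\<lambda>k. norm (qpochs as p k / qpochs (p # bs) p k * t ^ k))"
  using isCont_phi_aux(1)[of p "map (\<lambda>a _. a) as" 0 "map (\<lambda>a _. a) bs" "\<lambda>_. t"] assms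
  by (auto simp: o_def)

section \<open>The very-well-poised sum\<close>

text \<open>The factor of a very-well-poised term that depends on \<open>\<alpha>\<close> and one further parameter only.  Leaving out the
  usual denominator \<open>1 - \<alpha>\<close> avoids a case distinction for \<open>\<alpha> = 1\<close>.\<close>

definition vwp_weight :: "complex \<Rightarrow> complex \<Rightarrow> complex \<Rightarrow> nat \<Rightarrow> complex" where
  "vwp_weight \<alpha> \<beta> p n = (1 - \<alpha> * p ^ (2 * n)) * (qpochs [\<alpha>, \<beta>] p n / qpochs [p, \<alpha> * p / \<beta>] p n)"

definition vwp6 :: "complex \<Rightarrow> complex \<Rightarrow> complex \<Rightarrow> complex \<Rightarrow> complex \<Rightarrow> nat \<Rightarrow> complex" where
  "vwp6 \<alpha> b c d p k = (1 - \<alpha> * p ^ (2 * k)) *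
     (qpochs [\<alpha>, b, c, d] p k / qpochs [p, \<alpha> * p / b, \<alpha> * p / c, \<alpha> * p / d] p k) * (\<alpha> * p / (b * c * d)) ^ k"

text \<open>The identity behind the telescoping, with \<open>y = p^k\<close> and \<open>z = \<alpha> p / (b c d)\<close>.  It holds with \<open>\<alpha>\<close> as an
  independent variable if \<open>\<alpha> p\<close> is everywhere replaced by \<open>z b c d\<close>.\<close>

lemma vwp6_telescope_step:
  fixes \<alpha> b c d y z :: complex
  shows "(1 - \<alpha> * y^2) * ((1 - z * c * d * y) * (1 - z * b * d * y) * (1 - z * b * c * y)) * (1 - z)
    - (1 - \<alpha> * y) * (1 - z * b * c * d * y^2) * y * ((1 - z * d) * (1 - z * c) * (1 - z * b))
    = (1 - \<alpha> * z * y) * (1 - y) * ((1 - z * c * d * y) * (1 - z * b * d * y) * (1 - z * b * c * y))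
    - (1 - z^2 * b * c * d * y) * (1 - \<alpha> * y) * ((1 - b * y) * (1 - c * y) * (1 - d * y)) * z"
  by algebra


text \<open>Either the series converges or it terminates; in a terminating series the last parameter may have any
  modulus.  Both alternatives survive the step from \<open>\<alpha>\<close> to \<open>\<alpha> p\<close>.\<close>

locale vwp6_params =
  fixes \<alpha> b c d p :: complex
  assumes p: "norm p < 1"
    and nz: "b \<noteq> 0" "c \<noteq> 0" "d \<noteq> 0"
    and den: "qpoch_inf (\<alpha> * p / b) p \<noteq> 0" "qpoch_inf (\<alpha> * p / c) p \<noteq> 0"
      "qpoch_inf (\<alpha> * p / d) p \<noteq> 0" "qpoch_inf (\<alpha> * p / (b * c * d)) p \<noteq> 0"
    and conv: "norm (\<alpha> * p / (b * c * d)) < 1 \<or> (\<exists>K. qpoch c p K * qpoch d p K = 0)"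
begin

definition z where "z = \<alpha> * p / (b * c * d)"

text \<open>Rogers' product divided by the same product with \<open>\<alpha> p\<close> in place of \<open>\<alpha>\<close>, and the certificate for the
  corresponding recurrence of the sum: the rational factor in front of the term was determined from its values
  at \<open>p^k = 0\<close> and \<open>p^k = 1 / \<alpha>\<close>.\<close>

definition shift_factor :: complex where
  "shift_factor = (1 - \<alpha>) * ((1 - \<alpha> * p / (b * c)) * (1 - \<alpha> * p / (b * d)) * (1 - \<alpha> * p / (c * d))) /
     ((1 - \<alpha> * p / b) * (1 - \<alpha> * p / c) * (1 - \<alpha> * p / d) * (1 - z))"

definition antidifference :: "nat \<Rightarrow> complex" where
  "antidifference k = - (1 - \<alpha> * z * p ^ k) / (1 - z) * (1 - p ^ k) *
     (qpochs [\<alpha>, b, c, d] p k / qpochs [p, \<alpha> * p / b, \<alpha> * p / c, \<alpha> * p / d] p k) * z ^ k"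

lemma one_minus_nonzero:
  "1 - \<alpha> * p / b \<noteq> 0" "1 - \<alpha> * p / c \<noteq> 0" "1 - \<alpha> * p / d \<noteq> 0" "1 - z \<noteq> 0"
  using qpoch_nonzero[OF p den(1), of 1] qpoch_nonzero[OF p den(2), of 1]
    qpoch_nonzero[OF p den(3), of 1] qpoch_nonzero[OF p den(4), of 1]
  by (auto simp: qpoch_Suc z_def)

lemma telescope:
  "vwp6 \<alpha> b c d p k - shift_factor * vwp6 (\<alpha> * p) b c d p k = antidifference (Suc k) - antidifference k"
proof -
  define y where "y = p ^ k"
  define P where "P = qpoch p p k"
  define A where "A = \<alpha> * p"
  have A: "A = z * b * c * d" using nz by (simp add: A_def z_def)
  have rat: "\<alpha> * p / b = z * c * d" "\<alpha> * p / c = z * b * d" "\<alpha> * p / d = z * b * c"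
    "\<alpha> * p / (b * c) = z * d" "\<alpha> * p / (b * d) = z * c" "\<alpha> * p / (c * d) = z * b"
    using nz by (simp_all add: z_def)
  have rat': "\<alpha> * p * p / b = z * c * d * p" "\<alpha> * p * p / c = z * b * d * p" "\<alpha> * p * p / d = z * b * c * p"
    "\<alpha> * p * p / (b * c * d) = z * p"
    using nz by (simp_all add: z_def)
  have nB: "1 - z * c * d * y \<noteq> 0" "qpoch (z * c * d) p k \<noteq> 0" "1 - z * c * d \<noteq> 0"
    and nC: "1 - z * b * d * y \<noteq> 0" "qpoch (z * b * d) p k \<noteq> 0" "1 - z * b * d \<noteq> 0"
    and nD: "1 - z * b * c * y \<noteq> 0" "qpoch (z * b * c) p k \<noteq> 0" "1 - z * b * c \<noteq> 0"
    and nP: "P \<noteq> 0" "1 - p * y \<noteq> 0" and nz1: "1 - z \<noteq> 0"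
    using qpoch_nonzero[OF p den(1), of "Suc k"] qpoch_nonzero[OF p den(2), of "Suc k"]
      qpoch_nonzero[OF p den(3), of "Suc k"] qpoch_nonzero[OF p qpoch_inf_base_nonzero[OF p], of "Suc k"]
      one_minus_nonzero
    by (auto simp: qpoch_Suc y_def P_def rat)
  define T where "T = (1 - z * c * d * y) * (1 - z * b * d * y) * (1 - z * b * c * y)"
  define H where "H = qpoch \<alpha> p k * qpoch b p k * qpoch c p k * qpoch d p k /
    (P * qpoch (z * c * d) p k * qpoch (z * b * d) p k * qpoch (z * b * c) p k * T) * z ^ k"
  have T0: "T \<noteq> 0" using nB nC nD by (simp add: T_def)
  have t1: "vwp6 \<alpha> b c d p k = (1 - \<alpha> * y^2) * T * H"
    unfolding vwp6_def qpochs_Cons qpochs_Nil rat z_def[symmetric]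
    using T0 by (simp add: H_def y_def P_def power_mult mult.commute[of 2])
  have t4: "antidifference k = - (1 - \<alpha> * z * y) / (1 - z) * (1 - y) * T * H"
    unfolding antidifference_def qpochs_Cons qpochs_Nil rat
    using T0 by (simp add: H_def y_def P_def)
  have t3: "antidifference (Suc k) = - (1 - z^2 * b * c * d * y) / (1 - z) * ((1 - \<alpha> * y) * ((1 - b * y) * (1 - c * y) * (1 - d * y))) * z * H"
  proof -
    have "\<alpha> * z * p ^ Suc k = z * A * y" by (simp add: A_def y_def)
    also have "\<dots> = z^2 * b * c * d * y" by (simp add: A power2_eq_square)
    finally have e: "\<alpha> * z * p ^ Suc k = z^2 * b * c * d * y" .
    show ?thesis
      unfolding antidifference_def qpochs_Cons qpochs_Nil rat e qpoch_Suc y_def[symmetric]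
      using nP by (simp add: H_def T_def P_def[symmetric] y_def[symmetric] mult_ac)
  qed
  have t2: "shift_factor * vwp6 (\<alpha> * p) b c d p k
      = (1 - \<alpha> * y) * (1 - z * b * c * d * y^2) * y * ((1 - z * d) * (1 - z * c) * (1 - z * b)) / (1 - z) * H"
  proof -
    have up: "qpoch (\<alpha> * p) p k * (1 - \<alpha>) = qpoch \<alpha> p k * (1 - \<alpha> * y)"
      using qpoch_Suc_left[of \<alpha> p k] qpoch_Suc[of \<alpha> p k] by (simp add: y_def mult.commute)
    have low: "qpoch (w * p) p k = qpoch w p k * (1 - w * y) / (1 - w)" if "1 - w \<noteq> 0" for w
      using qpoch_Suc_left[of w p k] qpoch_Suc[of w p k] that by (simp add: y_def field_simps)
    have e: "\<alpha> * p * p ^ (2 * k) = z * b * c * d * y^2"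
      using A by (simp add: A_def y_def power_mult mult.commute[of 2])
    have "shift_factor * vwp6 (\<alpha> * p) b c d p k
      = (1 - z * b * c * d * y^2) * ((1 - z * d) * (1 - z * c) * (1 - z * b)) / (1 - z) * (qpoch (\<alpha> * p) p k * (1 - \<alpha>)) *
        (qpoch b p k * qpoch c p k * qpoch d p k / (P * qpoch (z * c * d) p k * qpoch (z * b * d) p k * qpoch (z * b * c) p k * T)) * (z * p) ^ k"
      unfolding shift_factor_def vwp6_def qpochs_Cons qpochs_Nil rat rat' e
        low[OF nB(3)] low[OF nC(3)] low[OF nD(3)] P_def[symmetric]
      using nB nC nD nP nz1 T0 by (simp add: T_def mult_ac)
    thus ?thesis
      unfolding up H_def by (simp add: power_mult_distrib y_def mult_ac)
  qed
  have "vwp6 \<alpha> b c d p k - shift_factor * vwp6 (\<alpha> * p) b c d p k =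
     ((1 - \<alpha> * y^2) * T * (1 - z)
      - (1 - \<alpha> * y) * (1 - z * b * c * d * y^2) * y * ((1 - z * d) * (1 - z * c) * (1 - z * b))) / (1 - z) * H"
    unfolding t1 t2 using nz1 by (simp add: field_simps)
  also have "\<dots> = ((1 - \<alpha> * z * y) * (1 - y) * T
    - (1 - z^2 * b * c * d * y) * (1 - \<alpha> * y) * ((1 - b * y) * (1 - c * y) * (1 - d * y)) * z) / (1 - z) * H"
    unfolding T_def by (subst vwp6_telescope_step) (rule refl)
  also have "\<dots> = antidifference (Suc k) - antidifference k"
  proof -
    have "(u1 * u2 * T - n * m1 * m2 * z) / w * H = (- n / w * (m1 * m2) * z * H) - (- u1 / w * u2 * T * H)"
      for u1 u2 n m1 m2 w
      by (simp add: divide_inverse algebra_simps)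
    thus ?thesis unfolding t3 t4 .
  qed
  finally show ?thesis .
qed

lemma vwp6_eventually_0:
  assumes "qpoch c p K * qpoch d p K = 0" "k \<ge> K"
  shows "vwp6 \<alpha>' b c d p k = 0" "antidifference k = 0"
proof -
  have "qpoch w p K dvd qpoch w p k" for w
    using qpoch_add[of w p K "k - K"] assms(2) by auto
  hence "qpoch c p k * qpoch d p k = 0"
    using assms(1) by (metis dvd_0_left_iff mult_eq_0_iff)
  thus "vwp6 \<alpha>' b c d p k = 0" "antidifference k = 0"
    by (auto simp: vwp6_def antidifference_def)
qed

lemma vwp6_eq_phi_terms:
  "vwp6 \<alpha> b c d p k =
     qpochs [\<alpha>, b, c, d] p k / qpochs [p, \<alpha> * p / b, \<alpha> * p / c, \<alpha> * p / d] p k * z ^ k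
     - \<alpha> * (qpochs [\<alpha>, b, c, d] p k / qpochs [p, \<alpha> * p / b, \<alpha> * p / c, \<alpha> * p / d] p k * (p^2 * z) ^ k)"
proof -
  have "(p^2 * z) ^ k = p ^ (2 * k) * z ^ k" by (simp add: power_mult_distrib power_mult)
  thus ?thesis
    unfolding vwp6_def z_def[symmetric] by (simp only:) (simp only: algebra_simps mult_1_left mult_1_right)
qed

lemma norm_p2z: "norm z < 1 \<Longrightarrow> norm (p^2 * z) < 1"
  using norm_sq_less_1[OF p] mult_strict_mono[of "norm (p^2)" 1 "norm z" 1]
  by (auto simp: norm_mult)

lemma den_list: "\<forall>w\<in>set [\<alpha> * p / b, \<alpha> * p / c, \<alpha> * p / d]. qpoch_inf w p \<noteq> 0"
  using den by simp

lemma summable_vwp6: "summable (vwp6 \<alpha> b c d p)"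
proof (cases "\<exists>K. qpoch c p K * qpoch d p K = 0")
  case True
  then obtain K where K: "qpoch c p K * qpoch d p K = 0" by blast
  show ?thesis
    by (rule summable_finite[of "{..<K}"]) (use vwp6_eventually_0(1)[OF K] in \<open>auto simp: not_less\<close>)
next
  case False
  hence z1: "norm z < 1" using conv by (simp add: z_def)
  show ?thesis
    unfolding vwp6_eq_phi_terms
    by (intro summable_diff summable_mult summable_norm_cancel[OF phi_summable[OF p den_list]] z1 norm_p2z)
qed

lemma vwp6_suminf_eq_phi:
  assumes "norm z < 1"
  shows "suminf (vwp6 \<alpha> b c d p) = phi [\<alpha>, b, c, d] [\<alpha> * p / b, \<alpha> * p / c, \<alpha> * p / d] p z
    - \<alpha> * phi [\<alpha>, b, c, d] [\<alpha> * p / b, \<alpha> * p / c, \<alpha> * p / d] p (p^2 * z)"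
  unfolding vwp6_eq_phi_terms phi_def
  by (subst suminf_diff[symmetric] suminf_mult[symmetric],
      (intro summable_mult summable_norm_cancel[OF phi_summable[OF p den_list]] assms norm_p2z)+)+ (rule refl)

lemma antidifference_LIMSEQ: "antidifference \<longlonglongrightarrow> 0"
proof (cases "\<exists>K. qpoch c p K * qpoch d p K = 0")
  case True
  then obtain K where K: "qpoch c p K * qpoch d p K = 0" by blast
  show ?thesis
    by (rule tendsto_eventually, rule eventually_mono[OF eventually_ge_at_top[of K]])
       (rule vwp6_eventually_0(2)[OF K])
next
  case False
  hence z1: "norm z < 1" using conv by (simp add: z_def)
  have S: "(\<lambda>k. qpochs [\<alpha>, b, c, d] p k / qpochs (p # [\<alpha> * p / b, \<alpha> * p / c, \<alpha> * p / d]) p k * z ^ k) \<longlonglongrightarrow> 0"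
    using phi_summable[OF p den_list z1, of "[\<alpha>, b, c, d]"]
    by (intro summable_LIMSEQ_zero) (rule summable_norm_cancel)
  have "(\<lambda>k. - (1 - \<alpha> * z * p ^ k) / (1 - z) * (1 - p ^ k) *
      (qpochs [\<alpha>, b, c, d] p k / qpochs (p # [\<alpha> * p / b, \<alpha> * p / c, \<alpha> * p / d]) p k * z ^ k))
    \<longlonglongrightarrow> - (1 - \<alpha> * z * 0) / (1 - z) * (1 - 0) * 0"
    by (intro tendsto_intros S LIMSEQ_power_zero p) (use one_minus_nonzero in auto)
  thus ?thesis by (simp add: antidifference_def[abs_def] mult.assoc del: qpochs_Cons)
qed

lemma shifted: "vwp6_params (\<alpha> * p) b c d p"
proof
  have *: "qpoch_inf (w * p) p \<noteq> 0" if "qpoch_inf w p \<noteq> 0" for w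
    using that qpoch_inf_split[OF p, of w 1] by auto
  show "qpoch_inf (\<alpha> * p * p / b) p \<noteq> 0" "qpoch_inf (\<alpha> * p * p / c) p \<noteq> 0"
    "qpoch_inf (\<alpha> * p * p / d) p \<noteq> 0" "qpoch_inf (\<alpha> * p * p / (b * c * d)) p \<noteq> 0"
    using den[THEN *] by simp_all
  have "norm (\<alpha> * p * p / (b * c * d)) < 1" if "norm (\<alpha> * p / (b * c * d)) < 1"
  proof -
    have "norm (\<alpha> * p * p / (b * c * d)) = norm (\<alpha> * p / (b * c * d)) * norm p"
      by (simp add: norm_mult norm_divide)
    also have "\<dots> < 1" using that p mult_strict_mono[of "norm (\<alpha> * p / (b * c * d))" 1 "norm p" 1] by auto
    finally show ?thesis .
  qed
  thus "norm (\<alpha> * p * p / (b * c * d)) < 1 \<or> (\<exists>K. qpoch c p K * qpoch d p K = 0)"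
    using conv by blast
qed (use p nz in auto)

lemma vwp6_shift: "suminf (vwp6 \<alpha> b c d p) = shift_factor * suminf (vwp6 (\<alpha> * p) b c d p)"
proof -
  interpret sh: vwp6_params "\<alpha> * p" b c d p by (rule shifted)
  have part: "(\<Sum>k<K. vwp6 \<alpha> b c d p k) - shift_factor * (\<Sum>k<K. vwp6 (\<alpha> * p) b c d p k) = antidifference K" for K
  proof (induction K)
    case (Suc K)
    thus ?case using telescope[of K] by (simp add: algebra_simps)
  qed (simp add: antidifference_def)
  have "(\<lambda>K. (\<Sum>k<K. vwp6 \<alpha> b c d p k) - shift_factor * (\<Sum>k<K. vwp6 (\<alpha> * p) b c d p k))
      \<longlonglongrightarrow> suminf (vwp6 \<alpha> b c d p) - shift_factor * suminf (vwp6 (\<alpha> * p) b c d p)"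
    by (intro tendsto_intros summable_LIMSEQ summable_vwp6 sh.summable_vwp6)
  hence "suminf (vwp6 \<alpha> b c d p) - shift_factor * suminf (vwp6 (\<alpha> * p) b c d p) = 0"
    unfolding part using antidifference_LIMSEQ LIMSEQ_unique by blast
  thus ?thesis by simp
qed

end

text \<open>Iterating leads to \<open>\<alpha> p^n\<close>, which tends to zero, where the series reduces to its first term.\<close>

lemma vwp6_iterate:
  assumes "vwp6_params \<alpha> b c d p"
  shows "vwp6_params (\<alpha> * p ^ n) b c d p"
    and "suminf (vwp6 \<alpha> b c d p) =
      qpochs [\<alpha>, \<alpha> * p / (b * c), \<alpha> * p / (b * d), \<alpha> * p / (c * d)] p n /
      qpochs [\<alpha> * p / b, \<alpha> * p / c, \<alpha> * p / d, \<alpha> * p / (b * c * d)] p n *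
      suminf (vwp6 (\<alpha> * p ^ n) b c d p)"
proof (induction n)
  case 0
  case 1 show ?case using assms by simp
  case 2 show ?case by simp
next
  case (Suc n)
  interpret vwp6_params "\<alpha> * p ^ n" b c d p by (rule Suc)
  case 1 show ?case using shifted by (simp add: mult_ac)
  case 2
  have e: "\<alpha> * p ^ n * p / w = \<alpha> * p / w * p ^ n" for w by simp
  show ?case
    unfolding Suc(2) vwp6_shift shift_factor_def z_def e
    by (simp add: qpoch_Suc mult_ac)
qed

text \<open>Rogers' nonterminating sum, normalised without the factor \<open>1 / (1 - \<alpha>)\<close>.\<close>

theorem sum_6phi5:
  assumes "vwp6_params \<alpha> b c d p"
  shows "vwp6 \<alpha> b c d p sums
    (qpochs_inf [\<alpha>, \<alpha> * p / (b * c), \<alpha> * p / (b * d), \<alpha> * p / (c * d)] p /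
     qpochs_inf [\<alpha> * p / b, \<alpha> * p / c, \<alpha> * p / d, \<alpha> * p / (b * c * d)] p)"
proof -
  interpret vwp6_params \<alpha> b c d p by (rule assms)
  define g where "g v = phi [v, b, c, d] [v * p / b, v * p / c, v * p / d] p (v * p / (b * c * d))
      - v * phi [v, b, c, d] [v * p / b, v * p / c, v * p / d] p (p^2 * (v * p / (b * c * d)))" for v
  have one: "qpoch_inf 0 p = 1" by (simp add: qpoch_inf_def)
  have "isCont g 0"
    unfolding g_def
    using isCont_phi[of p "[\<lambda>v. v, \<lambda>_. b, \<lambda>_. c, \<lambda>_. d]" 0 "[\<lambda>v. v * p / b, \<lambda>v. v * p / c, \<lambda>v. v * p / d]" "\<lambda>v. v * p / (b * c * d)"]
      isCont_phi[of p "[\<lambda>v. v, \<lambda>_. b, \<lambda>_. c, \<lambda>_. d]" 0 "[\<lambda>v. v * p / b, \<lambda>v. v * p / c, \<lambda>v. v * p / d]" "\<lambda>v. p^2 * (v * p / (b * c * d))"]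
      p nz one
    by (auto intro!: continuous_intros)
  moreover have "phi as bs p 0 = 1" for as bs
  proof -
    have "phi as bs p 0 = (\<Sum>k\<in>{0}. qpochs as p k / qpochs (p # bs) p k * 0 ^ k)"
      unfolding phi_def by (rule suminf_finite) auto
    moreover have "qpochs As p 0 = 1" for As by (induction As) auto
    ultimately show ?thesis by simp
  qed
  hence "g 0 = 1" by (simp add: g_def)
  moreover have "(\<lambda>n. \<alpha> * p ^ n) \<longlonglongrightarrow> \<alpha> * 0"
    by (intro tendsto_intros LIMSEQ_power_zero p)
  ultimately have g1: "(\<lambda>n. g (\<alpha> * p ^ n)) \<longlonglongrightarrow> 1"
    using isCont_tendsto_compose[of 0 g "\<lambda>n. \<alpha> * p ^ n" sequentially] by simp
  have "(\<lambda>n. \<alpha> * p ^ n * p / (b * c * d)) \<longlonglongrightarrow> \<alpha> * 0 * p / (b * c * d)"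
    by (intro tendsto_intros LIMSEQ_power_zero p) (use nz in auto)
  hence "eventually (\<lambda>n. norm (\<alpha> * p ^ n * p / (b * c * d)) < 1) sequentially"
    using tendsto_norm[THEN order_tendstoD(2), of _ 0 sequentially 1] by simp
  hence "eventually (\<lambda>n. g (\<alpha> * p ^ n) = suminf (vwp6 (\<alpha> * p ^ n) b c d p)) sequentially"
  proof eventually_elim
    case (elim n)
    interpret n: vwp6_params "\<alpha> * p ^ n" b c d p by (rule vwp6_iterate(1)[OF assms])
    show ?case using elim n.vwp6_suminf_eq_phi by (simp add: g_def n.z_def)
  qed
  with g1 have S1: "(\<lambda>n. suminf (vwp6 (\<alpha> * p ^ n) b c d p)) \<longlonglongrightarrow> 1"
    by (rule Lim_transform_eventually)
  have L: "(\<lambda>n. qpochs As p n) \<longlonglongrightarrow> qpochs_inf As p" for As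
    by (induction As) (auto simp: qpochs_inf_def intro!: tendsto_intros qpoch_LIMSEQ p)
  have "(\<lambda>n. qpochs [\<alpha>, \<alpha> * p / (b * c), \<alpha> * p / (b * d), \<alpha> * p / (c * d)] p n /
      qpochs [\<alpha> * p / b, \<alpha> * p / c, \<alpha> * p / d, \<alpha> * p / (b * c * d)] p n *
      suminf (vwp6 (\<alpha> * p ^ n) b c d p)) \<longlonglongrightarrow>
      qpochs_inf [\<alpha>, \<alpha> * p / (b * c), \<alpha> * p / (b * d), \<alpha> * p / (c * d)] p /
      qpochs_inf [\<alpha> * p / b, \<alpha> * p / c, \<alpha> * p / d, \<alpha> * p / (b * c * d)] p * 1"
    by (intro tendsto_mult tendsto_divide L S1) (use den in \<open>auto simp: qpochs_inf_def\<close>)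
  hence "suminf (vwp6 \<alpha> b c d p) = qpochs_inf [\<alpha>, \<alpha> * p / (b * c), \<alpha> * p / (b * d), \<alpha> * p / (c * d)] p /
      qpochs_inf [\<alpha> * p / b, \<alpha> * p / c, \<alpha> * p / d, \<alpha> * p / (b * c * d)] p"
    unfolding vwp6_iterate(2)[OF assms, symmetric] using LIMSEQ_unique[OF tendsto_const] by fastforce
  thus ?thesis using summable_vwp6 by (metis summable_sums)
qed

section \<open>Summing over the outer poles\<close>

lemma qpoch_inf_times_power_LIMSEQ:
  assumes "norm q < 1"
  shows "(\<lambda>k. qpoch_inf (a * q ^ k) q) \<longlonglongrightarrow> 1"
proof -
  have "isCont (\<lambda>v. qpoch_inf v q) 0" by (intro isCont_qpoch_inf assms) simp
  moreover have "(\<lambda>k. a * q ^ k) \<longlonglongrightarrow> a * 0" by (intro tendsto_intros LIMSEQ_power_zero assms)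
  ultimately have "(\<lambda>k. qpoch_inf (a * q ^ k) q) \<longlonglongrightarrow> qpoch_inf 0 q"
    using isCont_tendsto_compose[of 0 "\<lambda>v. qpoch_inf v q" "\<lambda>k. a * q ^ k" sequentially] by simp
  thus ?thesis by (simp add: qpoch_inf_def)
qed

lemma summable_superexponential:
  assumes "norm (q :: complex) < 1" "C \<ge> 0"
  shows "summable (\<lambda>n. \<Prod>j<n. C * norm q ^ j)"
proof -
  have "(\<lambda>n. C * norm q ^ n) \<longlonglongrightarrow> C * 0"
    using assms by (intro tendsto_intros LIMSEQ_power_zero) auto
  hence "eventually (\<lambda>n. C * norm q ^ n < 1 / 2) sequentially"
    by (rule order_tendstoD) simp
  then obtain N where N: "\<And>n. n \<ge> N \<Longrightarrow> C * norm q ^ n < 1 / 2"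
    by (auto simp: eventually_sequentially)
  show ?thesis
  proof (rule summable_ratio_test[of "1 / 2" N])
    fix n assume "n \<ge> N"
    have "(\<Prod>j<n. C * norm q ^ j) * (C * norm q ^ n) \<le> (\<Prod>j<n. C * norm q ^ j) * (1 / 2)"
      using N[OF \<open>n \<ge> N\<close>] assms by (intro mult_left_mono prod_nonneg) auto
    thus "norm (\<Prod>j<Suc n. C * norm q ^ j) \<le> 1 / 2 * norm (\<Prod>j<n. C * norm q ^ j)"
      using assms by (simp add: abs_mult prod_nonneg mult.commute abs_of_nonneg)
  qed simp
qed

lemma suminf_swap_dominated:
  fixes f :: "nat \<Rightarrow> nat \<Rightarrow> complex"
  assumes bound: "\<And>n k. norm (f n k) \<le> M n * w k" and M: "summable M" and w: "summable w"
  shows "(\<Sum>n. \<Sum>k. f n k) = (\<Sum>k. \<Sum>n. f n k)" "summable (\<lambda>n. \<Sum>k. f n k)"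
proof -
  have sk: "summable (\<lambda>k. f n k)" for n
    by (rule summable_comparison_test'[OF summable_mult[OF w, of "M n"], of 0]) (rule bound)
  have sn: "summable (\<lambda>n. norm (f n k))" for k
    by (rule summable_comparison_test'[OF summable_mult2[OF M, of "w k"], of 0]) (simp add: bound)
  have lim: "(\<lambda>N. \<Sum>n<N. f n k) \<longlonglongrightarrow> (\<Sum>n. f n k)" for k
    by (rule summable_LIMSEQ[OF summable_norm_cancel[OF sn]])
  have Mw: "M n * w k \<ge> 0" for n k using bound[of n k] norm_ge_zero order_trans by blast
  have b2: "norm (\<Sum>n<N. f n k) \<le> suminf M * w k" for N k
  proof -
    have "norm (\<Sum>n<N. f n k) \<le> (\<Sum>n<N. M n * w k)"
      by (rule order_trans[OF norm_sum sum_mono[OF bound]])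
    also have "\<dots> \<le> (\<Sum>n. M n * w k)"
      using Mw by (intro sum_le_suminf summable_mult2 M) auto
    also have "\<dots> = suminf M * w k" by (rule suminf_mult2[OF M, symmetric])
    finally show ?thesis .
  qed
  have "(\<lambda>N. \<Sum>k. \<Sum>n<N. f n k) \<longlonglongrightarrow> (\<Sum>k. \<Sum>n. f n k)"
    using tannerys_theorem[of "\<lambda>k N. \<Sum>n<N. f n k" "\<lambda>k. \<Sum>n. f n k" sequentially "\<lambda>k. suminf M * w k",
        OF lim always_eventually summable_mult[OF w]] b2 by auto
  moreover have "(\<Sum>k. \<Sum>n<N. f n k) = (\<Sum>n<N. \<Sum>k. f n k)" for N
    by (rule suminf_sum) (rule sk)
  ultimately have "(\<lambda>n. \<Sum>k. f n k) sums (\<Sum>k. \<Sum>n. f n k)" by (simp add: sums_def)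
  thus "(\<Sum>n. \<Sum>k. f n k) = (\<Sum>k. \<Sum>n. f n k)" "summable (\<lambda>n. \<Sum>k. f n k)"
    by (auto simp: sums_iff)
qed

lemma norm_suminf_le_suminf:
  fixes f :: "nat \<Rightarrow> complex"
  assumes "\<And>k. norm (f k) \<le> g k" "summable g"
  shows "norm (suminf f) \<le> suminf g"
proof -
  have s: "summable (\<lambda>k. norm (f k))"
    by (rule summable_comparison_test'[OF assms(2), of 0]) (simp add: assms(1))
  show ?thesis
    using summable_norm[OF s] suminf_le[OF assms(1) s assms(2)] by linarith
qed

text \<open>The outer poles are \<open>t = X q^(-k)\<close> and \<open>t = q^(-k)\<close>; the variable \<open>w = 1/t\<close> takes the values \<open>q^k / X\<close> and
  \<open>q^k\<close> there.  Here \<open>\<alpha>\<close> stands for \<open>a^2\<close>.\<close>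

locale outer_poles =
  fixes q X x y z \<alpha> :: complex
  assumes q0: "q \<noteq> 0" and q1: "norm q < 1"
    and nz: "x \<noteq> 0" "y \<noteq> 0" "z \<noteq> 0" "\<alpha> \<noteq> 0"
    and X: "X = x * y * z / (q * \<alpha>)"
    and X_gen: "qpoch_inf X q \<noteq> 0" "qpoch_inf (1 / X) q \<noteq> 0"
    and xyz_gen: "qpoch_inf x q \<noteq> 0" "qpoch_inf y q \<noteq> 0" "qpoch_inf z q \<noteq> 0"
    and xyzX_gen: "qpoch_inf (x / X) q \<noteq> 0" "qpoch_inf (y / X) q \<noteq> 0" "qpoch_inf (z / X) q \<noteq> 0"
    and alpha_gen: "qpoch_inf (q * \<alpha>) q \<noteq> 0" "qpoch_inf (q * \<alpha> / x) q \<noteq> 0"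
      "qpoch_inf (q * \<alpha> / y) q \<noteq> 0" "qpoch_inf (q * \<alpha> / z) q \<noteq> 0"
begin

lemma X0: "X \<noteq> 0" using X nz q0 by simp

text \<open>At the outer poles the theta functions and the factors \<open>(t)\<close>, \<open>(t/X)\<close> of \<open>G\<close> together leave the weight \<open>wt\<close>, up to
  factors that do not depend on \<open>k\<close>.\<close>

definition wt :: "complex \<Rightarrow> nat \<Rightarrow> complex" where
  "wt r k = q ^ k / (qpoch q q k * qpoch (q * r) q k)"

definition Lam :: "(complex \<Rightarrow> complex) \<Rightarrow> complex" where
  "Lam f = (\<Sum>k. wt (1 / X) k * f (1 / X * q ^ k)) / qpoch_inf X q
         + (\<Sum>k. wt X k * f (1 * q ^ k)) / qpoch_inf (1 / X) q"

text \<open>In terms of \<open>t = 1/w\<close>, the function \<open>pn n\<close> is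
  \<open>(X/t)^n (t; q)_n (q^(n+1) \<alpha> / t) / (x/t, y/t, z/t)\<close>.\<close>

definition den :: "complex \<Rightarrow> complex" where
  "den w = qpoch_inf (x * w) q * qpoch_inf (y * w) q * qpoch_inf (z * w) q"

definition pn :: "nat \<Rightarrow> complex \<Rightarrow> complex" where
  "pn n w = X ^ n * (\<Prod>j<n. w - q ^ j) * qpoch_inf (q * \<alpha> * q ^ n * w) q / den w"

lemma shift_nonzero: "qpoch_inf r q \<noteq> 0 \<Longrightarrow> qpoch_inf (q * r) q \<noteq> 0"
  by (metis mult.commute mult_zero_right power_one_right qpoch_inf_split[OF q1, of r 1])

lemma wt_bound:
  assumes "qpoch_inf (q * r) q \<noteq> 0"
  obtains C where "\<And>k. norm (wt r k) \<le> C * norm q ^ k" "C \<ge> 0"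
proof -
  have "bdd2 (\<lambda>k N. inverse (qpoch q q k) * inverse (qpoch (q * r) q k))"
    by (intro bdd2_mult bdd2_inverse_qpoch_base q1 qpoch_inf_base_nonzero assms)
  then obtain C where C: "\<And>k. norm (inverse (qpoch q q k) * inverse (qpoch (q * r) q k)) \<le> C"
    unfolding bdd2_def by blast
  have "norm (wt r k) = norm (inverse (qpoch q q k) * inverse (qpoch (q * r) q k)) * norm q ^ k" for k
    by (simp add: wt_def divide_inverse norm_mult norm_power)
  hence "norm (wt r k) \<le> C * norm q ^ k" for k
    using C[of k] by (simp add: mult_right_mono)
  moreover have "C \<ge> 0" using C norm_ge_zero order_trans by blast
  ultimately show ?thesis using that by blast
qed

lemma summable_wt:
  assumes "qpoch_inf (q * r) q \<noteq> 0" "Bseq f"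
  shows "summable (\<lambda>k. wt r k * f k)"
proof -
  obtain C where C: "\<And>k. norm (wt r k) \<le> C * norm q ^ k" "C \<ge> 0" using wt_bound[OF assms(1)] by blast
  obtain K where K: "\<And>k. norm (f k) \<le> K" using assms(2) unfolding Bseq_def by blast
  show ?thesis
  proof (rule summable_comparison_test'[of "\<lambda>k. C * norm q ^ k * K" 0])
    show "summable (\<lambda>k. C * norm q ^ k * K)"
      using q1 by (intro summable_mult2 summable_mult summable_geometric) simp
    show "norm (wt r k * f k) \<le> C * norm q ^ k * K" for k
      unfolding norm_mult using C K by (intro mult_mono) auto
  qed
qed

lemma q_LIMSEQ: "(\<lambda>k. q ^ k) \<longlonglongrightarrow> 0"
  by (intro LIMSEQ_power_zero q1)

lemma times_q_LIMSEQ: "(\<lambda>k. c * q ^ k) \<longlonglongrightarrow> 0"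
  using tendsto_mult[OF tendsto_const[of c] q_LIMSEQ] by simp

lemma qpoch_inf_c_LIMSEQ: "(\<lambda>k. qpoch_inf (a * (c * q ^ k)) q) \<longlonglongrightarrow> 1"
  using qpoch_inf_times_power_LIMSEQ[OF q1, of "a * c"] by (simp add: mult.assoc)

lemma den_LIMSEQ: "(\<lambda>k. den (c * q ^ k)) \<longlonglongrightarrow> 1"
  using tendsto_mult[OF tendsto_mult[OF qpoch_inf_c_LIMSEQ[of x c] qpoch_inf_c_LIMSEQ[of y c]] qpoch_inf_c_LIMSEQ[of z c]]
  by (simp add: den_def)

text \<open>Half of the \<open>q\<close>-difference rule; the boundary term at the accumulation point survives when
  \<open>g k\<close> grows like \<open>q^(-k)\<close>.\<close>

lemma half_difference:
  assumes r: "qpoch_inf (q * r) q \<noteq> 0" and g: "(\<lambda>k. q ^ k * g k) \<longlonglongrightarrow> l"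
    and s: "summable (\<lambda>k. wt r k * ((1 - q ^ k) * (1 - r * q ^ k) * g k - q * g (Suc k)))"
  shows "(\<Sum>k. wt r k * ((1 - q ^ k) * (1 - r * q ^ k) * g k - q * g (Suc k)))
    = - l / (qpoch_inf q q * qpoch_inf (q * r) q)"
proof -
  define u where "u k = wt r k * ((1 - q ^ k) * (1 - r * q ^ k) * g k)" for k
  have nzk: "qpoch q q k \<noteq> 0" "qpoch (q * r) q k \<noteq> 0" for k
    using qpoch_nonzero[OF q1 qpoch_inf_base_nonzero[OF q1]] qpoch_nonzero[OF q1 r] by blast+
  have step: "u (Suc k) = wt r k * (q * g (Suc k))" for k
  proof -
    have f: "1 - q ^ Suc k \<noteq> 0" "1 - r * q ^ Suc k \<noteq> 0"
      using nzk[of "Suc k"] by (auto simp: qpoch_Suc mult_ac)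
    have "u (Suc k) = q * q ^ k * g (Suc k) * ((1 - q ^ Suc k) * (1 - r * q ^ Suc k)) /
        (qpoch q q k * qpoch (q * r) q k * ((1 - q ^ Suc k) * (1 - r * q ^ Suc k)))"
      by (simp add: u_def wt_def qpoch_Suc mult_ac)
    also have "\<dots> = q * q ^ k * g (Suc k) / (qpoch q q k * qpoch (q * r) q k)"
      by (rule mult_divide_mult_cancel_right) (use f in simp)
    finally show ?thesis by (simp add: wt_def mult_ac)
  qed
  have "(\<Sum>k<K. wt r k * ((1 - q ^ k) * (1 - r * q ^ k) * g k - q * g (Suc k))) = - u K" for K
  proof -
    have "(\<Sum>k<K. wt r k * ((1 - q ^ k) * (1 - r * q ^ k) * g k - q * g (Suc k))) = (\<Sum>k<K. u k - u (Suc k))"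
      unfolding step by (simp add: u_def right_diff_distrib)
    also have "\<dots> = u 0 - u K" by (rule sum_lessThan_telescope')
    finally show ?thesis by (simp add: u_def)
  qed
  hence L1: "(\<lambda>K. - u K) \<longlonglongrightarrow> (\<Sum>k. wt r k * ((1 - q ^ k) * (1 - r * q ^ k) * g k - q * g (Suc k)))"
    using summable_LIMSEQ[OF s] by simp
  have "(\<lambda>k. - ((1 - q ^ k) * (1 - r * q ^ k) * (q ^ k * g k) / (qpoch q q k * qpoch (q * r) q k)))
      \<longlonglongrightarrow> - ((1 - 0) * (1 - r * 0) * l / (qpoch_inf q q * qpoch_inf (q * r) q))"
    by (intro tendsto_intros q_LIMSEQ g qpoch_LIMSEQ q1) (use r qpoch_inf_base_nonzero[OF q1] in auto)
  also have "(\<lambda>k. - ((1 - q ^ k) * (1 - r * q ^ k) * (q ^ k * g k) / (qpoch q q k * qpoch (q * r) q k))) = (\<lambda>K. - u K)"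
    by (simp add: u_def wt_def mult_ac)
  finally show ?thesis using LIMSEQ_unique[OF L1] by simp
qed

text \<open>The weights satisfy \<open>(1 - w) (1 - X w) wt k = q wt (k - 1)\<close> at both kinds of poles, so sums of differences
  telescope.  The boundary terms at the accumulation point \<open>w = 0\<close> need not vanish, but those of the
  two halves cancel, because \<open>X / (1 - X) + 1 / (1 - 1/X) = 0\<close>.\<close>

lemma Lam_difference:
  assumes g: "\<And>c. c \<in> {1, 1 / X} \<Longrightarrow> (\<lambda>k. q ^ k * g (c * q ^ k)) \<longlonglongrightarrow> l / c"
    and h: "\<And>k c. c \<in> {1, 1 / X} \<Longrightarrow> h (c * q ^ k) = (1 - c * q ^ k) * (1 - X * (c * q ^ k)) * g (c * q ^ k) - q * g (q * (c * q ^ k))"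
    and hb: "\<And>c. c \<in> {1, 1 / X} \<Longrightarrow> Bseq (\<lambda>k. h (c * q ^ k))"
  shows "Lam h = 0"
proof -
  have gX: "qpoch_inf (q * X) q \<noteq> 0" "qpoch_inf (q * (1 / X)) q \<noteq> 0"
    using shift_nonzero X_gen by blast+
  have hX: "h (1 / X * q ^ k) = (1 - q ^ k) * (1 - 1 / X * q ^ k) * g (1 / X * q ^ k) - q * g (1 / X * q ^ Suc k)" for k
    using h[of "1 / X" k] X0 by (simp add: mult_ac)
  have h1: "h (1 * q ^ k) = (1 - q ^ k) * (1 - X * q ^ k) * g (1 * q ^ k) - q * g (1 * q ^ Suc k)" for k
    using h[of 1 k] by simp
  have s1: "(\<Sum>k. wt (1 / X) k * h (1 / X * q ^ k)) = - (l * X) / (qpoch_inf q q * qpoch_inf (q * (1 / X)) q)"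
    using half_difference[OF gX(2), of "\<lambda>k. g (1 / X * q ^ k)" "l * X"] g[of "1 / X"]
      summable_wt[OF gX(2) hb[of "1 / X"]]
    unfolding hX by simp
  have s2: "(\<Sum>k. wt X k * h (1 * q ^ k)) = - l / (qpoch_inf q q * qpoch_inf (q * X) q)"
    using half_difference[OF gX(1), of "\<lambda>k. g (1 * q ^ k)" l] g[of 1]
      summable_wt[OF gX(1) hb[of 1]]
    unfolding h1 by simp
  have e: "qpoch_inf X q = (1 - X) * qpoch_inf (q * X) q" "qpoch_inf (1 / X) q = (1 - 1 / X) * qpoch_inf (q * (1 / X)) q"
    using qpoch_inf_split[OF q1, of X 1] qpoch_inf_split[OF q1, of "1 / X" 1] by (simp_all add: qpoch_Suc mult.commute)
  have n: "1 - X \<noteq> 0" "X - 1 \<noteq> 0" using X_gen e by auto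
  have "Lam h = - (l * X) / (qpoch_inf q q * qpoch_inf (q * (1 / X)) q) / ((1 - X) * qpoch_inf (q * X) q)
      + - l / (qpoch_inf q q * qpoch_inf (q * X) q) / ((1 - 1 / X) * qpoch_inf (q * (1 / X)) q)"
    unfolding Lam_def s1 s2 by (simp only: e)
  also have "\<dots> = - l / (qpoch_inf q q * qpoch_inf (q * (1 / X)) q * qpoch_inf (q * X) q) * (X / (1 - X) + 1 / (1 - 1 / X))"
  proof -
    have "- (l * X) / (Q * P) / ((1 - X) * R) + - l / (Q * R) / ((1 - 1 / X) * P)
        = - l / (Q * P * R) * (X / (1 - X) + 1 / (1 - 1 / X))" for P Q R
      by (simp add: divide_inverse distrib_left mult_ac)
    thus ?thesis .
  qed
  also have "X / (1 - X) + 1 / (1 - 1 / X) = 0"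
  proof -
    have "1 - 1 / X = (X - 1) / X" using X0 by (simp add: field_simps)
    moreover have "X / (X - 1) = - (X / (1 - X))" by (simp add: minus_divide_right)
    ultimately show ?thesis using n by simp
  qed
  finally show ?thesis by simp
qed

lemma Lam_add_scale:
  assumes f: "\<And>c. c \<in> {1, 1 / X} \<Longrightarrow> Bseq (\<lambda>k. f (c * q ^ k))"
    and g: "\<And>c. c \<in> {1, 1 / X} \<Longrightarrow> Bseq (\<lambda>k. g (c * q ^ k))"
  shows "Lam (\<lambda>w. u * f w + v * g w) = u * Lam f + v * Lam g"
proof -
  have half: "(\<Sum>k. wt r k * (u * f (c * q ^ k) + v * g (c * q ^ k)))
      = u * (\<Sum>k. wt r k * f (c * q ^ k)) + v * (\<Sum>k. wt r k * g (c * q ^ k))"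
    if "qpoch_inf (q * r) q \<noteq> 0" "c \<in> {1, 1 / X}" for r c
  proof -
    have "(\<lambda>k. wt r k * (u * f (c * q ^ k) + v * g (c * q ^ k)))
        = (\<lambda>k. u * (wt r k * f (c * q ^ k)) + v * (wt r k * g (c * q ^ k)))"
      by (simp add: algebra_simps)
    thus ?thesis
      using summable_wt[OF that(1) f[OF that(2)]] summable_wt[OF that(1) g[OF that(2)]]
      by (simp add: suminf_add[symmetric] suminf_mult summable_mult)
  qed
  have gX: "qpoch_inf (q * X) q \<noteq> 0" "qpoch_inf (q * (1 / X)) q \<noteq> 0"
    using shift_nonzero X_gen by blast+
  show ?thesis
    unfolding Lam_def half[OF gX(1), of 1, simplified] using half[OF gX(1), of 1] half[OF gX(2), of "1 / X"]
    by (simp add: add_divide_distrib algebra_simps)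
qed

lemma pn_LIMSEQ: "(\<lambda>k. pn n (c * q ^ k)) \<longlonglongrightarrow> X ^ n * (\<Prod>j<n. 0 - q ^ j)"
proof -
  have "(\<lambda>k. pn n (c * q ^ k)) \<longlonglongrightarrow> X ^ n * (\<Prod>j<n. 0 - q ^ j) * 1 / 1"
    unfolding pn_def by (intro tendsto_intros times_q_LIMSEQ qpoch_inf_c_LIMSEQ den_LIMSEQ) auto
  thus ?thesis by simp
qed

lemma pn_Bseq: "Bseq (\<lambda>k. pn n (c * q ^ k))"
  by (rule convergent_imp_Bseq, rule convergentI, rule pn_LIMSEQ)

text \<open>Dividing by \<open>w\<close> gives an affine function of \<open>w\<close>, because the constant coefficient on the left vanishes and so does the
  cubic one, by the relation between \<open>A\<close>, \<open>X\<close> and \<open>Q\<close>.  Its expansion in \<open>1 - A w\<close> and \<open>w - Q\<close> is found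
  by evaluating at \<open>w = Q\<close> and \<open>w = 1/A\<close>.\<close>

lemma contiguous_polynomial:
  fixes A Q w :: complex
  assumes AX: "A * X = Q * (x * y * z)" "A \<noteq> 0"
  shows "(1 - A * Q) * (- (1 - X * w) * (w - Q) * (1 - A * w) - Q * ((1 - x * w) * (1 - y * w) * (1 - z * w)))
    = w * (- ((1 - x * Q) * (1 - y * Q) * (1 - z * Q)) * (1 - A * w)
        + X * ((1 - A / x) * (1 - A / y) * (1 - A / z)) * (w - Q))"
proof -
  have "X * ((1 - A / x) * (1 - A / y) * (1 - A / z)) * A = Q * ((x - A) * (y - A) * (z - A))"
  proof -
    have "X * ((1 - A / x) * (1 - A / y) * (1 - A / z)) * A = (A * X) * ((1 - A / x) * (1 - A / y) * (1 - A / z))"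
      by simp
    also have "\<dots> = Q * ((x * (1 - A / x)) * (y * (1 - A / y)) * (z * (1 - A / z)))"
      unfolding AX by simp
    also have "\<dots> = Q * ((x - A) * (y - A) * (z - A))"
      using nz by (simp add: right_diff_distrib)
    finally show ?thesis .
  qed
  moreover define M where "M = X * ((1 - A / x) * (1 - A / y) * (1 - A / z))"
  ultimately have M: "M * A = Q * ((x - A) * (y - A) * (z - A))" by simp
  have "A * ((1 - A * Q) * (- (1 - X * w) * (w - Q) * (1 - A * w) - Q * ((1 - x * w) * (1 - y * w) * (1 - z * w))))
    = A * (w * (- ((1 - x * Q) * (1 - y * Q) * (1 - z * Q)) * (1 - A * w) + M * (w - Q)))"
    using AX(1) M by algebra
  thus ?thesis using AX(2) by (simp add: M_def)
qed

lemma qpoch_inf_head: "qpoch_inf u q = (1 - u) * qpoch_inf (u * q) q"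
  using qpoch_inf_split[OF q1, of u 1] by (simp add: qpoch_Suc)

lemma qpoch_inf_tail_nonzero: "qpoch_inf u q \<noteq> 0 \<Longrightarrow> qpoch_inf (u * q ^ k) q \<noteq> 0"
  by (metis mult_zero_right qpoch_inf_split[OF q1, of u k])

lemma den_nonzero:
  assumes "c \<in> {1, 1 / X}"
  shows "den (c * q ^ k) \<noteq> 0"
  using assms xyz_gen xyzX_gen qpoch_inf_tail_nonzero[of "x * c" k] qpoch_inf_tail_nonzero[of "y * c" k]
    qpoch_inf_tail_nonzero[of "z * c" k]
  by (auto simp: den_def mult.assoc)

text \<open>The function \<open>g\<close> is chosen such that the telescoping difference is a common factor \<open>b\<close> of \<open>pn n\<close> and
  \<open>pn (Suc n)\<close> times the affine function of \<open>contiguous_polynomial\<close>.\<close>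

lemma Lam_pn_Suc:
  "Lam (pn (Suc n)) = ((1 - x * q ^ n) * (1 - y * q ^ n) * (1 - z * q ^ n)) /
     ((1 - q * \<alpha> / x * q ^ n) * (1 - q * \<alpha> / y * q ^ n) * (1 - q * \<alpha> / z * q ^ n)) * Lam (pn n)"
proof -
  define Q where "Q = q ^ n"
  define A where "A = q * \<alpha> * Q"
  define N where "N = (1 - x * Q) * (1 - y * Q) * (1 - z * Q)"
  define D where "D = (1 - A / x) * (1 - A / y) * (1 - A / z)"
  have A0: "A \<noteq> 0" using q0 nz by (simp add: A_def Q_def)
  have AX: "A * X = Q * (x * y * z)" using q0 nz by (simp add: A_def X)
  have AQ: "1 - A * Q \<noteq> 0"
    using qpoch_inf_tail_nonzero[OF alpha_gen(1), of "n + n"] qpoch_inf_head[of "q * \<alpha> * q ^ (n + n)"]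
    by (auto simp: A_def Q_def power_add mult_ac)
  have D0: "D \<noteq> 0"
    using qpoch_inf_tail_nonzero[OF alpha_gen(2), of n] qpoch_inf_head[of "q * \<alpha> / x * q ^ n"]
      qpoch_inf_tail_nonzero[OF alpha_gen(3), of n] qpoch_inf_head[of "q * \<alpha> / y * q ^ n"]
      qpoch_inf_tail_nonzero[OF alpha_gen(4), of n] qpoch_inf_head[of "q * \<alpha> / z * q ^ n"]
    by (auto simp: D_def A_def Q_def mult_ac)
  define g where "g w = (\<Prod>j<n. w - q ^ Suc j) * qpoch_inf (A * w) q / den w / w" for w
  define l where "l = (\<Prod>j<n. 0 - q ^ Suc j)"
  have "Lam (\<lambda>w. - N / (1 - A * Q) / X ^ n * pn n w + D / (1 - A * Q) / X ^ n * pn (Suc n) w) = 0"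
  proof (rule Lam_difference[where g = g and l = l])
    fix c assume c: "c \<in> {1, 1 / X}"
    hence c0: "c \<noteq> 0" using X0 by auto
    have "(\<lambda>k. (\<Prod>j<n. c * q ^ k - q ^ Suc j) * qpoch_inf (A * (c * q ^ k)) q / den (c * q ^ k) / c)
        \<longlonglongrightarrow> l * 1 / 1 / c"
      unfolding l_def by (intro tendsto_intros times_q_LIMSEQ qpoch_inf_c_LIMSEQ den_LIMSEQ) (use c0 in auto)
    thus "(\<lambda>k. q ^ k * g (c * q ^ k)) \<longlonglongrightarrow> l / c"
      using q0 by (simp add: g_def)
    show "Bseq (\<lambda>k. - N / (1 - A * Q) / X ^ n * pn n (c * q ^ k) + D / (1 - A * Q) / X ^ n * pn (Suc n) (c * q ^ k))"
      by (rule convergent_imp_Bseq, rule convergentI,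
          rule tendsto_add[OF tendsto_mult[OF tendsto_const pn_LIMSEQ] tendsto_mult[OF tendsto_const pn_LIMSEQ]])
    fix k
    define w where "w = c * q ^ k"
    have w0: "w \<noteq> 0" using c0 q0 by (simp add: w_def)
    have dw: "den w \<noteq> 0" using den_nonzero[OF c] by (simp add: w_def)
    define b where "b = (\<Prod>j<n. w - q ^ j) * qpoch_inf (A * w * q) q / den w"
    have p0: "pn n w = X ^ n * b * (1 - A * w)"
      using qpoch_inf_head[of "A * w"] by (simp add: pn_def b_def A_def Q_def mult_ac)
    have p1: "pn (Suc n) w = X ^ n * b * (X * (w - Q))"
      by (simp add: pn_def b_def A_def Q_def mult_ac)
    have g1: "(1 - w) * g w = - (b / w * ((w - Q) * (1 - A * w)))"
    proof -
      have "(\<Prod>j<Suc n. w - q ^ j) = (w - 1) * (\<Prod>j<n. w - q ^ Suc j)"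
        by (subst prod.lessThan_Suc_shift) simp
      hence H: "(1 - w) * (\<Prod>j<n. w - q ^ Suc j) = - ((\<Prod>j<n. w - q ^ j) * (w - Q))"
        by (simp add: Q_def algebra_simps)
      have "(1 - w) * g w = ((1 - w) * (\<Prod>j<n. w - q ^ Suc j)) * qpoch_inf (A * w) q / den w / w"
        by (simp add: g_def mult_ac)
      thus ?thesis unfolding H using qpoch_inf_head[of "A * w"] by (simp add: b_def mult_ac)
    qed
    have g2: "q * g (q * w) = b / w * (Q * ((1 - x * w) * (1 - y * w) * (1 - z * w)))"
    proof -
      have "(\<Prod>j<n. q * w - q ^ Suc j) = (\<Prod>j<n. q * (w - q ^ j))" by (simp add: algebra_simps)
      hence e1: "(\<Prod>j<n. q * w - q ^ Suc j) = Q * (\<Prod>j<n. w - q ^ j)"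
        by (simp add: prod.distrib Q_def)
      have e2: "den w = (1 - x * w) * (1 - y * w) * (1 - z * w) * den (q * w)"
        using qpoch_inf_head[of "x * w"] qpoch_inf_head[of "y * w"] qpoch_inf_head[of "z * w"]
        by (simp add: den_def mult_ac)
      have "(1 - x * w) * (1 - y * w) * (1 - z * w) \<noteq> 0" using dw e2 by auto
      hence "1 / den (q * w) = (1 - x * w) * (1 - y * w) * (1 - z * w) / den w"
        unfolding e2 by simp
      moreover have "q * g (q * w) = Q * (\<Prod>j<n. w - q ^ j) * qpoch_inf (A * w * q) q * (1 / den (q * w)) / w"
        unfolding g_def e1 using q0 by (simp add: mult_ac)
      ultimately show ?thesis by (simp add: b_def mult_ac)
    qed
    have "(1 - w) * (1 - X * w) * g w - q * g (q * w)
        = b / w * (- (1 - X * w) * (w - Q) * (1 - A * w) - Q * ((1 - x * w) * (1 - y * w) * (1 - z * w)))"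
    proof -
      have e: "(1 - w) * (1 - X * w) * g w = (1 - X * w) * ((1 - w) * g w)" by simp
      have gen: "m * - (v * (u * t)) - v * r = v * (- m * u * t - r)" for m v u t r :: complex
        by (simp add: algebra_simps)
      show ?thesis unfolding e g1 g2 by (rule gen)
    qed
    also have "\<dots> = b / w * (((1 - A * Q) * (- (1 - X * w) * (w - Q) * (1 - A * w)
        - Q * ((1 - x * w) * (1 - y * w) * (1 - z * w)))) / (1 - A * Q))"
      using AQ by simp
    also have "\<dots> = b / w * (w * (- N * (1 - A * w) + X * D * (w - Q)) / (1 - A * Q))"
      unfolding contiguous_polynomial[OF AX A0] N_def D_def by simp
    also have "\<dots> = b * (- N * (1 - A * w) + X * D * (w - Q)) / (1 - A * Q)"
      using w0 by simp
    also have "\<dots> = - N / (1 - A * Q) / X ^ n * pn n w + D / (1 - A * Q) / X ^ n * pn (Suc n) w"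
    proof -
      have gen: "b * (- N * u + X * D * v) / R = - N / R / Y * (Y * b * u) + D / R / Y * (Y * b * (X * v))"
        if "Y \<noteq> 0" "R \<noteq> 0" for u v R Y
        using that by (simp add: field_simps)
      show ?thesis unfolding p0 p1 by (rule gen) (use X0 AQ in auto)
    qed
    finally show "- N / (1 - A * Q) / X ^ n * pn n (c * q ^ k) + D / (1 - A * Q) / X ^ n * pn (Suc n) (c * q ^ k)
       = (1 - c * q ^ k) * (1 - X * (c * q ^ k)) * g (c * q ^ k) - q * g (q * (c * q ^ k))"
      by (simp add: w_def)
  qed
  hence "- N / (1 - A * Q) / X ^ n * Lam (pn n) + D / (1 - A * Q) / X ^ n * Lam (pn (Suc n)) = 0"
    by (subst (asm) Lam_add_scale) (rule pn_Bseq)+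
  moreover have "- N / (1 - A * Q) / X ^ n * Lam (pn n) + D / (1 - A * Q) / X ^ n * Lam (pn (Suc n))
      = (D * Lam (pn (Suc n)) - N * Lam (pn n)) / ((1 - A * Q) * X ^ n)"
    by (simp add: diff_divide_distrib)
  ultimately have "D * Lam (pn (Suc n)) = N * Lam (pn n)"
    using AQ X0 by simp
  hence "Lam (pn (Suc n)) = N / D * Lam (pn n)" using D0 by (simp add: field_simps)
  thus ?thesis by (simp add: N_def D_def A_def Q_def mult_ac)
qed

text \<open>On the poles \<open>q^k\<close> the product \<open>\<Prod>j<n. q^k - q^j\<close> vanishes for \<open>k < n\<close>, and otherwise each factor is at most
  \<open>2 |q|^j\<close>.  So there the bound even tends to zero superexponentially in \<open>n\<close>.\<close>

lemma pn_uniform_bound: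
  obtains M where "\<And>n k. norm (pn n (1 / X * q ^ k)) \<le> M" "M \<ge> 0"
    "\<And>n k. norm (pn n (1 * q ^ k)) \<le> (\<Prod>j<n. (2 * norm X) * norm q ^ j) * M"
proof -
  have pq: "norm (q ^ k) \<le> 1" for k using q1 by (simp add: norm_power power_le_one)
  have "\<exists>M. \<forall>k. norm (1 / den (c * q ^ k)) \<le> M" for c
  proof -
    have "(\<lambda>k. 1 / den (c * q ^ k)) \<longlonglongrightarrow> 1 / 1" by (intro tendsto_intros den_LIMSEQ) simp
    hence "Bseq (\<lambda>k. 1 / den (c * q ^ k))" by (intro convergent_imp_Bseq convergentI)
    thus ?thesis unfolding Bseq_def by blast
  qed
  then obtain M1 where M1: "\<And>c k. norm (1 / den (c * q ^ k)) \<le> M1 c" by metis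
  have B: "norm (qpoch_inf (q * \<alpha> * q ^ n * (c * q ^ k)) q / den (c * q ^ k)) \<le> qbound (norm (q * \<alpha> * c)) q * M1 c" for n k c
  proof -
    have "norm (q * \<alpha> * q ^ n * (c * q ^ k)) = norm (q * \<alpha> * c) * norm (q ^ (n + k))"
      by (simp add: norm_mult norm_power power_add)
    also have "\<dots> \<le> norm (q * \<alpha> * c)" using pq by (intro mult_left_le) auto
    finally have "norm (qpoch_inf (q * \<alpha> * q ^ n * (c * q ^ k)) q) \<le> qbound (norm (q * \<alpha> * c)) q"
      by (rule norm_qpoch_inf_le[OF q1])
    hence "norm (qpoch_inf (q * \<alpha> * q ^ n * (c * q ^ k)) q * (1 / den (c * q ^ k))) \<le> qbound (norm (q * \<alpha> * c)) q * M1 c"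
      unfolding norm_mult using M1 less_imp_le[OF qbound_pos] by (intro mult_mono) auto
    thus ?thesis by simp
  qed
  define K where "K c = qbound (norm (q * \<alpha> * c)) q * M1 c" for c
  have K0: "K c \<ge> 0" for c
    using B[of 0 c 0] order_trans[OF norm_ge_zero] unfolding K_def by blast
  define M where "M = qbound (norm X) q * K (1 / X) + K 1"
  have b1: "norm (pn n (1 / X * q ^ k)) \<le> qbound (norm X) q * K (1 / X)" for n k
  proof -
    have "X ^ n * (\<Prod>j<n. 1 / X * q ^ k - q ^ j) = (\<Prod>j<n. q ^ k - X * q ^ j)"
    proof -
      have "(\<Prod>j<n. q ^ k - X * q ^ j) = (\<Prod>j<n. X * (1 / X * q ^ k - q ^ j))"
        using X0 by (simp add: right_diff_distrib)
      thus ?thesis by (simp add: prod.distrib)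
    qed
    moreover have "norm (\<Prod>j<n. q ^ k - X * q ^ j) \<le> (\<Prod>j<n. 1 + norm X * norm q ^ j)"
      unfolding prod_norm[symmetric]
    proof (intro prod_mono conjI norm_ge_zero)
      fix j show "norm (q ^ k - X * q ^ j) \<le> 1 + norm X * norm q ^ j"
        using norm_triangle_ineq4[of "q ^ k" "X * q ^ j"] pq[of k] by (simp add: norm_mult norm_power)
    qed
    ultimately have "norm (X ^ n * (\<Prod>j<n. 1 / X * q ^ k - q ^ j)) \<le> qbound (norm X) q"
      using prod_one_plus_le_qbound[OF q1, of "norm X" n] by simp
    hence "norm ((X ^ n * (\<Prod>j<n. 1 / X * q ^ k - q ^ j)) *
       (qpoch_inf (q * \<alpha> * q ^ n * (1 / X * q ^ k)) q / den (1 / X * q ^ k))) \<le> qbound (norm X) q * K (1 / X)"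
      unfolding norm_mult[of "X ^ n * _"] K_def
      by (rule mult_mono[OF _ B]) (simp_all add: less_imp_le)
    thus ?thesis by (simp add: pn_def)
  qed
  have b2: "norm (pn n (1 * q ^ k)) \<le> (\<Prod>j<n. (2 * norm X) * norm q ^ j) * K 1" for n k
  proof -
    have e: "norm (X ^ n * (\<Prod>j<n. 1 * q ^ k - q ^ j)) \<le> (\<Prod>j<n. (2 * norm X) * norm q ^ j)"
    proof (cases "k < n")
      case True
      hence "(\<Prod>j<n. 1 * q ^ k - q ^ j) = 0" by (intro prod_zero) auto
      hence "X ^ n * (\<Prod>j<n. 1 * q ^ k - q ^ j) = 0" by (simp only: mult_zero_right)
      moreover have "0 \<le> (\<Prod>j<n. (2 * norm X) * norm q ^ j)" by (intro prod_nonneg) simp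
      ultimately show ?thesis by (simp only: norm_zero)
    next
      case False
      have "X ^ n * (\<Prod>j<n. 1 * q ^ k - q ^ j) = (\<Prod>j<n. X * (q ^ k - q ^ j))"
        by (simp add: prod.distrib)
      moreover have "norm (\<Prod>j<n. X * (q ^ k - q ^ j)) \<le> (\<Prod>j<n. (2 * norm X) * norm q ^ j)"
        unfolding prod_norm[symmetric]
      proof (intro prod_mono conjI norm_ge_zero)
        fix j assume "j \<in> {..<n}"
        hence "j \<le> k" using False by auto
        hence "norm q ^ k \<le> norm q ^ j" using q1 by (intro power_decreasing) auto
        hence "norm (q ^ k - q ^ j) \<le> 2 * norm q ^ j"
          using norm_triangle_ineq4[of "q ^ k" "q ^ j"] by (simp add: norm_power)
        thus "norm (X * (q ^ k - q ^ j)) \<le> (2 * norm X) * norm q ^ j"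
          using mult_left_mono[of _ _ "norm X"] by (fastforce simp: norm_mult)
      qed
      ultimately show ?thesis by simp
    qed
    have "norm ((X ^ n * (\<Prod>j<n. 1 * q ^ k - q ^ j)) *
       (qpoch_inf (q * \<alpha> * q ^ n * (1 * q ^ k)) q / den (1 * q ^ k))) \<le> (\<Prod>j<n. (2 * norm X) * norm q ^ j) * K 1"
      unfolding norm_mult[of "X ^ n * _"] K_def by (rule mult_mono[OF e B]) (simp_all add: prod_nonneg)
    thus ?thesis by (simp add: pn_def)
  qed
  show ?thesis
  proof (rule that[of M])
    show "M \<ge> 0" using K0 less_imp_le[OF qbound_pos] by (simp add: M_def)
    show "norm (pn n (1 / X * q ^ k)) \<le> M" for n k using b1[of n k] K0[of 1] by (simp add: M_def)
    have "K 1 \<le> M" using K0[of "1 / X"] less_imp_le[OF qbound_pos] by (simp add: M_def)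
    thus "norm (pn n (1 * q ^ k)) \<le> (\<Prod>j<n. (2 * norm X) * norm q ^ j) * M" for n k
      by (intro order_trans[OF b2] mult_left_mono prod_nonneg) auto
  qed
qed

lemma summable_wt_norm:
  assumes "qpoch_inf (q * r) q \<noteq> 0"
  shows "summable (\<lambda>k. norm (wt r k))"
proof -
  obtain C where C: "\<And>k. norm (wt r k) \<le> C * norm q ^ k" using wt_bound[OF assms] by blast
  show ?thesis
    by (rule summable_comparison_test'[of "\<lambda>k. C * norm q ^ k" 0])
       (use C q1 in \<open>auto intro!: summable_mult summable_geometric\<close>)
qed

lemma qX_nonzero: "qpoch_inf (q * X) q \<noteq> 0" "qpoch_inf (q * (1 / X)) q \<noteq> 0"
  using shift_nonzero X_gen by blast+

text \<open>As \<open>n\<close> grows only the pole \<open>t = X\<close> continues to contribute.\<close>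

lemma Lam_pn_LIMSEQ: "(\<lambda>n. Lam (pn n)) \<longlonglongrightarrow> 1 / den (1 / X)"
proof -
  obtain M where M: "\<And>n k. norm (pn n (1 / X * q ^ k)) \<le> M" "M \<ge> 0"
    "\<And>n k. norm (pn n (1 * q ^ k)) \<le> (\<Prod>j<n. (2 * norm X) * norm q ^ j) * M"
    using pn_uniform_bound by blast
  define e where "e n = (\<Prod>j<n. (2 * norm X) * norm q ^ j)" for n
  have e0: "e \<longlonglongrightarrow> 0"
    using summable_LIMSEQ_zero[OF summable_superexponential[OF q1, of "2 * norm X"]] by (simp add: e_def[abs_def])
  define v where "v k = (if k = 0 then qpoch_inf X q / den (1 / X) else 0)" for k :: nat
  have lim: "(\<lambda>n. wt (1 / X) k * pn n (1 / X * q ^ k)) \<longlonglongrightarrow> v k" for k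
  proof -
    have dz: "den (1 / X * q ^ k) \<noteq> 0" by (rule den_nonzero) simp
    have pn_eq: "pn n (1 / X * q ^ k) = (q ^ k) ^ n * qpoch (X / q ^ k) q n *
       qpoch_inf (q * \<alpha> * (1 / X * q ^ k) * q ^ n) q / den (1 / X * q ^ k)" for n
    proof -
      have "X ^ n * (\<Prod>j<n. 1 / X * q ^ k - q ^ j) = (\<Prod>j<n. X * (1 / X * q ^ k - q ^ j))"
        by (simp add: prod.distrib)
      also have "\<dots> = (\<Prod>j<n. q ^ k * (1 - X / q ^ k * q ^ j))"
        using X0 q0 by (intro prod.cong refl) (simp add: right_diff_distrib)
      also have "\<dots> = (q ^ k) ^ n * qpoch (X / q ^ k) q n"
        by (simp add: prod.distrib qpoch_def)
      finally show ?thesis unfolding pn_def by (simp add: mult_ac)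
    qed
    show ?thesis
    proof (cases "k = 0")
      case True
      have "(\<lambda>n. 1 ^ n * qpoch X q n * qpoch_inf (q * \<alpha> * (1 / X) * q ^ n) q / den (1 / X))
          \<longlonglongrightarrow> 1 * qpoch_inf X q * 1 / den (1 / X)"
        unfolding power_one by (intro tendsto_intros qpoch_LIMSEQ qpoch_inf_times_power_LIMSEQ q1) (use dz True in auto)
      thus ?thesis using pn_eq True by (simp add: v_def wt_def)
    next
      case False
      have "(\<lambda>n. wt (1 / X) k * ((q ^ k) ^ n * qpoch (X / q ^ k) q n * qpoch_inf (q * \<alpha> * (1 / X * q ^ k) * q ^ n) q / den (1 / X * q ^ k)))
          \<longlonglongrightarrow> wt (1 / X) k * (0 * qpoch_inf (X / q ^ k) q * 1 / den (1 / X * q ^ k))"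
        using False q1 dz
        by (intro tendsto_intros qpoch_LIMSEQ qpoch_inf_times_power_LIMSEQ LIMSEQ_power_zero)
           (auto simp: norm_power power_less_one_iff)
      thus ?thesis using pn_eq False by (simp add: v_def)
    qed
  qed
  have A: "(\<lambda>n. \<Sum>k. wt (1 / X) k * pn n (1 / X * q ^ k)) \<longlonglongrightarrow> suminf v"
    using tannerys_theorem[of "\<lambda>k n. wt (1 / X) k * pn n (1 / X * q ^ k)" v sequentially "\<lambda>k. norm (wt (1 / X) k) * M",
        OF lim always_eventually summable_mult2[OF summable_wt_norm[OF qX_nonzero(2)]]] M(1)
    by (auto simp: norm_mult mult_left_mono)
  have v: "suminf v = qpoch_inf X q / den (1 / X)"
    by (subst suminf_finite[of "{0}"]) (auto simp: v_def)
  have B: "(\<lambda>n. \<Sum>k. wt X k * pn n (1 * q ^ k)) \<longlonglongrightarrow> 0"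
  proof (rule Lim_null_comparison)
    show "\<forall>\<^sub>F n in sequentially. norm (\<Sum>k. wt X k * pn n (1 * q ^ k)) \<le> (\<Sum>k. norm (wt X k)) * (e n * M)"
    proof (intro always_eventually allI)
      fix n
      have b: "norm (wt X k * pn n (1 * q ^ k)) \<le> norm (wt X k) * (e n * M)" for k
        unfolding norm_mult e_def using M(3) by (intro mult_left_mono) auto
      have s: "summable (\<lambda>k. norm (wt X k) * (e n * M))"
        by (intro summable_mult2 summable_wt_norm qX_nonzero)
      have "norm (\<Sum>k. wt X k * pn n (1 * q ^ k)) \<le> (\<Sum>k. norm (wt X k) * (e n * M))"
        by (rule norm_suminf_le_suminf[OF b s])
      thus "norm (\<Sum>k. wt X k * pn n (1 * q ^ k)) \<le> (\<Sum>k. norm (wt X k)) * (e n * M)"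
        by (simp only: suminf_mult2[OF summable_wt_norm[OF qX_nonzero(1)]])
    qed
    have "(\<lambda>n. (\<Sum>k. norm (wt X k)) * (e n * M)) \<longlonglongrightarrow> (\<Sum>k. norm (wt X k)) * (0 * M)"
      by (intro tendsto_intros e0)
    thus "(\<lambda>n. (\<Sum>k. norm (wt X k)) * (e n * M)) \<longlonglongrightarrow> 0" by simp
  qed
  have "(\<lambda>n. Lam (pn n)) \<longlonglongrightarrow> qpoch_inf X q / den (1 / X) / qpoch_inf X q + 0 / qpoch_inf (1 / X) q"
    unfolding Lam_def v[symmetric] by (intro tendsto_intros A B X_gen)
  thus ?thesis using X_gen by simp
qed

text \<open>A nonterminating form of the q-Saalschuetz sum: the recurrence determines everything up to \<open>Lam (pn 0)\<close>, and
  the limit \<open>n \<rightarrow> \<infinity>\<close> determines that.\<close>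

theorem Lam_pn:
  "Lam (pn n) = qpochs [x, y, z] q n / qpochs [q * \<alpha> / x, q * \<alpha> / y, q * \<alpha> / z] q n *
     (qpochs_inf [q * \<alpha> / x, q * \<alpha> / y, q * \<alpha> / z] q / (qpochs_inf [x, y, z] q * den (1 / X)))"
proof -
  have rec: "Lam (pn n) = qpochs [x, y, z] q n / qpochs [q * \<alpha> / x, q * \<alpha> / y, q * \<alpha> / z] q n * Lam (pn 0)" for n
  proof (induction n)
    case (Suc n)
    show ?case unfolding Lam_pn_Suc Suc by (simp add: qpoch_Suc mult_ac)
  qed simp
  have "(\<lambda>n. qpoch x q n * (qpoch y q n * qpoch z q n) /
      (qpoch (q * \<alpha> / x) q n * (qpoch (q * \<alpha> / y) q n * qpoch (q * \<alpha> / z) q n)) * Lam (pn 0))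
    \<longlonglongrightarrow> qpoch_inf x q * (qpoch_inf y q * qpoch_inf z q) /
      (qpoch_inf (q * \<alpha> / x) q * (qpoch_inf (q * \<alpha> / y) q * qpoch_inf (q * \<alpha> / z) q)) * Lam (pn 0)"
    by (intro tendsto_intros qpoch_LIMSEQ q1) (use alpha_gen in auto)
  moreover have "(\<lambda>n. qpoch x q n * (qpoch y q n * qpoch z q n) /
      (qpoch (q * \<alpha> / x) q n * (qpoch (q * \<alpha> / y) q n * qpoch (q * \<alpha> / z) q n)) * Lam (pn 0)) = (\<lambda>n. Lam (pn n))"
    by (subst rec) simp
  ultimately have L: "(\<lambda>n. Lam (pn n)) \<longlonglongrightarrow> qpoch_inf x q * (qpoch_inf y q * qpoch_inf z q) /
      (qpoch_inf (q * \<alpha> / x) q * (qpoch_inf (q * \<alpha> / y) q * qpoch_inf (q * \<alpha> / z) q)) * Lam (pn 0)"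
    by (simp only:)
  have "qpoch_inf x q * (qpoch_inf y q * qpoch_inf z q) /
      (qpoch_inf (q * \<alpha> / x) q * (qpoch_inf (q * \<alpha> / y) q * qpoch_inf (q * \<alpha> / z) q)) * Lam (pn 0) = 1 / den (1 / X)"
    by (rule LIMSEQ_unique[OF L Lam_pn_LIMSEQ])
  hence "Lam (pn 0) = qpochs_inf [q * \<alpha> / x, q * \<alpha> / y, q * \<alpha> / z] q / (qpochs_inf [x, y, z] q * den (1 / X))"
    using xyz_gen alpha_gen den_nonzero[of "1 / X" 0] by (simp add: qpochs_inf_def field_simps)
  thus ?thesis using rec[of n] by simp
qed

end

context outer_poles
begin

lemma bdd2_vwp_weights:
  assumes p: "norm p < 1" and low: "qpoch_inf (\<alpha> * p / \<beta>) p \<noteq> 0"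
  shows "bdd2 (\<lambda>k N. vwp_weight \<alpha> \<beta> p k)"
proof -
  have "norm (1 - \<alpha> * p ^ (2 * k)) \<le> 1 + norm \<alpha>" for k
  proof -
    have "norm (\<alpha> * p ^ (2 * k)) \<le> norm \<alpha>"
      using p by (simp add: norm_mult norm_power mult_left_le power_le_one)
    thus ?thesis using norm_triangle_ineq4[of 1 "\<alpha> * p ^ (2 * k)"] by simp
  qed
  hence "bdd2 (\<lambda>k N. 1 - \<alpha> * p ^ (2 * k))" unfolding bdd2_def by blast
  moreover have "bdd2 (\<lambda>k N. qpoch w p k)" for w
    using bdd2_qpoch[OF p, of w "\<lambda>_ _. 0" "\<lambda>k _. k"] by simp
  ultimately have "bdd2 (\<lambda>k N. (1 - \<alpha> * p ^ (2 * k)) * ((qpoch \<alpha> p k * qpoch \<beta> p k) *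
      (inverse (qpoch p p k) * inverse (qpoch (\<alpha> * p / \<beta>) p k))))"
    by (intro bdd2_mult bdd2_inverse_qpoch_base p low qpoch_inf_base_nonzero)
  thus ?thesis by (simp add: vwp_weight_def divide_inverse mult_ac)
qed

text \<open>The factors of \<open>G\<close> apart from those absorbed by the weights, as a function of \<open>w = 1/t\<close>; here \<open>\<beta>\<close> stands for \<open>b^2\<close>.
  The products to the base \<open>q^2\<close> unite the factors with opposite signs.\<close>

definition kernel :: "complex \<Rightarrow> complex \<Rightarrow> complex" where
  "kernel \<beta> w = qpoch_inf (q * \<alpha> / \<beta> * w) q * qpoch_inf (q * \<alpha> * w^2) (q^2) /
     (den w * qpoch_inf (q * \<alpha> / \<beta> * w^2) (q^2))"

text \<open>At every outer pole the sum over \<open>n\<close> is a very-well-poised series with parameters \<open>1/w\<close> and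
  \<open>q/w\<close>.  At \<open>w = q^k / X\<close> it converges because of the convergence condition on the whole series;
  at \<open>w = q^k\<close> it terminates.\<close>

lemma pn_sums_kernel:
  assumes \<beta>: "\<beta> \<noteq> 0" and conv: "norm (q * \<alpha> / (\<beta> * X^2)) < 1"
    and low: "qpoch_inf (\<alpha> * q^2 / \<beta>) (q^2) \<noteq> 0"
    and gen: "qpoch_inf (q * \<alpha> / X) q \<noteq> 0" "qpoch_inf (q * \<alpha> / \<beta>) (q^2) \<noteq> 0"
    and c: "c \<in> {1, 1 / X}"
  shows "(\<lambda>n. vwp_weight \<alpha> \<beta> (q^2) n *
      (q * \<alpha> / (\<beta> * X^2)) ^ n * pn (2 * n) (c * q ^ k)) sums
    (qpoch_inf \<alpha> (q^2) / qpoch_inf (\<alpha> * q^2 / \<beta>) (q^2) * kernel \<beta> (c * q ^ k))"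
proof -
  define w where "w = c * q ^ k"
  have c0: "c \<noteq> 0" using c X0 by auto
  have w0: "w \<noteq> 0" using c0 q0 by (simp add: w_def)
  have p1: "norm (q^2) < 1" by (rule norm_sq_less_1[OF q1])
  have qaw: "qpoch_inf (q * \<alpha> * w) q \<noteq> 0"
    using qpoch_inf_tail_nonzero[of "q * \<alpha> * c" k] alpha_gen(1) gen(1) c by (auto simp: w_def mult_ac)
  have qaw2: "qpoch_inf (q * \<alpha> * w) (q^2) \<noteq> 0" "qpoch_inf (\<alpha> * q^2 * w) (q^2) \<noteq> 0"
    using qpoch_inf_square_base[OF q1, of "q * \<alpha> * w"] qaw by (auto simp: power2_eq_square mult_ac)
  have small: "norm (q * \<alpha> / \<beta> * w^2) < 1" if "c = 1 / X"
  proof -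
    have "norm (q * \<alpha> / \<beta> * w^2) = norm (q * \<alpha> / (\<beta> * X^2)) * norm (q ^ (2 * k))"
      by (simp add: w_def that power_mult_distrib power_mult[symmetric] norm_mult norm_divide mult_ac power_divide)
    also have "\<dots> \<le> norm (q * \<alpha> / (\<beta> * X^2))"
      using q1 by (intro mult_left_le) (auto simp: norm_power power_le_one)
    finally show ?thesis using conv by simp
  qed
  have den2: "qpoch_inf (q * \<alpha> / \<beta> * w^2) (q^2) \<noteq> 0"
  proof (cases "c = 1")
    case True
    have "w^2 = (q^2) ^ k" using True by (simp add: w_def power_mult[symmetric] mult.commute)
    thus ?thesis
      using gen(2) by (metis mult_zero_right qpoch_inf_split[OF p1, of "q * \<alpha> / \<beta>" k])
  next
    case False
    hence s: "norm (q * \<alpha> / \<beta> * w^2) < 1" using small c by simp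
    show ?thesis
    proof
      assume "qpoch_inf (q * \<alpha> / \<beta> * w^2) (q^2) = 0"
      then obtain j where "q * \<alpha> / \<beta> * w^2 * (q^2) ^ j = 1" using qpoch_inf_eq_0_iff[OF p1] by blast
      hence "norm (q * \<alpha> / \<beta> * w^2) * norm ((q^2) ^ j) = 1" by (metis norm_mult norm_one)
      moreover have "norm (q * \<alpha> / \<beta> * w^2) * norm ((q^2) ^ j) \<le> norm (q * \<alpha> / \<beta> * w^2)"
        using p1 by (intro mult_left_le) (auto simp: norm_power power_le_one)
      ultimately show False using s by simp
    qed
  qed
  have rat: "\<alpha> * q^2 / (1 / w) = \<alpha> * q^2 * w" "\<alpha> * q^2 / (q / w) = q * \<alpha> * w"
    "\<alpha> * q^2 / (\<beta> * (1 / w) * (q / w)) = q * \<alpha> / \<beta> * w^2"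
    "\<alpha> * q^2 / (\<beta> * (1 / w)) = q * \<alpha> / \<beta> * w * q" "\<alpha> * q^2 / (\<beta> * (q / w)) = q * \<alpha> / \<beta> * w"
    "\<alpha> * q^2 / (1 / w * (q / w)) = q * \<alpha> * w^2"
    using q0 w0 by (simp_all add: power2_eq_square field_simps)
  have params: "vwp6_params \<alpha> \<beta> (1 / w) (q / w) (q^2)"
  proof
    show "norm (\<alpha> * q^2 / (\<beta> * (1 / w) * (q / w))) < 1 \<or>
        (\<exists>K. qpoch (1 / w) (q^2) K * qpoch (q / w) (q^2) K = 0)"
    proof (cases "c = 1")
      case True
      have "qpoch (1 / w) q (2 * Suc k) = 0"
        using q0 True by (auto simp: qpoch_eq_0_iff w_def intro!: exI[of _ k])
      hence "qpoch (1 / w) (q^2) (Suc k) * qpoch (1 / w * q) (q^2) (Suc k) = 0"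
        by (simp only: qpoch_square_base)
      thus ?thesis by auto
    next
      case False
      thus ?thesis using small c unfolding rat by simp
    qed
  qed (use p1 \<beta> w0 q0 low qaw2 den2 in \<open>simp_all only: rat, auto\<close>)
  have summand: "vwp_weight \<alpha> \<beta> (q^2) n *
      (q * \<alpha> / (\<beta> * X^2)) ^ n * pn (2 * n) w
      = qpoch_inf (q * \<alpha> * w) q / den w * vwp6 \<alpha> \<beta> (1 / w) (q / w) (q^2) n" for n
  proof -
    have e1: "(\<Prod>j<2 * n. w - q ^ j) = w ^ (2 * n) * (qpoch (1 / w) (q^2) n * qpoch (q / w) (q^2) n)"
    proof -
      have "(\<Prod>j<2 * n. w - q ^ j) = (\<Prod>j<2 * n. w * (1 - 1 / w * q ^ j))"
        using w0 by (intro prod.cong refl) (simp add: right_diff_distrib)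
      also have "\<dots> = w ^ (2 * n) * qpoch (1 / w) q (2 * n)"
        by (simp only: prod.distrib qpoch_def prod_constant card_lessThan)
      finally show ?thesis by (simp add: qpoch_square_base[symmetric])
    qed
    have nz2: "qpoch (q * \<alpha> * w) q (2 * n) \<noteq> 0" by (rule qpoch_nonzero[OF q1 qaw])
    have e2: "qpoch_inf (q * \<alpha> * q ^ (2 * n) * w) q
        = qpoch_inf (q * \<alpha> * w) q / (qpoch (\<alpha> * q^2 * w) (q^2) n * qpoch (q * \<alpha> * w) (q^2) n)"
    proof -
      have sq: "qpoch (\<alpha> * q^2 * w) (q^2) n * qpoch (q * \<alpha> * w) (q^2) n = qpoch (q * \<alpha> * w) q (2 * n)"
        using qpoch_square_base[of "q * \<alpha> * w" q n] by (simp add: power2_eq_square mult_ac)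
      show ?thesis
        unfolding sq using qpoch_inf_split[OF q1, of "q * \<alpha> * w" "2 * n"] nz2 by (simp add: mult_ac)
    qed
    have e3: "(q * \<alpha> / (\<beta> * X^2)) ^ n * X ^ (2 * n) * w ^ (2 * n) = (q * \<alpha> / \<beta> * w^2) ^ n"
      using X0 by (simp add: power_mult power_mult_distrib[symmetric])
    have "vwp_weight \<alpha> \<beta> (q^2) n *
        (q * \<alpha> / (\<beta> * X^2)) ^ n * pn (2 * n) w
      = vwp_weight \<alpha> \<beta> (q^2) n *
        ((q * \<alpha> / (\<beta> * X^2)) ^ n * X ^ (2 * n) * w ^ (2 * n)) *
        (qpoch (1 / w) (q^2) n * qpoch (q / w) (q^2) n) * qpoch_inf (q * \<alpha> * q ^ (2 * n) * w) q / den w"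
      unfolding pn_def e1 by (simp add: mult_ac)
    thus ?thesis
      unfolding e3 e2 vwp6_def vwp_weight_def rat by (simp add: mult_ac)
  qed
  have "(\<lambda>n. qpoch_inf (q * \<alpha> * w) q / den w * vwp6 \<alpha> \<beta> (1 / w) (q / w) (q^2) n) sums
    (qpoch_inf (q * \<alpha> * w) q / den w *
      (qpochs_inf [\<alpha>, q * \<alpha> / \<beta> * w * q, q * \<alpha> / \<beta> * w, q * \<alpha> * w^2] (q^2) /
       qpochs_inf [\<alpha> * q^2 / \<beta>, \<alpha> * q^2 * w, q * \<alpha> * w, q * \<alpha> / \<beta> * w^2] (q^2)))"
    using sum_6phi5[OF params] unfolding rat by (rule sums_mult)
  also have "qpoch_inf (q * \<alpha> * w) q / den w *
      (qpochs_inf [\<alpha>, q * \<alpha> / \<beta> * w * q, q * \<alpha> / \<beta> * w, q * \<alpha> * w^2] (q^2) /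
       qpochs_inf [\<alpha> * q^2 / \<beta>, \<alpha> * q^2 * w, q * \<alpha> * w, q * \<alpha> / \<beta> * w^2] (q^2))
     = qpoch_inf \<alpha> (q^2) / qpoch_inf (\<alpha> * q^2 / \<beta>) (q^2) * kernel \<beta> w"
  proof -
    have s1: "qpoch_inf (q * \<alpha> * w) q = qpoch_inf (q * \<alpha> * w) (q^2) * qpoch_inf (\<alpha> * q^2 * w) (q^2)"
      using qpoch_inf_square_base[OF q1, of "q * \<alpha> * w"] by (simp add: power2_eq_square mult_ac)
    have s2: "qpoch_inf (q * \<alpha> / \<beta> * w) q = qpoch_inf (q * \<alpha> / \<beta> * w) (q^2) * qpoch_inf (q * \<alpha> / \<beta> * w * q) (q^2)"
      using qpoch_inf_square_base[OF q1, of "q * \<alpha> / \<beta> * w"] by simp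
    have gen: "(u * v) / D * (p1 * (p2 * (p3 * p4)) / (r * (v * (u * t)))) = p1 / r * (p3 * p2 * p4 / (D * t))"
      if "u \<noteq> 0" "v \<noteq> 0" for u v D p1 p2 p3 p4 r t :: complex
      using that by (simp add: mult_ac)
    show ?thesis
      unfolding kernel_def s1 s2 qpochs_inf_def list.map prod_list.Cons prod_list.Nil mult_1_right
      by (rule gen) (use qaw2 in auto)
  qed
  finally show ?thesis unfolding summand[symmetric] by (simp only: w_def)
qed

text \<open>The interchange of summations is absolutely convergent: \<open>pn\<close> is bounded uniformly in \<open>n\<close> and in the pole, and the
  remaining factors decay geometrically.\<close>

theorem vwp_sum_eq_Lam:
  assumes \<beta>: "\<beta> \<noteq> 0" and conv: "norm (q * \<alpha> / (\<beta> * X^2)) < 1"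
    and low: "qpoch_inf (\<alpha> * q^2 / \<beta>) (q^2) \<noteq> 0"
    and gen: "qpoch_inf (q * \<alpha> / X) q \<noteq> 0" "qpoch_inf (q * \<alpha> / \<beta>) (q^2) \<noteq> 0"
  shows "(\<Sum>n. vwp_weight \<alpha> \<beta> (q^2) n *
      (q * \<alpha> / (\<beta> * X^2)) ^ n * Lam (pn (2 * n)))
    = qpoch_inf \<alpha> (q^2) / qpoch_inf (\<alpha> * q^2 / \<beta>) (q^2) * Lam (kernel \<beta>)"
proof -
  define C where "C n = vwp_weight \<alpha> \<beta> (q^2) n *
      (q * \<alpha> / (\<beta> * X^2)) ^ n" for n
  define K where "K = qpoch_inf \<alpha> (q^2) / qpoch_inf (\<alpha> * q^2 / \<beta>) (q^2)"
  define \<delta> where "\<delta> = norm (q * \<alpha> / (\<beta> * X^2))"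
  obtain C0 where C0: "\<And>n. norm (C n) \<le> C0 * \<delta> ^ n" "C0 \<ge> 0"
  proof -
    obtain C0 where C0: "\<And>k. norm (vwp_weight \<alpha> \<beta> (q^2) k) \<le> C0"
      using bdd2_vwp_weights[OF norm_sq_less_1[OF q1] low] unfolding bdd2_def by blast
    have "norm (C n) \<le> C0 * \<delta> ^ n" for n
      unfolding C_def \<delta>_def norm_mult[of _ "_ ^ n"] norm_power by (rule mult_right_mono[OF C0]) simp
    moreover have "C0 \<ge> 0" using C0 norm_ge_zero order_trans by blast
    ultimately show ?thesis using that by blast
  qed
  obtain M where M: "\<And>n k c. c \<in> {1, 1 / X} \<Longrightarrow> norm (pn n (c * q ^ k)) \<le> M" "M \<ge> 0"
  proof -
    obtain M where M: "\<And>n k. norm (pn n (1 / X * q ^ k)) \<le> M" "M \<ge> 0"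
      "\<And>n k. norm (pn n (1 * q ^ k)) \<le> (\<Prod>j<n. (2 * norm X) * norm q ^ j) * M"
      using pn_uniform_bound by blast
    have "Bseq (\<lambda>n. \<Prod>j<n. (2 * norm X) * norm q ^ j)"
      by (rule convergent_imp_Bseq, rule convergentI,
          rule summable_LIMSEQ_zero[OF summable_superexponential[OF q1]]) simp
    then obtain L where L: "\<And>n. norm (\<Prod>j<n. (2 * norm X) * norm q ^ j) \<le> L" unfolding Bseq_def by blast
    have "norm (pn n (1 * q ^ k)) \<le> L * M" for n k
      by (rule order_trans[OF M(3) mult_right_mono[OF order_trans[OF abs_ge_self L[unfolded real_norm_def]] M(2)]])
    hence "norm (pn n (c * q ^ k)) \<le> max M (L * M)" if "c \<in> {1, 1 / X}" for n k c
      using that M(1)[of n k] by (auto simp: le_max_iff_disj)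
    thus ?thesis using that[of "max M (L * M)"] M(2) by (simp add: le_max_iff_disj)
  qed
  have half: "(\<Sum>k. wt r k * (K * kernel \<beta> (c * q ^ k))) = (\<Sum>n. C n * (\<Sum>k. wt r k * pn (2 * n) (c * q ^ k)))"
    "summable (\<lambda>n. C n * (\<Sum>k. wt r k * pn (2 * n) (c * q ^ k)))"
    if r: "qpoch_inf (q * r) q \<noteq> 0" and c: "c \<in> {1, 1 / X}" for r c
  proof -
    have b: "norm (wt r k * (C n * pn (2 * n) (c * q ^ k))) \<le> (C0 * \<delta> ^ n * M) * norm (wt r k)" for n k
    proof -
      have "norm (C n * pn (2 * n) (c * q ^ k)) \<le> (C0 * \<delta> ^ n) * M"
        unfolding norm_mult using C0 M(1)[OF c] M(2) by (intro mult_mono) (auto simp: \<delta>_def)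
      thus ?thesis unfolding norm_mult[of "wt r k"] by (subst mult.commute) (rule mult_right_mono, simp_all)
    qed
    have sM: "summable (\<lambda>n. C0 * \<delta> ^ n * M)"
      using conv by (intro summable_mult2 summable_mult summable_geometric) (simp add: \<delta>_def)
    note sw = suminf_swap_dominated[OF b sM summable_wt_norm[OF r]]
    have inner: "(\<Sum>n. wt r k * (C n * pn (2 * n) (c * q ^ k))) = wt r k * (K * kernel \<beta> (c * q ^ k))" for k
    proof -
      have "(\<lambda>n. C n * pn (2 * n) (c * q ^ k)) sums (K * kernel \<beta> (c * q ^ k))"
        using pn_sums_kernel[OF assms c, of k] by (simp only: C_def K_def)
      thus ?thesis by (intro sums_unique[symmetric] sums_mult)
    qed
    have outer: "(\<Sum>k. wt r k * (C n * pn (2 * n) (c * q ^ k))) = C n * (\<Sum>k. wt r k * pn (2 * n) (c * q ^ k))" for n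
      by (subst suminf_mult[OF summable_wt[OF r pn_Bseq], symmetric]) (simp add: mult_ac)
    show "(\<Sum>k. wt r k * (K * kernel \<beta> (c * q ^ k))) = (\<Sum>n. C n * (\<Sum>k. wt r k * pn (2 * n) (c * q ^ k)))"
      using sw(1) unfolding inner outer by simp
    show "summable (\<lambda>n. C n * (\<Sum>k. wt r k * pn (2 * n) (c * q ^ k)))"
      using sw(2) unfolding outer .
  qed
  have scal: "(\<Sum>k. wt r k * (K * kernel \<beta> (c * q ^ k))) = K * (\<Sum>k. wt r k * kernel \<beta> (c * q ^ k))"
    if r: "qpoch_inf (q * r) q \<noteq> 0" and c: "c \<in> {1, 1 / X}" for r c
  proof -
    have "(\<lambda>k. kernel \<beta> (c * q ^ k)) \<longlonglongrightarrow> 1 * 1 / (1 * 1)"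
    proof -
      have sq: "(c * q ^ k)^2 = c^2 * (q^2) ^ k" for k
        by (simp add: power_mult_distrib power_mult[symmetric] mult.commute)
      have L: "(\<lambda>k. qpoch_inf (u * (c^2 * (q^2) ^ k)) (q^2)) \<longlonglongrightarrow> 1" for u
        using qpoch_inf_times_power_LIMSEQ[OF norm_sq_less_1[OF q1], of "u * c^2"] by (simp add: mult.assoc)
      show ?thesis
        unfolding kernel_def sq by (intro tendsto_intros qpoch_inf_c_LIMSEQ den_LIMSEQ L) auto
    qed
    hence "Bseq (\<lambda>k. kernel \<beta> (c * q ^ k))" by (intro convergent_imp_Bseq convergentI)
    from suminf_mult[OF summable_wt[OF r this], of K] show ?thesis by (simp add: mult_ac)
  qed
  have "(\<Sum>n. C n * Lam (pn (2 * n))) =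
      (\<Sum>n. C n * (\<Sum>k. wt (1 / X) k * pn (2 * n) (1 / X * q ^ k)) / qpoch_inf X q
        + C n * (\<Sum>k. wt X k * pn (2 * n) (1 * q ^ k)) / qpoch_inf (1 / X) q)"
    by (simp add: Lam_def distrib_left)
  also have "\<dots> = (\<Sum>n. C n * (\<Sum>k. wt (1 / X) k * pn (2 * n) (1 / X * q ^ k))) / qpoch_inf X q
      + (\<Sum>n. C n * (\<Sum>k. wt X k * pn (2 * n) (1 * q ^ k))) / qpoch_inf (1 / X) q"
    using half(2)[OF qX_nonzero(2), of "1 / X"] half(2)[OF qX_nonzero(1), of 1]
    by (subst suminf_add[symmetric]) (auto intro!: summable_divide simp: suminf_divide)
  also have "\<dots> = K * Lam (kernel \<beta>)"
    using half(1)[OF qX_nonzero(2), of "1 / X"] half(1)[OF qX_nonzero(1), of 1]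
      scal[OF qX_nonzero(2), of "1 / X"] scal[OF qX_nonzero(1), of 1]
    by (simp add: Lam_def distrib_left)
  finally show ?thesis unfolding C_def K_def .
qed

end

section \<open>The poles of the integrand\<close>

lemma qpochs_inf_Nil [simp]: "qpochs_inf [] p = 1"
  and qpochs_inf_Cons [simp]: "qpochs_inf (a # as) p = qpoch_inf a p * qpochs_inf as p"
  by (simp_all add: qpochs_inf_def)

lemma thetas_two: "thetas [u, v] q = theta u q * theta v q"
  by (simp add: thetas_def)

lemma theta_alt: "theta t q = qpoch_inf t q * qpoch_inf (q / t) q"
  by (simp add: theta_def)

lemma phi_eqI:
  assumes "\<And>k. qpochs as p k = qpochs as' p k" "\<And>k. qpochs bs p k = qpochs bs' p k"
  shows "phi as bs p t = phi as' bs' p t"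
  unfolding phi_def using assms by simp

lemma suminf_proportional:
  fixes f g :: "nat \<Rightarrow> complex"
  assumes eq: "\<And>k. A * f k = T * g k" and f: "summable f"
  shows "A * suminf f = T * suminf g"
proof -
  have 1: "A * suminf f = (\<Sum>k. T * g k)" "summable (\<lambda>k. T * g k)"
    unfolding eq[symmetric] using f by (simp_all add: suminf_mult summable_mult)
  show ?thesis
  proof (cases "T = 0")
    case False
    hence "summable g" using 1(2) by (simp add: summable_cmult_iff)
    thus ?thesis unfolding 1(1) by (rule suminf_mult)
  qed (simp add: 1(1))
qed

text \<open>The sum of the residues at \<open>c q^k\<close>, times \<open>(q; q)\<close>: here \<open>o1\<close>, ..., \<open>o4\<close> are the other four inner families
  and \<open>b0\<close>, \<open>b1\<close>, \<open>b2\<close> the numerator parameters outside the theta functions.\<close>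

definition pole_term where
  "pole_term q h X b0 b1 b2 c o1 o2 o3 o4 =
     theta (h * c) q * theta (h * (X / c)) q * qpochs_inf [b0 / c, b1 / c, b2 / c] q /
     qpochs_inf [c, c / X, o1 / c, o2 / c, o3 / c, o4 / c] q *
     phi [c, c / X, q * c / b0, q * c / b1, q * c / b2] [q * c / o1, q * c / o2, q * c / o3, q * c / o4] q q"

definition vwp_term :: "complex \<Rightarrow> complex \<Rightarrow> complex \<Rightarrow> complex \<Rightarrow> complex \<Rightarrow> complex \<Rightarrow> complex \<Rightarrow> nat \<Rightarrow> complex" where
  "vwp_term q b x y z a t n = vwp_weight (a^2) (b^2) (q^2) n *
      (qpochs [x, y, z] q (2 * n) / qpochs [q * a^2 / x, q * a^2 / y, q * a^2 / z] q (2 * n)) * t ^ n"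

text \<open>The parameter \<open>a\<close> comes last because the continuity in \<open>a\<close> matters in the end.\<close>

definition residue_side :: "complex \<Rightarrow> complex \<Rightarrow> complex \<Rightarrow> complex \<Rightarrow> complex \<Rightarrow> complex \<Rightarrow> complex \<Rightarrow> complex \<Rightarrow> complex" where
  "residue_side q s b h x y z a =
     qpochs_inf (pm (q * a) @ [x, y, z, q * a^2 / (x * y), q * a^2 / (x * z), q * a^2 / (y * z)]) q /
     (thetas [h, h * (x * y * z / (q * a^2))] q *
      qpochs_inf (pm (q * a / b) @ [q * a^2 / x, q * a^2 / y, q * a^2 / z]) q) *
     (F_term q s a b h x y z + F_term q s a b h y x z + F_term q s a b h z y x +
      qpochs_inf (pm b) q / (2 * qpochs_inf [- q] q) *
      (E_term q s a b h x y z 1 + E_term q s a b h x y z (- 1)))"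

text \<open>The hypotheses of the theorem, reduced to the non-vanishing of single products, and three groups of genericity
  conditions that do not follow from them: \<open>X_ok\<close> and \<open>tau_one_ok\<close> separate the poles, and \<open>alpha_ok\<close> keeps the
  denominators in the recurrence for \<open>pn\<close> and in the 6-phi-5 sum away from zero.\<close>

locale nine_parameters =
  fixes q s a b x y z h :: complex
  assumes q0: "q \<noteq> 0" and q1: "norm q < 1" and sq: "s^2 = q"
    and par_nz: "a \<noteq> 0" "b \<noteq> 0" "x \<noteq> 0" "y \<noteq> 0" "z \<noteq> 0" "h \<noteq> 0"
    and conv: "norm (q^3 * a^6) < norm (b * x * y * z) ^ 2"
    and one_ne: "1 - a^2 \<noteq> 0"
    and xyz_ok: "qpoch_inf x q \<noteq> 0" "qpoch_inf y q \<noteq> 0" "qpoch_inf z q \<noteq> 0"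
    and pair_ok: "qpoch_inf (q * a^2 / (y * z)) q \<noteq> 0" "qpoch_inf (q * a^2 / (x * z)) q \<noteq> 0"
      "qpoch_inf (q * a^2 / (y * x)) q \<noteq> 0"
    and low_ok: "qpoch_inf (q * a / b) q \<noteq> 0" "qpoch_inf (- (q * a / b)) q \<noteq> 0"
      "qpoch_inf (q * a^2 / x) q \<noteq> 0" "qpoch_inf (q * a^2 / y) q \<noteq> 0" "qpoch_inf (q * a^2 / z) q \<noteq> 0"
    and distinct_ok: "qpoch_inf (y / x) q \<noteq> 0" "qpoch_inf (z / x) q \<noteq> 0" "qpoch_inf (x / y) q \<noteq> 0"
      "qpoch_inf (z / y) q \<noteq> 0" "qpoch_inf (y / z) q \<noteq> 0" "qpoch_inf (x / z) q \<noteq> 0"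
    and tau_ok: "\<And>w. w \<in> {x, y, z} \<Longrightarrow> qpoch_inf (s * a / (b * w)) q \<noteq> 0"
      "\<And>w. w \<in> {x, y, z} \<Longrightarrow> qpoch_inf (- (s * a / (b * w))) q \<noteq> 0"
      "\<And>w. w \<in> {x, y, z} \<Longrightarrow> qpoch_inf (b * w / (s * a)) q \<noteq> 0"
      "\<And>w. w \<in> {x, y, z} \<Longrightarrow> qpoch_inf (- (b * w / (s * a))) q \<noteq> 0"
      "qpoch_inf (s^3 * a^3 / (b * x * y * z)) q \<noteq> 0" "qpoch_inf (- (s^3 * a^3 / (b * x * y * z))) q \<noteq> 0"
    and theta_ok: "theta h q \<noteq> 0" "theta (h * (x * y * z / (q * a^2))) q \<noteq> 0"
    and minus_q_ok: "qpoch_inf (- q) q \<noteq> 0"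
    and X_ok: "qpoch_inf (x * y * z / (q * a^2)) q \<noteq> 0" "qpoch_inf (q * a^2 / (x * y * z)) q \<noteq> 0"
    and tau_one_ok: "qpoch_inf (s * a / b) q \<noteq> 0" "qpoch_inf (- (s * a / b)) q \<noteq> 0"
    and alpha_ok: "qpoch_inf (q * a^2) q \<noteq> 0" "qpoch_inf (q * a^2 * (q * a^2) / (x * y * z)) q \<noteq> 0"
begin

definition X where "X = x * y * z / (q * a^2)"
definition \<tau> where "\<tau> = s * a / b"

lemma s0: "s \<noteq> 0" using sq q0 by auto
lemma X0: "X \<noteq> 0" using par_nz q0 by (simp add: X_def)
lemma \<tau>0: "\<tau> \<noteq> 0" using par_nz s0 by (simp add: \<tau>_def)

lemma over_X:
  "x / X = q * a^2 / (y * z)" "y / X = q * a^2 / (x * z)" "z / X = q * a^2 / (y * x)"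
  "X / x = y * z / (q * a^2)" "X / y = x * z / (q * a^2)" "X / z = y * x / (q * a^2)"
  "1 / X = q * a^2 / (x * y * z)" "q * a^2 / X = q * a^2 * (q * a^2) / (x * y * z)"
  "\<tau> / X = s^3 * a^3 / (b * x * y * z)" "X / \<tau> = b * x * y * z / (s^3 * a^3)"
proof -
  have s3: "s ^ 3 = s * q" by (simp add: sq[symmetric] power3_eq_cube power2_eq_square)
  show "\<tau> / X = s^3 * a^3 / (b * x * y * z)" "X / \<tau> = b * x * y * z / (s^3 * a^3)"
    unfolding s3 using par_nz q0 s0 by (simp_all add: X_def \<tau>_def field_simps power2_eq_square power3_eq_cube)
qed (use par_nz q0 in \<open>simp_all add: X_def field_simps power2_eq_square\<close>)

lemma \<tau>_square: "\<tau> * \<tau> = q * a^2 / b^2" "s * a * (s * a) = q * a^2" "q * a^2 * X = x * y * z"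
proof -
  show "q * a^2 * X = x * y * z" using par_nz q0 by (simp add: X_def)
qed (simp_all add: \<tau>_def sq[symmetric] power2_eq_square)

sublocale outer_poles q X x y z "a^2"
proof
  show "X = x * y * z / (q * a^2)" by (rule X_def)
  show "qpoch_inf X q \<noteq> 0" unfolding X_def by (rule X_ok(1))
  show "qpoch_inf (1 / X) q \<noteq> 0" unfolding over_X by (rule X_ok(2))
  show "qpoch_inf (x / X) q \<noteq> 0" "qpoch_inf (y / X) q \<noteq> 0" "qpoch_inf (z / X) q \<noteq> 0"
    unfolding over_X by (rule pair_ok)+
  show "a^2 \<noteq> 0" using par_nz by simp
qed (fact q0 q1 par_nz xyz_ok low_ok alpha_ok)+

text \<open>The data of \<open>G\<close> for \<open>two_sided_poles\<close>: each theta function \<open>\<vartheta>(g t)\<close> contributes \<open>g\<close> to the outer numerators \<open>es\<close> and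
  \<open>q / g\<close> to the inner numerators \<open>bs\<close>, with \<open>g = h\<close> and \<open>g = q / (h X)\<close>.\<close>

definition cs where "cs = (!) [x, y, z, \<tau>, - \<tau>]"
definition bs where "bs = (!) [s * a, - (s * a), q * a^2 / b^2, q / h, h * X]"
definition ds where "ds = (!) [1, 1 / X]"
definition es where "es = (!) [h, q / (h * X)]"

abbreviation "I5 \<equiv> {0, 1, 2, 3, 4 :: nat}"
abbreviation "I2 \<equiv> {0, 1 :: nat}"

lemma nth_values:
  "cs 0 = x" "cs 1 = y" "cs (Suc 0) = y" "cs 2 = z" "cs 3 = \<tau>" "cs 4 = - \<tau>"
  "bs 0 = s * a" "bs 1 = - (s * a)" "bs (Suc 0) = - (s * a)" "bs 2 = q * a^2 / b^2" "bs 3 = q / h" "bs 4 = h * X"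
  "ds 0 = 1" "ds 1 = 1 / X" "ds (Suc 0) = 1 / X" "es 0 = h" "es 1 = q / (h * X)" "es (Suc 0) = q / (h * X)"
  by (simp_all add: cs_def bs_def ds_def es_def)

lemma qpoch_inf_minus_one: "qpoch_inf (- 1) q = 2 * qpoch_inf (- q) q"
  using qpoch_inf_head[of "- 1"] by simp

lemma prods:
  "(\<Prod>i\<in>I5. cs i) = - (x * y * z * (q * a^2 / b^2))" "(\<Prod>i\<in>I5. bs i) = q * (\<Prod>i\<in>I5. cs i)"
  "(\<Prod>i\<in>I2. ds i) = 1 / X" "(\<Prod>i\<in>I2. es i) = q * (\<Prod>i\<in>I2. ds i)"
proof -
  show 1: "(\<Prod>i\<in>I5. cs i) = - (x * y * z * (q * a^2 / b^2))"
    unfolding \<tau>_square(1)[symmetric] by (simp add: nth_values)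
  have "(\<Prod>i\<in>I5. bs i) = - ((s * a * (s * a)) * (q * a^2 / b^2) * (q * X))"
    using par_nz by (simp add: nth_values)
  also have "\<dots> = q * - ((q * a^2 * X) * (q * a^2 / b^2))"
    unfolding \<tau>_square(2) by simp
  finally show "(\<Prod>i\<in>I5. bs i) = q * (\<Prod>i\<in>I5. cs i)"
    unfolding 1 \<tau>_square(3) .
  show "(\<Prod>i\<in>I2. ds i) = 1 / X" "(\<Prod>i\<in>I2. es i) = q * (\<Prod>i\<in>I2. ds i)"
    using par_nz by (simp_all add: nth_values)
qed

lemma tau_pairs:
  assumes "w \<in> {x, y, z}"
  shows "qpoch_inf (\<tau> / w) q \<noteq> 0" "qpoch_inf (- \<tau> / w) q \<noteq> 0"
    "qpoch_inf (w / \<tau>) q \<noteq> 0" "qpoch_inf (w / - \<tau>) q \<noteq> 0"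
proof -
  have "\<tau> / w = s * a / (b * w)" "- \<tau> / w = - (s * a / (b * w))"
    "w / \<tau> = b * w / (s * a)" "w / - \<tau> = - (b * w / (s * a))"
    by (simp_all add: \<tau>_def)
  thus "qpoch_inf (\<tau> / w) q \<noteq> 0" "qpoch_inf (- \<tau> / w) q \<noteq> 0"
    "qpoch_inf (w / \<tau>) q \<noteq> 0" "qpoch_inf (w / - \<tau>) q \<noteq> 0"
    using tau_ok(1-4)[OF assms] by simp_all
qed

lemma minus_one_pairs: "qpoch_inf (\<tau> / - \<tau>) q \<noteq> 0" "qpoch_inf (- \<tau> / \<tau>) q \<noteq> 0"
  using \<tau>0 minus_q_ok qpoch_inf_minus_one by simp_all

lemmas pairs = distinct_ok minus_one_pairs tau_pairs[of x, simplified] tau_pairs[of y, simplified] tau_pairs[of z, simplified]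

lemma cross_pairs:
  "qpoch_inf \<tau> q \<noteq> 0" "qpoch_inf (- \<tau>) q \<noteq> 0" "qpoch_inf (\<tau> / X) q \<noteq> 0" "qpoch_inf (- \<tau> / X) q \<noteq> 0"
proof -
  have "- \<tau> / X = - (s^3 * a^3 / (b * x * y * z))" using over_X(9) by simp
  thus "qpoch_inf (- \<tau> / X) q \<noteq> 0" using tau_ok(6) by (simp only: not_False_eq_True)
  show "qpoch_inf (\<tau> / X) q \<noteq> 0" unfolding over_X by (rule tau_ok(5))
qed (use tau_one_ok in \<open>simp_all add: \<tau>_def\<close>)

sublocale inner: two_sided_poles q I5 I2 I5 I2 cs ds bs es
proof
  fix i i' assume "i \<in> I5" "i' \<in> I5" "i \<noteq> i'"
  thus "qpoch_inf (cs i' / cs i) q \<noteq> 0"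
    by (elim insertE emptyE) (simp_all add: nth_values pairs[simplified])
next
  fix i i' assume "i \<in> I2" "i' \<in> I2" "i \<noteq> i'"
  thus "qpoch_inf (ds i' / ds i) q \<noteq> 0"
    using X_gen by (auto simp: nth_values)
next
  fix i j assume "i \<in> I5" "j \<in> I2"
  thus "qpoch_inf (ds j * cs i) q \<noteq> 0"
    by (elim insertE emptyE) (use xyz_gen xyzX_gen cross_pairs in \<open>simp_all add: nth_values\<close>)
next
  have c0: "(\<Prod>i\<in>I5. cs i) \<noteq> 0" "(\<Prod>i\<in>I2. ds i) \<noteq> 0" unfolding prods using par_nz q0 X0 by simp_all
  show "norm (\<Prod>i\<in>I5. bs i) < norm (\<Prod>i\<in>I5. cs i)" "norm (\<Prod>i\<in>I2. es i) < norm (\<Prod>i\<in>I2. ds i)"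
    using c0 q1 by (simp_all only: prods(2,4) norm_mult) simp_all
qed (use q0 q1 par_nz s0 X0 \<tau>0 in \<open>auto simp: nth_values\<close>)

sublocale outer: two_sided_poles q I2 I5 I2 I5 ds cs es bs
  by (rule inner.swapped)

lemma rho_eq: "inner.rho = q" "outer.rho = q"
proof -
  have "(\<Prod>i\<in>I5. cs i) \<noteq> 0" "(\<Prod>i\<in>I2. ds i) \<noteq> 0" unfolding prods using par_nz q0 X0 by simp_all
  thus "inner.rho = q" "outer.rho = q" unfolding inner.rho_def outer.rho_def prods(2,4) by simp_all
qed

text \<open>The quasi-periodicity of theta functions: at \<open>c q^k\<close> the factor that grows with \<open>k\<close> after reflection compensates
  the one that loses its first \<open>k\<close> factors.\<close>

lemma theta_factors:
  "qpoch v q k * qpoch_inf (v * q ^ k) q * qpoch_inf (q / v) q = theta v q"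
  unfolding theta_alt qpoch_inf_split[OF q1, of v k] by simp

lemma inner_sum:
  assumes i: "i \<in> I5" and c: "cs i = c" "c \<noteq> 0"
    and others: "\<And>f. (\<Prod>i'\<in>I5 - {i}. f (cs i')) = f o1 * (f o2 * (f o3 * (f o4 :: complex)))"
    and ok: "qpoch_inf c q \<noteq> 0" "qpoch_inf (c / X) q \<noteq> 0"
  shows "qpoch_inf q q * (\<Sum>k. inner.res i k) = pole_term q h X (s * a) (- (s * a)) (q * a^2 / b^2) c o1 o2 o3 o4"
proof -
  define T where "T = theta (h * c) q * theta (h * (X / c)) q *
     qpochs_inf [s * a / c, - (s * a) / c, q * a^2 / b^2 / c] q / qpochs_inf [c, c / X, o1 / c, o2 / c, o3 / c, o4 / c] q"
  define u where "u k = qpochs [c, c / X, q * c / (s * a), q * c / - (s * a), q * c / (q * a^2 / b^2)] q k /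
     qpochs (q # [q * c / o1, q * c / o2, q * c / o3, q * c / o4]) q k * q ^ k" for k
  have Q: "qpoch_inf q q \<noteq> 0" by (rule qpoch_inf_base_nonzero[OF q1])
  have th1: "qpoch (h * c) q k * qpoch_inf (q / h / c) q * qpoch_inf (h * c * q ^ k) q = theta (h * c) q" for k
    using theta_factors[of "h * c" k] by (simp add: mult_ac)
  have th2: "qpoch (q * c / (h * X)) q k * qpoch_inf (h * X / c) q * qpoch_inf (q / (h * X) * c * q ^ k) q = theta (h * (X / c)) q" for k
  proof -
    have "theta (q / v) q = theta v q" if "v \<noteq> 0" for v
      using that q0 by (simp add: theta_alt mult.commute)
    moreover have "q / (h * (X / c)) = q * c / (h * X)" by simp
    ultimately have t: "theta (q * c / (h * X)) q = theta (h * (X / c)) q"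
      using par_nz X0 c(2) by (metis divide_eq_0_iff mult_eq_0_iff)
    have "q / (q * c / (h * X)) = h * X / c" using q0 by simp
    thus ?thesis
      using theta_factors[of "q * c / (h * X)" k] unfolding t by (simp add: mult_ac)
  qed
  have J: "1 / qpoch_inf (v * q ^ k) q = qpoch v q k / qpoch_inf v q" if "qpoch_inf v q \<noteq> 0" for v k
    using qpoch_inf_split[OF q1, of v k] that by (auto simp: field_simps)
  have gen: "Q * (qk * ((b0 * B0) * ((b1 * B1) * ((b2 * B2) * ((t1 * T1) * (t2 * T2))))) * (e1 * e2) /
      (qq * Q * ((p1 * P1) * ((p2 * P2) * ((p3 * P3) * (p4 * P4)))) * (j1 * j2)))
      = (t1 * T1 * e1) * (t2 * T2 * e2) * (B0 * (B1 * B2)) * (1 / j1) * (1 / j2) / (P1 * (P2 * (P3 * P4)))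
        * ((b0 * (b1 * b2)) / (qq * (p1 * (p2 * (p3 * p4)))) * qk)"
    if "Q \<noteq> 0" for Q qk b0 B0 b1 B1 b2 B2 t1 T1 t2 T2 e1 e2 qq p1 P1 p2 P2 p3 P3 p4 P4 j1 j2 :: complex
    using that by (simp add: divide_inverse mult_ac)
  have "qpoch_inf q q * inner.res i k = T * u k" for k
  proof -
    have "qpoch_inf q q * inner.res i k = qpoch_inf q q * (q ^ k *
      ((qpoch (q * c / (s * a)) q k * qpoch_inf (s * a / c) q) *
       ((qpoch (q * c / - (s * a)) q k * qpoch_inf (- (s * a) / c) q) *
        ((qpoch (q * c / (q * a^2 / b^2)) q k * qpoch_inf (q * a^2 / b^2 / c) q) *
         ((qpoch (h * c) q k * qpoch_inf (q / h / c) q) *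
          (qpoch (q * c / (h * X)) q k * qpoch_inf (h * X / c) q))))) *
      (qpoch_inf (h * c * q ^ k) q * qpoch_inf (q / (h * X) * c * q ^ k) q) /
      (qpoch q q k * qpoch_inf q q *
       ((qpoch (q * c / o1) q k * qpoch_inf (o1 / c) q) *
        ((qpoch (q * c / o2) q k * qpoch_inf (o2 / c) q) *
         ((qpoch (q * c / o3) q k * qpoch_inf (o3 / c) q) *
          (qpoch (q * c / o4) q k * qpoch_inf (o4 / c) q)))) *
       (qpoch_inf (c * q ^ k) q * qpoch_inf (c / X * q ^ k) q)))"
      unfolding inner.res_def rho_eq c(1) others[of "\<lambda>w. qpoch (q * c / w) q k * qpoch_inf (w / c) q"]
      using q0 by (simp add: nth_values mult.commute[of h c])
    also have "\<dots> = theta (h * c) q * theta (h * (X / c)) q *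
        (qpoch_inf (s * a / c) q * (qpoch_inf (- (s * a) / c) q * qpoch_inf (q * a^2 / b^2 / c) q)) *
        (qpoch c q k / qpoch_inf c q) * (qpoch (c / X) q k / qpoch_inf (c / X) q) /
        (qpoch_inf (o1 / c) q * (qpoch_inf (o2 / c) q * (qpoch_inf (o3 / c) q * qpoch_inf (o4 / c) q))) *
        ((qpoch (q * c / (s * a)) q k * (qpoch (q * c / - (s * a)) q k * qpoch (q * c / (q * a^2 / b^2)) q k)) /
         (qpoch q q k * (qpoch (q * c / o1) q k * (qpoch (q * c / o2) q k * (qpoch (q * c / o3) q k * qpoch (q * c / o4) q k)))) * q ^ k)"
      unfolding gen[OF Q] th1 th2 J[OF ok(1)] J[OF ok(2)] ..
    also have "\<dots> = T * u k"
      unfolding T_def u_def qpochs_Cons qpochs_Nil qpochs_inf_Cons qpochs_inf_Nil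
      by (simp add: mult_ac)
    finally show ?thesis .
  qed
  moreover have "summable (inner.res i)"
    by (rule summable_norm_cancel[OF inner.res_trunc_LIMSEQ(2)[OF i]])
  ultimately have "qpoch_inf q q * (\<Sum>k. inner.res i k) = T * suminf u"
    by (rule suminf_proportional)
  thus ?thesis unfolding pole_term_def phi_def T_def u_def .
qed

lemma a_square_pm:
  "qpoch_inf (s * a * w) q * qpoch_inf (- (s * a) * w) q = qpoch_inf (q * a^2 * w^2) (q^2)"
  "qpoch_inf (\<tau> * w) q * qpoch_inf (- \<tau> * w) q = qpoch_inf (q * a^2 / b^2 * w^2) (q^2)"
  using qpoch_inf_pm[OF q1, of "s * a * w"] qpoch_inf_pm[OF q1, of "\<tau> * w"]
  by (simp_all add: power_mult_distrib sq \<tau>_def power_divide)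

text \<open>The two outer families are interchanged by \<open>c \<mapsto> 1 / (X c)\<close>, which also interchanges the two theta functions
  \<open>\<vartheta>(h / c)\<close> and \<open>\<vartheta>(h X c)\<close>.\<close>

lemma outer_half:
  assumes j: "j \<in> I2" and c: "ds j = c" "c \<in> {1, 1 / X}"
    and other: "\<And>f. (\<Prod>i'\<in>I2 - {j}. f (ds i')) = (f (r * c) :: complex)"
    and r: "r = 1 / X \<and> c = 1 \<or> r = X \<and> c = 1 / X"
  shows "qpoch_inf q q * (\<Sum>k. outer.res j k) =
    theta h q * theta (h * X) q * ((\<Sum>k. wt (1 / r) k * kernel (b^2) (c * q ^ k)) / qpoch_inf r q)"
proof -
  have c0: "c \<noteq> 0" using c X0 by auto
  have Q: "qpoch_inf q q \<noteq> 0" by (rule qpoch_inf_base_nonzero[OF q1])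
  have th1: "qpoch (q * c / h) q k * qpoch_inf (h / c) q * qpoch_inf (q / h * (c * q ^ k)) q = theta (h / c) q" for k
    using theta_factors[of "q * c / h" k] q0 by (simp add: theta_alt mult_ac)
  have th2: "qpoch (h * X * c) q k * qpoch_inf (q / (h * X) / c) q * qpoch_inf (h * X * (c * q ^ k)) q = theta (h * X * c) q" for k
    using theta_factors[of "h * X * c" k] by (simp add: mult_ac)
  have th: "theta (h / c) q * theta (h * X * c) q = theta h q * theta (h * X) q"
    using r X0 by auto
  have qc: "q * c / (q / (h * X)) = h * X * c" using q0 by simp
  have gen: "Q * (qk * ((e1 * E1) * (e2 * E2)) * (b0 * (b1 * (b2 * (b3 * b4)))) /
      (qq * Q * (d1 * D1) * (c0 * (c1 * (c2 * (c3 * c4))))))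
     = (e1 * E1 * b3) * (e2 * E2 * b4) / D1 * (qk / (qq * d1) * (b2 * (b0 * b1) / (c0 * c1 * c2 * (c3 * c4))))"
    if "Q \<noteq> 0" for Q qk e1 E1 e2 E2 b0 b1 b2 b3 b4 qq d1 D1 c0 c1 c2 c3 c4 :: complex
    using that by (simp add: divide_inverse mult_ac)
  have "qpoch_inf q q * outer.res j k = theta h q * theta (h * X) q / qpoch_inf r q * (wt (1 / r) k * kernel (b^2) (c * q ^ k))" for k
  proof -
    define w where "w = c * q ^ k"
    have rc: "q * c / (r * c) = q * (1 / r)" "r * c / c = r" using c0 by simp_all
    have "qpoch_inf q q * outer.res j k = qpoch_inf q q * (q ^ k *
       ((qpoch (q * c / h) q k * qpoch_inf (h / c) q) * (qpoch (h * X * c) q k * qpoch_inf (q / (h * X) / c) q)) *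
       (qpoch_inf (s * a * w) q * (qpoch_inf (- (s * a) * w) q * (qpoch_inf (q * a^2 / b^2 * w) q *
         (qpoch_inf (q / h * w) q * qpoch_inf (h * X * w) q)))) /
       (qpoch q q k * qpoch_inf q q * (qpoch (q * (1 / r)) q k * qpoch_inf r q) *
        (qpoch_inf (x * w) q * (qpoch_inf (y * w) q * (qpoch_inf (z * w) q *
          (qpoch_inf (\<tau> * w) q * qpoch_inf (- \<tau> * w) q))))))"
      unfolding outer.res_def rho_eq c(1) other[of "\<lambda>v. qpoch (q * c / v) q k * qpoch_inf (v / c) q"] rc qc[symmetric] w_def
      by (simp add: nth_values mult.assoc)
    also have "\<dots> = theta (h / c) q * theta (h * X * c) q / qpoch_inf r q *
        (q ^ k / (qpoch q q k * qpoch (q * (1 / r)) q k) *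
         (qpoch_inf (q * a^2 / b^2 * w) q * qpoch_inf (q * a^2 * w^2) (q^2) /
          (qpoch_inf (x * w) q * qpoch_inf (y * w) q * qpoch_inf (z * w) q * qpoch_inf (q * a^2 / b^2 * w^2) (q^2))))"
      unfolding gen[OF Q] unfolding a_square_pm th1[of k, folded w_def] th2[of k, folded w_def] ..
    finally show ?thesis unfolding th wt_def kernel_def den_def w_def .
  qed
  moreover have "summable (outer.res j)"
    by (rule summable_norm_cancel[OF outer.res_trunc_LIMSEQ(2)[OF j]])
  ultimately have "qpoch_inf q q * (\<Sum>k. outer.res j k) =
      theta h q * theta (h * X) q / qpoch_inf r q * (\<Sum>k. wt (1 / r) k * kernel (b^2) (c * q ^ k))"
    by (rule suminf_proportional)
  thus ?thesis by simp
qed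

lemma outer_sum:
  "qpoch_inf q q * (\<Sum>j\<in>I2. \<Sum>k. outer.res j k) = theta h q * theta (h * X) q * Lam (kernel (b^2))"
proof -
  have d0: "I2 - {0} = {1}" "I2 - {1} = {0}" by auto
  have h0: "qpoch_inf q q * (\<Sum>k. outer.res 0 k) = theta h q * theta (h * X) q *
      ((\<Sum>k. wt (1 / (1 / X)) k * kernel (b^2) (1 * q ^ k)) / qpoch_inf (1 / X) q)"
    by (rule outer_half) (simp_all only: d0, simp_all add: nth_values)
  have h1: "qpoch_inf q q * (\<Sum>k. outer.res 1 k) = theta h q * theta (h * X) q *
      ((\<Sum>k. wt (1 / X) k * kernel (b^2) (1 / X * q ^ k)) / qpoch_inf X q)"
    by (rule outer_half) (simp_all only: d0, use X0 in \<open>simp_all add: nth_values\<close>)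
  have "(\<Sum>j\<in>I2. \<Sum>k. outer.res j k) = (\<Sum>k. outer.res 0 k) + (\<Sum>k. outer.res 1 k)" by simp
  thus ?thesis using h0 h1 X0 by (simp add: Lam_def distrib_left)
qed

lemma F_term_eq_pole_term:
  assumes cw: "c \<noteq> 0" "v \<noteq> 0" "w \<noteq> 0" and cvw: "c * v * w = x * y * z"
  shows "F_term q s a b h c v w =
    pole_term q h X (s * a) (- (s * a)) (q * a^2 / b^2) c v w \<tau> (- \<tau>)"
proof -
  have X: "X = c * v * w / (q * a^2)" by (simp add: X_def cvw)
  have e: "X / c = v * w / (q * a^2)" "c / X = q * a^2 / (v * w)"
    "q * a^2 / b^2 / c = q * a^2 / (b^2 * c)" "- (s * a) / c = - (s * a / c)"
    "\<tau> / c = s * a / (b * c)" "- \<tau> / c = - (s * a / (b * c))"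
    "q * c / (q * a^2 / b^2) = b^2 * c / a^2"
    using cw par_nz q0 by (simp_all add: X \<tau>_def field_simps power2_eq_square)
  have e2: "q * c / (s * a) = s * c / a" "q * c / - (s * a) = - (s * c / a)"
    "q * c / \<tau> = s * b * c / a" "q * c / - \<tau> = - (s * b * c / a)"
    using par_nz s0 by (simp_all add: \<tau>_def sq[symmetric] power2_eq_square)
  have u: "qpochs_inf [s * a / c, - (s * a) / c, q * a^2 / b^2 / c] q = qpochs_inf (pm (s * a / c) @ [q * a^2 / (b^2 * c)]) q"
    unfolding e by (simp add: pm_def)
  have l: "qpochs_inf [c, c / X, v / c, w / c, \<tau> / c, - \<tau> / c] q = qpochs_inf (F_denom q s a b c v w) q"
    unfolding e by (simp add: F_denom_def pm_def mult_ac)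
  have p: "phi [c, c / X, q * c / (s * a), q * c / - (s * a), q * c / (q * a^2 / b^2)] [q * c / v, q * c / w, q * c / \<tau>, q * c / - \<tau>] q q
      = phi ([c, q * a^2 / (v * w)] @ pm (s * c / a) @ [b^2 * c / a^2]) (F_lower q s a b c v w) q q"
    unfolding e e2 by (simp add: F_lower_def pm_def)
  have t: "thetas [h * c, h * (v * w / (q * a^2))] q = theta (h * c) q * theta (h * (X / c)) q"
    unfolding e thetas_two ..
  show ?thesis unfolding F_term_def pole_term_def u l p t ..
qed

text \<open>At \<open>t = e \<tau>\<close> the numerator \<open>q a^2 / (b^2 t)\<close> equals \<open>t\<close> and cancels the denominator factor \<open>(t)\<close>, while the
  pole family of opposite sign contributes \<open>(-1; q) = 2 (-q; q)\<close>; this explains the prefactor.\<close>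

lemma E_term_eq_pole_term:
  assumes e: "e = 1 \<or> e = - 1"
  shows "qpochs_inf (pm b) q / (2 * qpochs_inf [- q] q) * E_term q s a b h x y z e =
    pole_term q h X (s * a) (- (s * a)) (q * a^2 / b^2) (e * \<tau>) x y z (- (e * \<tau>))"
proof -
  define c where "c = e * \<tau>"
  have ee: "e * e = 1" "e \<noteq> 0" "1 / e = e" using e by auto
  have c0: "c \<noteq> 0" using ee \<tau>0 by (simp add: c_def)
  have s3: "s ^ 3 = s * q" by (simp add: sq[symmetric] power3_eq_cube power2_eq_square)
  have over_e: "v / (e * w) = e * (v / w)" for v w using e by auto
  have cX: "c / X = e * (\<tau> / X)" "X / c = e * (X / \<tau>)"
    unfolding c_def over_e by simp_all
  have arg: "c = e * s * a / b" "c / X = e * s ^ 3 * a ^ 3 / (b * x * y * z)"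
    "h * (X / c) = e * h * (b * x * y * z / (s ^ 3 * a ^ 3))" "h * c = e * h * (s * a / b)"
    unfolding cX over_X by (simp_all add: c_def \<tau>_def)
  have oc: "v / c = e * b * v / (s * a)" "q * c / v = e * s ^ 3 * a / (b * v)" for v
    unfolding c_def over_e s3 by (simp_all add: \<tau>_def)
  have bc: "q * a^2 / b^2 / c = c"
    unfolding \<tau>_square(1)[symmetric] c_def over_e using \<tau>0 by simp
  have up: "q * c / (q * a^2 / b^2) = e * s * b / a" "q * c / (s * a) = e * (q / b)" "q * c / - (s * a) = - (e * (q / b))"
    "s * a / c = e * b" "- (s * a) / c = - (e * b)" "- c / c = - 1" "q * c / - c = - q"
    using par_nz s0 q0 ee c0 by (simp_all add: c_def over_e \<tau>_def power2_eq_square)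
  have ok: "qpoch_inf c q \<noteq> 0" using cross_pairs e by (auto simp: c_def)
  have pme: "qpoch_inf (e * v) q * qpoch_inf (- (e * v)) q = qpoch_inf v q * qpoch_inf (- v) q" for v
    using e by (auto simp: mult.commute)
  have pmk: "qpoch (e * v) q k * qpoch (- (e * v)) q k = qpoch v q k * qpoch (- v) q k" for v k
    using e by (auto simp: mult.commute)
  have p: "phi [c, c / X, q * c / (s * a), q * c / - (s * a), q * c / (q * a^2 / b^2)] [q * c / x, q * c / y, q * c / z, q * c / - c] q q
     = phi (pm (q / b) @ [e * s * a / b, e * s * b / a, e * s ^ 3 * a ^ 3 / (b * x * y * z)]) (E_lower q s a b x y z e) q q"
  proof (rule phi_eqI)
    fix k
    have "qpochs [c, c / X, q * c / (s * a), q * c / - (s * a), q * c / (q * a^2 / b^2)] q k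
       = (qpoch (e * (q / b)) q k * qpoch (- (e * (q / b))) q k) * (qpoch c q k * (qpoch (e * s * b / a) q k * qpoch (c / X) q k))"
      unfolding up qpochs_Cons qpochs_Nil by (simp add: mult_ac)
    also have "\<dots> = qpochs (pm (q / b) @ [e * s * a / b, e * s * b / a, e * s ^ 3 * a ^ 3 / (b * x * y * z)]) q k"
      unfolding pmk arg(2) unfolding arg(1) by (simp add: pm_def)
    finally show "qpochs [c, c / X, q * c / (s * a), q * c / - (s * a), q * c / (q * a^2 / b^2)] q k = \<dots>" .
    show "qpochs [q * c / x, q * c / y, q * c / z, q * c / - c] q k = qpochs (E_lower q s a b x y z e) q k"
      unfolding up oc(2)[of x] oc(2)[of y] oc(2)[of z] by (simp add: E_lower_def mult_ac)
  qed
  have "pole_term q h X (s * a) (- (s * a)) (q * a^2 / b^2) c x y z (- c)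
    = theta (h * c) q * theta (h * (X / c)) q * ((qpoch_inf (e * b) q * qpoch_inf (- (e * b)) q) * qpoch_inf c q) /
      (qpoch_inf c q * qpochs_inf [c / X, x / c, y / c, z / c] q * (2 * qpoch_inf (- q) q)) *
      phi (pm (q / b) @ [e * s * a / b, e * s * b / a, e * s ^ 3 * a ^ 3 / (b * x * y * z)]) (E_lower q s a b x y z e) q q"
    unfolding pole_term_def p unfolding up bc qpochs_inf_Cons qpochs_inf_Nil qpoch_inf_minus_one by (simp add: mult_ac)
  also have "\<dots> = qpochs_inf (pm b) q / (2 * qpochs_inf [- q] q) * E_term q s a b h x y z e"
    unfolding pme E_term_def thetas_two arg(2-4)[symmetric] E_denom_def oc(1)[symmetric]
    using ok by (simp add: pm_def mult_ac)
  finally show ?thesis by (simp add: c_def)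
qed

lemma inner_sums:
  "qpoch_inf q q * (\<Sum>i\<in>I5. \<Sum>k. inner.res i k) =
    F_term q s a b h x y z + F_term q s a b h y x z + F_term q s a b h z y x +
    qpochs_inf (pm b) q / (2 * qpochs_inf [- q] q) * (E_term q s a b h x y z 1 + E_term q s a b h x y z (- 1))"
proof -
  have d: "I5 - {0} = {1, 2, 3, 4}" "I5 - {1} = {0, 2, 3, 4}" "I5 - {2} = {0, 1, 3, 4}"
    "I5 - {3} = {0, 1, 2, 4}" "I5 - {4} = {0, 1, 2, 3}" by auto
  let ?p = "pole_term q h X (s * a) (- (s * a)) (q * a^2 / b^2)"
  have "qpoch_inf q q * (\<Sum>k. inner.res 0 k) = ?p x y z \<tau> (- \<tau>)"
    by (rule inner_sum) (simp_all only: d, use par_nz xyz_gen xyzX_gen in \<open>simp_all add: nth_values\<close>)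
  moreover have "qpoch_inf q q * (\<Sum>k. inner.res 1 k) = ?p y x z \<tau> (- \<tau>)"
    by (rule inner_sum) (simp_all only: d, use par_nz xyz_gen xyzX_gen in \<open>simp_all add: nth_values\<close>)
  moreover have "qpoch_inf q q * (\<Sum>k. inner.res 2 k) = ?p z y x \<tau> (- \<tau>)"
    by (rule inner_sum) (simp_all only: d, use par_nz xyz_gen xyzX_gen in \<open>simp_all add: nth_values mult_ac\<close>)
  moreover have "qpoch_inf q q * (\<Sum>k. inner.res 3 k) = ?p (1 * \<tau>) x y z (- (1 * \<tau>))"
    by (rule inner_sum) (simp_all only: d, use \<tau>0 cross_pairs in \<open>simp_all add: nth_values\<close>)
  moreover have "qpoch_inf q q * (\<Sum>k. inner.res 4 k) = ?p (- 1 * \<tau>) x y z (- (- 1 * \<tau>))"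
    by (rule inner_sum) (simp_all only: d, use \<tau>0 cross_pairs in \<open>simp_all add: nth_values\<close>)
  moreover have "(\<Sum>i\<in>I5. \<Sum>k. inner.res i k) = (\<Sum>k. inner.res 0 k) + (\<Sum>k. inner.res 1 k) + (\<Sum>k. inner.res 2 k) + (\<Sum>k. inner.res 3 k) + (\<Sum>k. inner.res 4 k)"
    by simp
  moreover have "F_term q s a b h x y z = ?p x y z \<tau> (- \<tau>)" "F_term q s a b h y x z = ?p y x z \<tau> (- \<tau>)"
    "F_term q s a b h z y x = ?p z y x \<tau> (- \<tau>)"
    by (rule F_term_eq_pole_term; use par_nz in simp)+
  moreover note E_term_eq_pole_term[OF disjI1[OF refl]] E_term_eq_pole_term[OF disjI2[OF refl]]
  ultimately show ?thesis
    by (simp only: distrib_left add.assoc)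
qed

theorem vwp_transformation:
  "suminf (vwp_term q b x y z a (q^3 * a^6 / (b * x * y * z)^2)) / (1 - a^2) = residue_side q s b h x y z a"
proof -
  define t where "t = q * a^2 / (b^2 * X^2)"
  define \<kappa> where "\<kappa> = qpochs_inf [q * a^2 / x, q * a^2 / y, q * a^2 / z] q / (qpochs_inf [x, y, z] q * den (1 / X))"
  define C where "C n = vwp_weight (a^2) (b^2) (q^2) n" for n
  define R where "R n = qpochs [x, y, z] q n / qpochs [q * a^2 / x, q * a^2 / y, q * a^2 / z] q n" for n
  define G where "G = F_term q s a b h x y z + F_term q s a b h y x z + F_term q s a b h z y x +
      qpochs_inf (pm b) q / (2 * qpochs_inf [- q] q) *
      (E_term q s a b h x y z 1 + E_term q s a b h x y z (- 1))"
  have d1: "den (1 / X) \<noteq> 0" using den_nonzero[of "1 / X" 0] by simp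
  have \<kappa>0: "\<kappa> \<noteq> 0" using d1 alpha_gen xyz_gen by (simp add: \<kappa>_def)
  have t_eq: "t = q^3 * a^6 / (b * x * y * z)^2"
    using par_nz q0 unfolding t_def X_def
    by (simp add: power_divide power_mult_distrib field_simps) (simp add: power2_eq_square power3_eq_cube eval_nat_numeral)
  have t1: "norm t < 1"
  proof -
    have "norm ((b * x * y * z)^2) > 0" using par_nz by simp
    thus ?thesis using conv by (simp add: t_eq norm_divide norm_power)
  qed
  have pq: "a^2 * q^2 / b^2 = (q * a / b)^2" by (simp add: power_mult_distrib power_divide mult.commute)
  have low: "qpoch_inf (q * a / b) q * qpoch_inf (- (q * a / b)) q = qpoch_inf (a^2 * q^2 / b^2) (q^2)"
    unfolding pq by (rule qpoch_inf_pm[OF q1])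
  have up: "qpoch_inf (a^2) (q^2) = (1 - a^2) * (qpoch_inf (q * a) q * qpoch_inf (- (q * a)) q)"
    using qpoch_inf_split[OF norm_sq_less_1[OF q1], of "a^2" 1] qpoch_inf_pm[OF q1, of "q * a"]
    by (simp add: qpoch_Suc power_mult_distrib mult.commute)
  have low0: "qpoch_inf (a^2 * q^2 / b^2) (q^2) \<noteq> 0" unfolding low[symmetric] using low_ok by simp
  have tau2: "qpoch_inf (q * a^2 / b^2) (q^2) \<noteq> 0"
    using a_square_pm(2)[of 1] cross_pairs(1,2) by auto
  have main: "(\<Sum>n. C n * t ^ n * Lam (pn (2 * n))) = qpoch_inf (a^2) (q^2) / qpoch_inf (a^2 * q^2 / b^2) (q^2) * Lam (kernel (b^2))"
    unfolding C_def t_def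
    by (rule vwp_sum_eq_Lam) (use par_nz t1 low0 tau2 alpha_ok(2) in \<open>simp_all add: t_def over_X(8)\<close>)
  have Lk: "theta h q * theta (h * X) q * Lam (kernel (b^2)) = G"
    unfolding G_def inner_sums[symmetric] outer_sum[symmetric] inner.sum_inner_eq_sum_outer ..
  have th: "theta h q \<noteq> 0" "theta (h * X) q \<noteq> 0" using theta_ok by (simp_all add: X_def)
  have A: "(\<Sum>n. C n * R (2 * n) * t ^ n) * \<kappa> = (\<Sum>n. C n * t ^ n * Lam (pn (2 * n)))"
  proof -
    have "C n * t ^ n * Lam (pn (2 * n)) = \<kappa> * (C n * R (2 * n) * t ^ n)" for n
      unfolding Lam_pn R_def \<kappa>_def by (simp only: mult_ac)
    hence e: "(\<lambda>n. C n * t ^ n * Lam (pn (2 * n))) = (\<lambda>n. \<kappa> * (C n * R (2 * n) * t ^ n))" by blast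
    have "bdd2 (\<lambda>n N. C n * (qpoch x q (2 * n) * (qpoch y q (2 * n) * qpoch z q (2 * n)) *
        (inverse (qpoch (q * a^2 / x) q (2 * n)) * (inverse (qpoch (q * a^2 / y) q (2 * n)) * inverse (qpoch (q * a^2 / z) q (2 * n))))))"
    proof -
      have bq: "bdd2 (\<lambda>n N. qpoch w q (2 * n))" for w
        using bdd2_qpoch[OF q1, of w "\<lambda>_ _. 0" "\<lambda>n _. 2 * n"] by simp
      show ?thesis
        unfolding C_def
        by (intro bdd2_mult[OF bdd2_vwp_weights[OF norm_sq_less_1[OF q1] low0]] bdd2_mult bq
            bdd2_inverse_qpoch_base q1 alpha_gen)
    qed
    then obtain M where M: "\<And>n. norm (C n * R (2 * n)) \<le> M"
      unfolding bdd2_def R_def by (auto simp: divide_inverse mult.assoc)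
    have "summable (\<lambda>n. C n * R (2 * n) * t ^ n)"
    proof (rule summable_comparison_test'[of "\<lambda>n. M * norm t ^ n" 0])
      show "summable (\<lambda>n. M * norm t ^ n)" using t1 by (intro summable_mult summable_geometric) simp
      show "norm (C n * R (2 * n) * t ^ n) \<le> M * norm t ^ n" for n
        unfolding norm_mult[of _ "t ^ n"] norm_power by (rule mult_right_mono[OF M]) simp
    qed
    thus ?thesis unfolding e by (simp add: suminf_mult)
  qed
  have S: "(\<Sum>n. C n * R (2 * n) * t ^ n) =
      qpoch_inf (a^2) (q^2) / qpoch_inf (a^2 * q^2 / b^2) (q^2) * (G / (theta h q * theta (h * X) q)) / \<kappa>"
    proof -
    have L: "Lam (kernel (b^2)) = G / (theta h q * theta (h * X) q)" unfolding Lk[symmetric] using th by simp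
    show ?thesis unfolding L[symmetric] nonzero_eq_divide_eq[OF \<kappa>0] A by (rule main)
  qed
  have dX: "den (1 / X) = qpoch_inf (x / X) q * qpoch_inf (y / X) q * qpoch_inf (z / X) q"
    by (simp add: den_def)
  have \<kappa>i: "1 / \<kappa> = qpochs_inf [x, y, z, q * a^2 / (x * y), q * a^2 / (x * z), q * a^2 / (y * z)] q / qpochs_inf [q * a^2 / x, q * a^2 / y, q * a^2 / z] q"
    unfolding \<kappa>_def dX over_X(1-3)
    by (simp only: qpochs_inf_Cons qpochs_inf_Nil mult_1_right mult_1_left divide_divide_eq_right mult_ac)
  have "(\<Sum>n. C n * R (2 * n) * t ^ n) / (1 - a^2) =
      (qpoch_inf (a^2) (q^2) / (1 - a^2)) / qpoch_inf (a^2 * q^2 / b^2) (q^2) * (G / (theta h q * theta (h * X) q)) * (1 / \<kappa>)"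
    unfolding S by simp
  also have "qpoch_inf (a^2) (q^2) / (1 - a^2) = qpoch_inf (q * a) q * qpoch_inf (- (q * a)) q"
    unfolding up using one_ne by simp
  finally show ?thesis
    unfolding \<kappa>i low[symmetric] residue_side_def vwp_term_def[abs_def] C_def R_def t_eq G_def[symmetric] thetas_two X_def[symmetric]
    by (simp add: pm_def mult_ac)
qed

end

section \<open>Removing the genericity assumptions\<close>

text \<open>Shifted factorials to the base \<open>q\<close> and of length \<open>2 n\<close> become pairs to the base \<open>q^2\<close>, so that the left-hand side is
  a combination of two series of the form \<open>phi\<close>.  This gives its continuity in \<open>a\<close>.\<close>

definition vwp_lower :: "complex \<Rightarrow> complex \<Rightarrow> complex \<Rightarrow> complex \<Rightarrow> complex \<Rightarrow> complex \<Rightarrow> complex list" where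
  "vwp_lower q b x y z a = [a^2 * q^2 / b^2, q * a^2 / x, q * a^2 / x * q, q * a^2 / y, q * a^2 / y * q, q * a^2 / z, q * a^2 / z * q]"

definition vwp_phi :: "complex \<Rightarrow> complex \<Rightarrow> complex \<Rightarrow> complex \<Rightarrow> complex \<Rightarrow> complex \<Rightarrow> complex \<Rightarrow> complex" where
  "vwp_phi q b x y z a t =
     phi [a^2, b^2, x, x * q, y, y * q, z, z * q] (vwp_lower q b x y z a) (q^2) t"

lemma vwp_lower_nonzero:
  assumes "norm q < 1" "qpoch_inf (q * a / b) q \<noteq> 0" "qpoch_inf (- (q * a / b)) q \<noteq> 0"
    "qpoch_inf (q * a^2 / x) q \<noteq> 0" "qpoch_inf (q * a^2 / y) q \<noteq> 0" "qpoch_inf (q * a^2 / z) q \<noteq> 0"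
  shows "\<forall>w\<in>set (vwp_lower q b x y z a). qpoch_inf w (q^2) \<noteq> 0"
proof -
  have e: "a^2 * q^2 / b^2 = (q * a / b)^2" by (simp add: power_mult_distrib power_divide mult.commute)
  have "qpoch_inf (a^2 * q^2 / b^2) (q^2) \<noteq> 0"
    unfolding e qpoch_inf_pm[OF assms(1), symmetric] using assms by simp
  moreover have h: "qpoch_inf w (q^2) \<noteq> 0 \<and> qpoch_inf (w * q) (q^2) \<noteq> 0" if "qpoch_inf w q \<noteq> 0" for w
    using qpoch_inf_square_base[OF assms(1), of w] that by auto
  ultimately show ?thesis
    using h[OF assms(4)] h[OF assms(5)] h[OF assms(6)]
    by (simp only: vwp_lower_def list.set ball_simps ball_empty simp_thms not_False_eq_True)
qed

lemma vwp_sum_eq_phi: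
  assumes "norm q < 1" "qpoch_inf (q * a / b) q \<noteq> 0" "qpoch_inf (- (q * a / b)) q \<noteq> 0"
    "qpoch_inf (q * a^2 / x) q \<noteq> 0" "qpoch_inf (q * a^2 / y) q \<noteq> 0" "qpoch_inf (q * a^2 / z) q \<noteq> 0"
    and t: "norm t < 1"
  shows "suminf (vwp_term q b x y z a t) = vwp_phi q b x y z a t - a^2 * vwp_phi q b x y z a (q ^ 4 * t)"
    and "summable (vwp_term q b x y z a t)"
proof -
  define As where "As = [a^2, b^2, x, x * q, y, y * q, z, z * q]"
  define Bs where "Bs = vwp_lower q b x y z a"
  have Bs: "\<forall>w\<in>set Bs. qpoch_inf w (q^2) \<noteq> 0"
    unfolding Bs_def by (rule vwp_lower_nonzero[OF assms(1-6)])
  have summand: "vwp_term q b x y z a t n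
    = qpochs As (q^2) n / qpochs (q^2 # Bs) (q^2) n * t ^ n
      - a^2 * (qpochs As (q^2) n / qpochs (q^2 # Bs) (q^2) n * (q ^ 4 * t) ^ n)" for n
  proof -
    have R: "(qpochs [a^2, b^2] (q^2) n / qpochs [q^2, a^2 * q^2 / b^2] (q^2) n) *
      (qpochs [x, y, z] q (2 * n) / qpochs [q * a^2 / x, q * a^2 / y, q * a^2 / z] q (2 * n))
      = qpochs As (q^2) n / qpochs (q^2 # Bs) (q^2) n"
      unfolding As_def Bs_def vwp_lower_def qpochs_Cons qpochs_Nil qpoch_square_base[symmetric] by (simp add: mult_ac)
    have e: "(q ^ 4 * t) ^ n = (q^2) ^ (2 * n) * t ^ n"
      by (simp add: power_mult_distrib power_mult[symmetric])
    have "(1 - c * d) * U * V * w = U * V * w - c * (U * V * (d * w))" for c d U V w :: complex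
      by (simp add: algebra_simps)
    thus ?thesis unfolding vwp_term_def vwp_weight_def e R[symmetric] .
  qed
  have n4: "norm (q ^ 4 * t) < 1"
  proof -
    have "norm (q ^ 4 * t) \<le> norm t"
      unfolding norm_mult norm_power using assms(1) by (intro mult_left_le_one_le power_le_one) auto
    thus ?thesis using t by simp
  qed
  have s: "summable (\<lambda>n. qpochs As (q^2) n / qpochs (q^2 # Bs) (q^2) n * w ^ n)" if "norm w < 1" for w
    by (rule summable_norm_cancel[OF phi_summable[OF norm_sq_less_1[OF assms(1)] Bs that]])
  show "summable (vwp_term q b x y z a t)"
    unfolding summand by (rule summable_diff[OF s[OF t] summable_mult[OF s[OF n4]]])
  show "suminf (vwp_term q b x y z a t) = vwp_phi q b x y z a t - a^2 * vwp_phi q b x y z a (q ^ 4 * t)"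
    unfolding summand vwp_phi_def phi_def As_def[symmetric] Bs_def[symmetric]
    by (simp only: suminf_mult[OF s[OF n4], symmetric] suminf_diff[OF s[OF t] summable_mult[OF s[OF n4]]])
qed

text \<open>The two square roots of \<open>\<alpha>\<close> in a very-well-poised series only contribute
  \<open>(1 - \<alpha> p^(2 n)) / (1 - \<alpha>)\<close>.\<close>

lemma W_series_eq_sum:
  assumes one: "1 - a^2 \<noteq> 0"
    and root: "\<And>k. qpoch (csqrt (a^2)) (q^2) k \<noteq> 0" "\<And>k. qpoch (- csqrt (a^2)) (q^2) k \<noteq> 0"
    and summable: "summable (vwp_term q b x y z a t)"
    and q0: "q \<noteq> 0"
  shows "W_series (a^2) [b^2, x, q * x, y, q * y, z, q * z] (q^2) t =
    suminf (vwp_term q b x y z a t) / (1 - a^2)"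
proof -
  define r where "r = csqrt (a^2)"
  define p where "p = q^2"
  have r2: "r^2 = a^2" by (simp add: r_def)
  have low: "p * a^2 / b^2 = a^2 * q^2 / b^2" "p * a^2 / w = q * a^2 / w * q" "p * a^2 / (q * w) = q * a^2 / w" for w
    using q0 by (simp_all add: p_def power2_eq_square)
  have "qpochs (W_upper (a^2) [b^2, x, q * x, y, q * y, z, q * z] p) p n /
      qpochs (p # W_lower (a^2) [b^2, x, q * x, y, q * y, z, q * z] p) p n * t ^ n
    = vwp_term q b x y z a t n / (1 - a^2)" for n
  proof -
    have d0: "qpoch r p n * qpoch (- r) p n \<noteq> 0" using root[of n] by (simp add: r_def p_def)
    have root_ratio: "qpoch (p * r) p n * qpoch (- (p * r)) p n * (1 - a^2)
        = qpoch r p n * qpoch (- r) p n * (1 - a^2 * p ^ (2 * n))"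
    proof -
      have "qpoch (p * r) p n * qpoch (- (p * r)) p n = qpoch (a^2 * p^2) (p^2) n"
        unfolding qpoch_pm by (simp add: power_mult_distrib r2 mult.commute)
      moreover have "qpoch r p n * qpoch (- r) p n = qpoch (a^2) (p^2) n"
        unfolding qpoch_pm r2 ..
      moreover have "qpoch (a^2 * p^2) (p^2) n * (1 - a^2) = qpoch (a^2) (p^2) n * (1 - a^2 * p ^ (2 * n))"
        using qpoch_Suc_left[of "a^2" "p^2" n] qpoch_Suc[of "a^2" "p^2" n]
        unfolding power_mult by (simp add: mult.commute)
      ultimately show ?thesis by simp
    qed
    have gen: "al * (u1 * (u2 * N)) / (pp * (d1 * (d2 * D))) * tt = (m * ((al / pp) * (N / D)) * tt) / o1"
      if "u1 * u2 * o1 = d1 * d2 * m" "d1 * d2 \<noteq> 0" "o1 \<noteq> 0" for al u1 u2 N pp d1 d2 D tt m o1 :: complex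
    proof -
      have "m / o1 = u1 * u2 / (d1 * d2)" using that by (simp add: frac_eq_eq mult_ac)
      hence "(m / o1) * ((al / pp) * (N / D)) * tt = (u1 * u2 / (d1 * d2)) * ((al / pp) * (N / D)) * tt" by simp
      thus ?thesis by (simp add: mult_ac)
    qed
    have "qpochs (W_upper (a^2) [b^2, x, q * x, y, q * y, z, q * z] p) p n /
        qpochs (p # W_lower (a^2) [b^2, x, q * x, y, q * y, z, q * z] p) p n * t ^ n
      = qpoch (a^2) p n * (qpoch (p * r) p n * (qpoch (- (p * r)) p n * qpochs [b^2, x, x * q, y, y * q, z, z * q] p n)) /
        (qpoch p p n * (qpoch r p n * (qpoch (- r) p n * qpochs [a^2 * q^2 / b^2, q * a^2 / x * q, q * a^2 / x,
          q * a^2 / y * q, q * a^2 / y, q * a^2 / z * q, q * a^2 / z] p n))) * t ^ n"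
      by (simp only: W_upper_def W_lower_def pm_def r_def[symmetric] list.map append.simps qpochs_Cons qpochs_Nil low(1) low(2)[of x] low(2)[of y] low(2)[of z]
          mult.commute[of q x] mult.commute[of q y] mult.commute[of q z] low(3)[of x, unfolded mult.commute[of q x]]
          low(3)[of y, unfolded mult.commute[of q y]] low(3)[of z, unfolded mult.commute[of q z]])
    also have "\<dots> = ((1 - a^2 * p ^ (2 * n)) * ((qpoch (a^2) p n / qpoch p p n) * (qpochs [b^2, x, x * q, y, y * q, z, z * q] p n /
        qpochs [a^2 * q^2 / b^2, q * a^2 / x * q, q * a^2 / x, q * a^2 / y * q, q * a^2 / y, q * a^2 / z * q, q * a^2 / z] p n)) * t ^ n) / (1 - a^2)"
      by (rule gen[OF root_ratio d0 one])
    also have "\<dots> = vwp_term q b x y z a t n / (1 - a^2)"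
      unfolding vwp_term_def vwp_weight_def p_def qpochs_Cons qpochs_Nil qpoch_square_base[symmetric] by (simp add: mult_ac)
    finally show ?thesis .
  qed
  thus ?thesis
    unfolding W_series_def phi_def p_def[symmetric]
    using suminf_divide[OF summable, of "1 - a^2"] by simp
qed


subsection \<open>Continuity in the parameter \<open>a\<close>\<close>

lemma isCont_vwp_phi:
  assumes q: "norm q < 1" and nz: "a \<noteq> 0" "b \<noteq> 0" "x \<noteq> 0" "y \<noteq> 0" "z \<noteq> 0"
    and low: "qpoch_inf (q * a / b) q \<noteq> 0" "qpoch_inf (- (q * a / b)) q \<noteq> 0"
      "qpoch_inf (q * a^2 / x) q \<noteq> 0" "qpoch_inf (q * a^2 / y) q \<noteq> 0" "qpoch_inf (q * a^2 / z) q \<noteq> 0"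
    and t: "isCont t a" "norm (t a) < 1"
  shows "isCont (\<lambda>a. vwp_phi q b x y z a (t a)) a"
proof -
  define As :: "(complex \<Rightarrow> complex) list" where
    "As = [\<lambda>a. a^2, \<lambda>_. b^2, \<lambda>_. x, \<lambda>_. x * q, \<lambda>_. y, \<lambda>_. y * q, \<lambda>_. z, \<lambda>_. z * q]"
  define Bs :: "(complex \<Rightarrow> complex) list" where
    "Bs = [\<lambda>a. a^2 * q^2 / b^2, \<lambda>a. q * a^2 / x, \<lambda>a. q * a^2 / x * q, \<lambda>a. q * a^2 / y, \<lambda>a. q * a^2 / y * q,
      \<lambda>a. q * a^2 / z, \<lambda>a. q * a^2 / z * q]"
  have A: "\<forall>f\<in>set As. isCont f a"
    by (simp add: As_def)
  have B1: "\<forall>f\<in>set Bs. isCont f a"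
    using nz by (auto simp: Bs_def intro!: continuous_intros)
  have B2: "\<forall>f\<in>set Bs. qpoch_inf (f a) (q^2) \<noteq> 0"
    using vwp_lower_nonzero[OF q low] by (simp add: Bs_def vwp_lower_def)
  have "isCont (\<lambda>a. phi (map (\<lambda>f. f a) As) (map (\<lambda>f. f a) Bs) (q^2) (t a)) a"
    by (rule isCont_phi[OF norm_sq_less_1[OF q] A _ t]) (use B1 B2 in blast)
  thus ?thesis by (simp add: As_def Bs_def vwp_phi_def vwp_lower_def)
qed

lemma isCont_qpochs_inf:
  assumes "norm q < 1" "\<forall>f\<in>set fs. isCont f u"
  shows "isCont (\<lambda>v. qpochs_inf (map (\<lambda>f. f v) fs) q) u"
  using assms(2) by (induction fs) (auto intro!: continuous_intros isCont_qpoch_inf assms(1))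

lemma isCont_theta:
  assumes "norm q < 1" "isCont f u" "f u \<noteq> 0"
  shows "isCont (\<lambda>v. theta (f v) q) u"
  unfolding theta_alt using assms by (intro continuous_intros isCont_qpoch_inf) auto

lemma qpochs_inf_nonzero_iff: "qpochs_inf as p \<noteq> 0 \<longleftrightarrow> (\<forall>a\<in>set as. qpoch_inf a p \<noteq> 0)"
  by (induction as) auto

lemma phi_denom_ok_imp:
  assumes p: "norm p < 1" and ok: "phi_denom_ok bs p" and b: "b \<in> set bs"
  shows "qpoch_inf b p \<noteq> 0" "qpoch b p k \<noteq> 0"
proof -
  have nz: "qpoch b p k \<noteq> 0" for k
  proof -
    have "qpochs (p # bs) p k \<noteq> 0" using ok unfolding phi_denom_ok_def by blast
    hence "qpochs bs p k \<noteq> 0" by simp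
    thus ?thesis using b by (induction bs) auto
  qed
  thus "qpoch b p k \<noteq> 0" by blast
  show "qpoch_inf b p \<noteq> 0"
  proof
    assume "qpoch_inf b p = 0"
    then obtain k where "b * p ^ k = 1" using qpoch_inf_eq_0_iff[OF p] by blast
    hence "qpoch b p (Suc k) = 0" by (simp add: qpoch_Suc)
    thus False using nz by blast
  qed
qed

lemma isCont_F_term:
  assumes q: "norm q < 1" "q \<noteq> 0" and nz: "a \<noteq> 0" "b \<noteq> 0" "c \<noteq> 0" "v \<noteq> 0" "w \<noteq> 0" "h \<noteq> 0"
    and ok: "qpochs_inf (F_denom q s a b c v w) q \<noteq> 0" "\<forall>d\<in>set (F_lower q s a b c v w). qpoch_inf d q \<noteq> 0"
  shows "isCont (\<lambda>a. F_term q s a b h c v w) a"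
proof -
  define As :: "(complex \<Rightarrow> complex) list" where
    "As = [\<lambda>_. c, \<lambda>a. q * a^2 / (v * w), \<lambda>a. s * c / a, \<lambda>a. - (s * c / a), \<lambda>a. b^2 * c / a^2]"
  define Bs :: "(complex \<Rightarrow> complex) list" where
    "Bs = [\<lambda>_. q * c / v, \<lambda>_. q * c / w, \<lambda>a. s * b * c / a, \<lambda>a. - (s * b * c / a)]"
  define N :: "(complex \<Rightarrow> complex) list" where
    "N = [\<lambda>a. s * a / c, \<lambda>a. - (s * a / c), \<lambda>a. q * a^2 / (b^2 * c)]"
  define D :: "(complex \<Rightarrow> complex) list" where
    "D = [\<lambda>_. c, \<lambda>_. v / c, \<lambda>_. w / c, \<lambda>a. q * a^2 / (v * w), \<lambda>a. s * a / (b * c), \<lambda>a. - (s * a / (b * c))]"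
  have N: "\<forall>f\<in>set N. isCont f a" and D: "\<forall>f\<in>set D. isCont f a" and A: "\<forall>f\<in>set As. isCont f a"
    and B: "\<forall>f\<in>set Bs. isCont f a"
    using nz by (auto simp: N_def D_def As_def Bs_def intro!: continuous_intros)
  have B2: "\<forall>f\<in>set Bs. qpoch_inf (f a) q \<noteq> 0" using ok(2) by (simp add: Bs_def F_lower_def pm_def)
  have P: "isCont (\<lambda>a. phi (map (\<lambda>f. f a) As) (map (\<lambda>f. f a) Bs) q q) a"
    by (rule isCont_phi[OF q(1) A]) (use B B2 q in auto)
  have C: "isCont (\<lambda>a. qpochs_inf (map (\<lambda>f. f a) N) q) a" "isCont (\<lambda>a. qpochs_inf (map (\<lambda>f. f a) D) q) a"
    by (intro isCont_qpochs_inf q N D)+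
  have T: "isCont (\<lambda>a. theta (h * c) q * theta (h * (v * w / (q * a^2))) q) a"
    using nz q by (intro continuous_intros isCont_theta) auto
  have D0: "qpochs_inf (map (\<lambda>f. f a) D) q \<noteq> 0" using ok(1) by (simp add: D_def F_denom_def pm_def)
  have "isCont (\<lambda>a. theta (h * c) q * theta (h * (v * w / (q * a^2))) q * qpochs_inf (map (\<lambda>f. f a) N) q /
      qpochs_inf (map (\<lambda>f. f a) D) q * phi (map (\<lambda>f. f a) As) (map (\<lambda>f. f a) Bs) q q) a"
    by (rule isCont_mult[OF isCont_divide[OF isCont_mult[OF T C(1)] C(2) D0] P])
  thus ?thesis
    unfolding F_term_def thetas_two F_denom_def F_lower_def pm_def
    by (simp add: As_def Bs_def N_def D_def)
qed

lemma isCont_E_term: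
  assumes q: "norm q < 1" "q \<noteq> 0" "s \<noteq> 0" "e \<noteq> 0" and nz: "a \<noteq> 0" "b \<noteq> 0" "x \<noteq> 0" "y \<noteq> 0" "z \<noteq> 0" "h \<noteq> 0"
    and ok: "qpochs_inf (E_denom s a b x y z e) q \<noteq> 0" "\<forall>d\<in>set (E_lower q s a b x y z e). qpoch_inf d q \<noteq> 0"
  shows "isCont (\<lambda>a. E_term q s a b h x y z e) a"
proof -
  define As :: "(complex \<Rightarrow> complex) list" where
    "As = [\<lambda>_. q / b, \<lambda>_. - (q / b), \<lambda>a. e * s * a / b, \<lambda>a. e * s * b / a, \<lambda>a. e * s^3 * a^3 / (b * x * y * z)]"
  define Bs :: "(complex \<Rightarrow> complex) list" where
    "Bs = [\<lambda>_. - q, \<lambda>a. e * s^3 * a / (b * x), \<lambda>a. e * s^3 * a / (b * y), \<lambda>a. e * s^3 * a / (b * z)]"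
  define D :: "(complex \<Rightarrow> complex) list" where
    "D = [\<lambda>a. e * s^3 * a^3 / (b * x * y * z), \<lambda>a. e * b * x / (s * a), \<lambda>a. e * b * y / (s * a), \<lambda>a. e * b * z / (s * a)]"
  have D: "\<forall>f\<in>set D. isCont f a" and A: "\<forall>f\<in>set As. isCont f a" and B: "\<forall>f\<in>set Bs. isCont f a"
    using nz q by (auto simp: D_def As_def Bs_def intro!: continuous_intros)
  have B2: "\<forall>f\<in>set Bs. qpoch_inf (f a) q \<noteq> 0" using ok(2) by (simp add: Bs_def E_lower_def)
  have P: "isCont (\<lambda>a. phi (map (\<lambda>f. f a) As) (map (\<lambda>f. f a) Bs) q q) a"
    by (rule isCont_phi[OF q(1) A]) (use B B2 q in auto)
  have C: "isCont (\<lambda>a. qpochs_inf (map (\<lambda>f. f a) D) q) a"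
    by (intro isCont_qpochs_inf q D)
  have T: "isCont (\<lambda>a. theta (e * h * (s * a / b)) q * theta (e * h * (b * x * y * z / (s^3 * a^3))) q) a"
    using nz q by (intro continuous_intros isCont_theta) auto
  have D0: "qpochs_inf (map (\<lambda>f. f a) D) q \<noteq> 0" using ok(1) by (simp add: D_def E_denom_def)
  have "isCont (\<lambda>a. theta (e * h * (s * a / b)) q * theta (e * h * (b * x * y * z / (s^3 * a^3))) q /
      qpochs_inf (map (\<lambda>f. f a) D) q * phi (map (\<lambda>f. f a) As) (map (\<lambda>f. f a) Bs) q q) a"
    by (rule isCont_mult[OF isCont_divide[OF T C D0] P])
  thus ?thesis
    unfolding E_term_def thetas_two E_denom_def E_lower_def pm_def
    by (simp add: As_def Bs_def D_def)
qed

lemma isCont_residue_side: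
  assumes nonzero: "q \<noteq> 0" "s \<noteq> 0" "a \<noteq> 0" "b \<noteq> 0" "x \<noteq> 0" "y \<noteq> 0" "z \<noteq> 0" "h \<noteq> 0"
    and q: "norm q < 1"
    and theta_ok: "thetas [h, h * (x * y * z / (q * a^2))] q \<noteq> 0"
    and prefactor_ok: "qpochs_inf (pm (q * a / b) @ [q * a^2 / x, q * a^2 / y, q * a^2 / z]) q \<noteq> 0"
    and F_ok: "F_denom_ok q s a b x y z" "F_denom_ok q s a b y x z" "F_denom_ok q s a b z y x"
    and E_ok: "E_denom_ok q s a b x y z 1" "E_denom_ok q s a b x y z (- 1)"
  shows "isCont (residue_side q s b h x y z) a"
proof -
  have F: "isCont (\<lambda>a. F_term q s a b h x y z) a" "isCont (\<lambda>a. F_term q s a b h y x z) a"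
    "isCont (\<lambda>a. F_term q s a b h z y x) a"
    by (rule isCont_F_term[OF q nonzero(1,3,4)];
        use nonzero F_ok phi_denom_ok_imp(1)[OF q] in \<open>auto simp: F_denom_ok_def\<close>)+
  have E: "isCont (\<lambda>a. E_term q s a b h x y z 1) a" "isCont (\<lambda>a. E_term q s a b h x y z (- 1)) a"
    by (rule isCont_E_term[OF q nonzero(1,2)];
        use nonzero E_ok phi_denom_ok_imp(1)[OF q] in \<open>auto simp: E_denom_ok_def\<close>)+
  have N: "isCont (\<lambda>a. qpochs_inf (pm (q * a) @ [x, y, z, q * a^2 / (x * y), q * a^2 / (x * z), q * a^2 / (y * z)]) q) a"
    using isCont_qpochs_inf[OF q, of "[\<lambda>a. q * a, \<lambda>a. - (q * a), \<lambda>_. x, \<lambda>_. y, \<lambda>_. z,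
        \<lambda>a. q * a^2 / (x * y), \<lambda>a. q * a^2 / (x * z), \<lambda>a. q * a^2 / (y * z)]" a] nonzero
    by (simp add: pm_def)
  have D: "isCont (\<lambda>a. qpochs_inf (pm (q * a / b) @ [q * a^2 / x, q * a^2 / y, q * a^2 / z]) q) a"
    using isCont_qpochs_inf[OF q, of "[\<lambda>a. q * a / b, \<lambda>a. - (q * a / b), \<lambda>a. q * a^2 / x, \<lambda>a. q * a^2 / y, \<lambda>a. q * a^2 / z]" a] nonzero
    by (simp add: pm_def)
  have T: "isCont (\<lambda>a. thetas [h, h * (x * y * z / (q * a^2))] q) a"
    unfolding thetas_two using nonzero q by (intro isCont_mult isCont_theta) auto
  have "thetas [h, h * (x * y * z / (q * a^2))] q *
        qpochs_inf (pm (q * a / b) @ [q * a^2 / x, q * a^2 / y, q * a^2 / z]) q \<noteq> 0"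
    using theta_ok prefactor_ok by simp
  thus ?thesis
    unfolding residue_side_def
    by (intro isCont_mult[OF isCont_divide[OF N isCont_mult[OF T D]]] isCont_add isCont_mult[OF continuous_const] F E)
qed

text \<open>All exceptional values of \<open>a\<close> are zeros of such products.\<close>

lemma countable_qpoch_inf_zeros:
  assumes q: "norm q < 1" "q \<noteq> 0" and C: "C \<noteq> 0" and m: "m > 0"
  shows "countable {a. qpoch_inf (C * a ^ m) q = 0}" "countable {a. qpoch_inf (C / a ^ m) q = 0}"
proof -
  have roots: "countable (\<Union>k :: nat. {a. a ^ m = D k})" for D :: "nat \<Rightarrow> complex"
    using finite_nth_roots[OF m] by (simp add: countable_finite)
  have "{a. qpoch_inf (C * a ^ m) q = 0} \<subseteq> (\<Union>k. {a. a ^ m = 1 / (C * q ^ k)})"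
  proof
    fix a assume "a \<in> {a. qpoch_inf (C * a ^ m) q = 0}"
    then obtain k where "C * a ^ m * q ^ k = 1" using qpoch_inf_eq_0_iff[OF q(1)] by blast
    hence "a ^ m = 1 / (C * q ^ k)" using C q by (simp add: field_simps)
    thus "a \<in> (\<Union>k. {a. a ^ m = 1 / (C * q ^ k)})" by blast
  qed
  thus "countable {a. qpoch_inf (C * a ^ m) q = 0}" by (rule countable_subset[OF _ roots])
  have "{a. qpoch_inf (C / a ^ m) q = 0} \<subseteq> (\<Union>k. {a. a ^ m = C * q ^ k})"
  proof
    fix a assume "a \<in> {a. qpoch_inf (C / a ^ m) q = 0}"
    then obtain k where k: "C / a ^ m * q ^ k = 1" using qpoch_inf_eq_0_iff[OF q(1)] by blast
    hence "a ^ m \<noteq> 0" by auto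
    hence "a ^ m = C * q ^ k" using k by (simp add: field_simps)
    thus "a \<in> (\<Union>k. {a. a ^ m = C * q ^ k})" by blast
  qed
  thus "countable {a. qpoch_inf (C / a ^ m) q = 0}" by (rule countable_subset[OF _ roots])
qed

lemma eventually_nonzero:
  fixes f :: "complex \<Rightarrow> complex"
  assumes "isCont f u" "f u \<noteq> 0"
  shows "\<forall>\<^sub>F v in nhds u. f v \<noteq> 0"
  using assms by (intro tendsto_imp_eventually_ne[of f "f u"]) (simp_all add: isCont_def tendsto_nhds_iff)

text \<open>If the values at \<open>u\<close> were different, they would differ on a ball around \<open>u\<close>, which is uncountable.\<close>

lemma eq_of_eq_off_countable:
  fixes f g :: "complex \<Rightarrow> complex"
  assumes f: "isCont f u" and g: "isCont g u" and B: "countable B"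
    and eq: "\<forall>\<^sub>F v in nhds u. v \<notin> B \<longrightarrow> f v = g v"
  shows "f u = g u"
proof (rule ccontr)
  assume "f u \<noteq> g u"
  hence "\<forall>\<^sub>F v in nhds u. f v - g v \<noteq> 0"
    using f g by (intro eventually_nonzero continuous_intros) auto
  with eq have "\<forall>\<^sub>F v in nhds u. v \<in> B" by eventually_elim auto
  then obtain r where r: "r > 0" "\<And>v. dist v u < r \<Longrightarrow> v \<in> B"
    unfolding eventually_nhds_metric by blast
  hence "ball u r \<subseteq> B" by (auto simp: dist_commute)
  hence "countable (ball u r)" using B countable_subset by blast
  thus False using uncountable_ball[OF r(1)] by blast
qed


theorem theorem9p5:
  fixes q s a b x y z h :: complex
  assumes nonzero: "q \<noteq> 0" "a \<noteq> 0" "b \<noteq> 0" "x \<noteq> 0" "y \<noteq> 0" "z \<noteq> 0" "h \<noteq> 0"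
    and q: "norm q < 1"
    and s: "s^2 = q"
    and conv: "norm (q^3 * a^6) < norm (b * x * y * z) ^ 2"
    and W_ok: "phi_denom_ok (W_lower (a^2) [b^2, x, q * x, y, q * y, z, q * z] (q^2)) (q^2)"
    and theta_ok: "thetas [h, h * (x * y * z / (q * a^2))] q \<noteq> 0"
    and prefactor_ok:
      "qpochs_inf (pm (q * a / b) @ [q * a^2 / x, q * a^2 / y, q * a^2 / z]) q \<noteq> 0"
    and F_ok: "F_denom_ok q s a b x y z" "F_denom_ok q s a b y x z" "F_denom_ok q s a b z y x"
    and minus_q_ok: "qpochs_inf [- q] q \<noteq> 0"
    and E_ok: "E_denom_ok q s a b x y z 1" "E_denom_ok q s a b x y z (- 1)"
  shows "W_series (a^2) [b^2, x, q * x, y, q * y, z, q * z] (q^2)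
           (q^3 * a^6 / (b * x * y * z)^2) =
         qpochs_inf
           (pm (q * a) @ [x, y, z, q * a^2 / (x * y), q * a^2 / (x * z), q * a^2 / (y * z)]) q /
         (thetas [h, h * (x * y * z / (q * a^2))] q *
          qpochs_inf (pm (q * a / b) @ [q * a^2 / x, q * a^2 / y, q * a^2 / z]) q) *
         (F_term q s a b h x y z + F_term q s a b h y x z + F_term q s a b h z y x +
          qpochs_inf (pm b) q / (2 * qpochs_inf [- q] q) *
          (E_term q s a b h x y z 1 + E_term q s a b h x y z (- 1)))"
proof -
  have s0: "s \<noteq> 0" using s nonzero by auto
  define t where "t a = q^3 * a^6 / (b * x * y * z)^2" for a
  define lhs where "lhs a = (vwp_phi q b x y z a (t a) - a^2 * vwp_phi q b x y z a (q ^ 4 * t a)) / (1 - a^2)" for a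
  define rhs where "rhs = residue_side q s b h x y z"
  \<comment> \<open>\<open>fs\<close>: the parameters of the denominators that vary with \<open>a\<close>; \<open>gs\<close>: those of the
    genericity conditions\<close>
  define fs :: "(complex \<Rightarrow> complex) list" where "fs =
    [\<lambda>a. q * a / b, \<lambda>a. - (q * a / b), \<lambda>a. q * a^2 / x, \<lambda>a. q * a^2 / y, \<lambda>a. q * a^2 / z,
     \<lambda>a. q * a^2 / (y * z), \<lambda>a. q * a^2 / (x * z), \<lambda>a. q * a^2 / (y * x),
     \<lambda>a. s * a / (b * x), \<lambda>a. s * a / (b * y), \<lambda>a. s * a / (b * z),
     \<lambda>a. - (s * a / (b * x)), \<lambda>a. - (s * a / (b * y)), \<lambda>a. - (s * a / (b * z)),
     \<lambda>a. b * x / (s * a), \<lambda>a. b * y / (s * a), \<lambda>a. b * z / (s * a),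
     \<lambda>a. - (b * x / (s * a)), \<lambda>a. - (b * y / (s * a)), \<lambda>a. - (b * z / (s * a)),
     \<lambda>a. s^3 * a^3 / (b * x * y * z), \<lambda>a. - (s^3 * a^3 / (b * x * y * z)),
     \<lambda>a. h * (x * y * z / (q * a^2)), \<lambda>a. q / (h * (x * y * z / (q * a^2)))]"
  define gs :: "(complex \<Rightarrow> complex) list" where "gs =
    [\<lambda>a. x * y * z / (q * a^2), \<lambda>a. q * a^2 / (x * y * z), \<lambda>a. s * a / b, \<lambda>a. - (s * a / b),
     \<lambda>a. q * a^2, \<lambda>a. q * a^2 * (q * a^2) / (x * y * z)]"
  define bad where "bad = (\<Union>f\<in>set gs. {a. qpoch_inf (f a) q = 0})"
  have bad: "countable bad"
  proof -
    note zeros = countable_qpoch_inf_zeros[OF q nonzero(1)]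
    have "countable {a. qpoch_inf (f a) q = 0}" if "f \<in> set gs" for f
      using that nonzero s0 zeros(2)[of "x * y * z / q" 2] zeros(1)[of "q / (x * y * z)" 2] zeros(1)[of "s / b" 1]
        zeros(1)[of "- (s / b)" 1] zeros(1)[of q 2] zeros(1)[of "q * q / (x * y * z)" 4]
      by (auto simp: gs_def power2_eq_square power4_eq_xxxx mult_ac)
    thus ?thesis unfolding bad_def by (intro countable_UN[OF countable_finite[OF finite_set]])
  qed
  have F1: "qpochs_inf (F_denom q s a b x y z) q \<noteq> 0" "qpochs_inf (F_denom q s a b y x z) q \<noteq> 0"
    "qpochs_inf (F_denom q s a b z y x) q \<noteq> 0"
    using F_ok by (simp_all add: F_denom_ok_def)
  have E1: "qpochs_inf (E_denom s a b x y z 1) q \<noteq> 0" "qpochs_inf (E_denom s a b x y z (- 1)) q \<noteq> 0"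
    using E_ok by (simp_all add: E_denom_ok_def)
  note list_simps = qpochs_inf_nonzero_iff F_denom_def E_denom_def pm_def
  have const_ok: "qpoch_inf x q \<noteq> 0" "qpoch_inf y q \<noteq> 0" "qpoch_inf z q \<noteq> 0"
      "qpoch_inf (y / x) q \<noteq> 0" "qpoch_inf (z / x) q \<noteq> 0" "qpoch_inf (x / y) q \<noteq> 0"
      "qpoch_inf (z / y) q \<noteq> 0" "qpoch_inf (y / z) q \<noteq> 0" "qpoch_inf (x / z) q \<noteq> 0"
      "qpoch_inf (- q) q \<noteq> 0" "theta h q \<noteq> 0"
    using F1 minus_q_ok theta_ok by (simp_all add: list_simps thetas_two)
  have low: "qpoch_inf (q * a / b) q \<noteq> 0" "qpoch_inf (- (q * a / b)) q \<noteq> 0"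
      "qpoch_inf (q * a^2 / x) q \<noteq> 0" "qpoch_inf (q * a^2 / y) q \<noteq> 0" "qpoch_inf (q * a^2 / z) q \<noteq> 0"
    using prefactor_ok by (simp_all add: list_simps)
  have fs_ok: "\<forall>f\<in>set fs. qpoch_inf (f a) q \<noteq> 0"
    using low F1 E1 theta_ok by (simp add: fs_def list_simps thetas_two theta_alt)
  have fs_cont: "\<forall>f\<in>set fs. isCont f a"
    using nonzero s0 by (auto simp: fs_def intro!: continuous_intros)
  have root: "qpoch (csqrt (a^2)) (q^2) k \<noteq> 0" "qpoch (- csqrt (a^2)) (q^2) k \<noteq> 0" for k
    using phi_denom_ok_imp(2)[OF norm_sq_less_1[OF q] W_ok] by (simp_all add: W_lower_def pm_def)
  have one: "1 - a^2 \<noteq> 0"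
  proof -
    have "1 - a^2 = (1 - csqrt (a^2)) * (1 + csqrt (a^2))"
      by (simp add: algebra_simps power2_csqrt flip: power2_eq_square)
    thus ?thesis using root[of 1] by (simp add: qpoch_Suc)
  qed
  have conv_iff: "norm (q^3 * v^6) < norm (b * x * y * z) ^ 2 \<longleftrightarrow> norm (t v) < 1" for v
  proof -
    have "norm ((b * x * y * z)^2) > 0" using nonzero by simp
    thus ?thesis by (simp add: t_def norm_divide norm_power)
  qed
  have t1: "norm (t a) < 1" using conv by (simp only: conv_iff)
  have t_cont: "isCont t a" unfolding t_def using nonzero by (intro continuous_intros) auto
  have "lhs a = rhs a"
  proof (rule eq_of_eq_off_countable[where f = lhs and g = rhs and u = a, OF _ _ bad])
    have "norm (q ^ 4 * t a) < 1"
    proof -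
      have "norm (q ^ 4 * t a) \<le> norm (t a)"
        unfolding norm_mult norm_power using q by (intro mult_left_le_one_le power_le_one) auto
      thus ?thesis using t1 by simp
    qed
    thus "isCont lhs a"
      unfolding lhs_def using one t1 t_cont nonzero low q
      by (intro continuous_intros isCont_vwp_phi) auto
    show "isCont rhs a"
      unfolding rhs_def by (rule isCont_residue_side) (fact nonzero s0 q theta_ok prefactor_ok F_ok E_ok)+
    have "\<forall>\<^sub>F v in nhds a. \<forall>f\<in>set fs. qpoch_inf (f v) q \<noteq> 0"
      using fs_cont fs_ok by (intro eventually_ball_finite ballI eventually_nonzero isCont_qpoch_inf q) auto
    moreover have "\<forall>\<^sub>F v in nhds a. v \<noteq> 0" "\<forall>\<^sub>F v in nhds a. 1 - v^2 \<noteq> 0"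
      using eventually_nonzero[where f = "\<lambda>v. v" and u = a] eventually_nonzero[where f = "\<lambda>v. 1 - v^2" and u = a] nonzero one by auto
    moreover have "\<forall>\<^sub>F v in nhds a. norm (t v - t a) < 1 - norm (t a)"
      by (rule eventually_norm_diff_less[OF t_cont]) (use t1 in simp)
    ultimately show "\<forall>\<^sub>F v in nhds a. v \<notin> bad \<longrightarrow> lhs v = rhs v"
    proof eventually_elim
      case (elim v)
      show ?case
      proof
        assume "v \<notin> bad"
        hence "\<forall>f\<in>set gs. qpoch_inf (f v) q \<noteq> 0" by (auto simp: bad_def)
        hence gen: "qpoch_inf (x * y * z / (q * v^2)) q \<noteq> 0" "qpoch_inf (q * v^2 / (x * y * z)) q \<noteq> 0"
          "qpoch_inf (s * v / b) q \<noteq> 0" "qpoch_inf (- (s * v / b)) q \<noteq> 0"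
          "qpoch_inf (q * v^2) q \<noteq> 0" "qpoch_inf (q * v^2 * (q * v^2) / (x * y * z)) q \<noteq> 0"
          by (simp_all add: gs_def)
        have tv: "norm (t v) < 1" using elim(4) norm_triangle_ineq2[of "t v" "t a"] by linarith
        interpret nine_parameters q s v b x y z h
        proof
          show "theta (h * (x * y * z / (q * v^2))) q \<noteq> 0"
            unfolding theta_alt using elim(1) by (simp add: fs_def)
          show "norm (q^3 * v^6) < norm (b * x * y * z) ^ 2" unfolding conv_iff by (rule tv)
        next
          fix w assume "w \<in> {x, y, z}"
          thus "qpoch_inf (s * v / (b * w)) q \<noteq> 0" "qpoch_inf (- (s * v / (b * w))) q \<noteq> 0"
            "qpoch_inf (b * w / (s * v)) q \<noteq> 0" "qpoch_inf (- (b * w / (s * v))) q \<noteq> 0"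
            using elim(1) by (auto simp: fs_def)
        qed (fact nonzero q s elim(2,3) const_ok gen | use elim(1) in \<open>simp add: fs_def\<close>)+
        have "rhs v = suminf (vwp_term q b x y z v (t v)) / (1 - v^2)"
          unfolding rhs_def t_def by (rule vwp_transformation[symmetric])
        also have "\<dots> = lhs v"
          unfolding lhs_def by (subst vwp_sum_eq_phi(1)[OF q low_ok tv]) (rule refl)
        finally show "lhs v = rhs v" ..
      qed
    qed
  qed
  moreover have "W_series (a^2) [b^2, x, q * x, y, q * y, z, q * z] (q^2) (t a) = lhs a"
    unfolding lhs_def vwp_sum_eq_phi(1)[OF q low t1, symmetric]
    by (rule W_series_eq_sum[OF one root vwp_sum_eq_phi(2)[OF q low t1] nonzero(1)])
  ultimately show ?thesis unfolding rhs_def residue_side_def t_def by simp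
qed

end
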